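(* Any subgroup $H$ of $PL_o(I)$ which admits a deep tower contains a subgroup isomorphic to $(\wr\mathbf{Z})^{\infty}$.
   Context: $PL_o(I)$ is the group of orientation-preserving piecewise-linear homeomorphisms of $I=[0,1]$ with finitely many breaks in slope, acting on the right. An orbital of $g$ is a connected component of the set of points moved by $g$. A signed orbital of $H$ is a pair $(A,g)$, $g\in H$, $A$ an orbital of $g$. A tower of $H$ is a set of signed orbitals of $H$ with pairwise distinct orbitals which are pairwise comparable under inclusion, ordered by inclusion of orbitals. A tower $T$ is deep if there is an order-preserving injection from the negative integers into $T$, i.e. $T$ contains signed orbitals $(A_{-1},g_{-1}),(A_{-2},g_{-2}),\ldots$ with $\cdots\subsetneq A_{-2}\subsetneq A_{-1}$. For permutation groups $(K,X)$, $(L,Y)$, the permutation wreath product $K\wr L$ is the subgroup of $\mathrm{Sym}(X\times Y)$ generated by the maps $(x,y)\mapsto(x\kappa,y)$, $(x,y')\mapsto(x,y')$ for $y'\neq y$ ($\kappa\in K$, $y\in Y$) and $(x,y)\mapsto(x,y\lambda)$ ($\lambda\in L$). Let $P_1=\mathbf{Z}$ acting on $\mathbf{Z}$ by translation and $P_{k+1}=\mathbf{Z}\wr P_k$ (permutation wreath product, $\mathbf{Z}$ acting on itself by translation), with $P_k$ embedded as the top group; $(\wr\mathbf{Z})^{\infty}=\ldots\wr(\mathbf{Z}\wr(\mathbf{Z}\wr\mathbf{Z}))$ is the ascending union of the $P_k$. *)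

theory Defs
  imports "HOL-Analysis.Analysis" "HOL-Algebra.Algebra"
begin

definition PL_piecewise_linear :: "(real \<Rightarrow> real) \<Rightarrow> bool" where
  "PL_piecewise_linear f \<longleftrightarrow>
     (\<exists>ts :: real list. length ts \<ge> 2 \<and> sorted_wrt (<) ts \<and> hd ts = 0 \<and> last ts = 1 \<and>
        (\<forall>i. Suc i < length ts \<longrightarrow>
           (\<exists>a b. \<forall>x \<in> {ts ! i .. ts ! Suc i}. f x = a * x + b)))"

definition PLo :: "(real \<Rightarrow> real) set" where
  "PLo = {f. (\<forall>x. x \<notin> {0..1} \<longrightarrow> f x = x)
             \<and> continuous_on {0..1} f
             \<and> strict_mono_on {0..1} f
             \<and> f ` {0..1} = {0..1}
             \<and> PL_piecewise_linear f}"

text \<open>The group acts on the right: the product g h means first g, then h.\<close>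

definition PLo_group :: "(real \<Rightarrow> real) monoid" where
  "PLo_group = \<lparr>carrier = PLo, monoid.mult = (\<lambda>g h. h \<circ> g), one = id\<rparr>"

definition supp :: "(real \<Rightarrow> real) \<Rightarrow> real set" where
  "supp g = {x \<in> {0..1}. g x \<noteq> x}"

definition orbitals :: "(real \<Rightarrow> real) \<Rightarrow> real set set" where
  "orbitals g = components (supp g)"

definition signed_orbitals :: "(real \<Rightarrow> real) set \<Rightarrow> (real set \<times> (real \<Rightarrow> real)) set" where
  "signed_orbitals H = {(A, g). g \<in> H \<and> A \<in> orbitals g}"

definition tower :: "(real \<Rightarrow> real) set \<Rightarrow> (real set \<times> (real \<Rightarrow> real)) set \<Rightarrow> bool" where
  "tower H T \<longleftrightarrow> T \<subseteq> signed_orbitals H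
     \<and> (\<forall>p \<in> T. \<forall>q \<in> T. p \<noteq> q \<longrightarrow> fst p \<noteq> fst q)
     \<and> (\<forall>p \<in> T. \<forall>q \<in> T. fst p \<subseteq> fst q \<or> fst q \<subseteq> fst p)"

definition deep :: "(real set \<times> (real \<Rightarrow> real)) set \<Rightarrow> bool" where
  "deep T \<longleftrightarrow> (\<exists>\<phi> :: int \<Rightarrow> real set \<times> (real \<Rightarrow> real).
      (\<forall>n < 0. \<phi> n \<in> T) \<and> inj_on \<phi> {n. n < 0}
      \<and> (\<forall>m n. m < n \<and> n < 0 \<longrightarrow> fst (\<phi> m) \<subseteq> fst (\<phi> n)))"

text \<open>Concrete model.  P_k acts faithfully on Z^k; we let it act on Z^N (functions
nat => int) on the coordinates 0..k-1, fixing the rest.  Coordinate 0 is the one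
acted on by P_1 (the top group); P_(k+1) = Z wr P_k adds the new (bottom)
coordinate k, whose Z-factors are indexed by the values of coordinates 0..k-1.
The generator wr_gen j y translates coordinate j by 1 at those points whose
coordinates 0..j-1 equal y (a list of length j).  P_k is generated by the
wr_gen j y with j < k, and P_k sits inside P_(k+1) as the top group, so the
ascending union (wr Z)^infinity is the group generated by all wr_gen j y.\<close>

definition wr_gen :: "nat \<Rightarrow> int list \<Rightarrow> (nat \<Rightarrow> int) \<Rightarrow> (nat \<Rightarrow> int)" where
  "wr_gen j y c = (if (\<forall>i < j. c i = y ! i) then c(j := c j + 1) else c)"

definition wr_gens :: "((nat \<Rightarrow> int) \<Rightarrow> (nat \<Rightarrow> int)) set" where
  "wr_gens = {wr_gen j y | j y. length y = j}"

definition WrZ_inf :: "((nat \<Rightarrow> int) \<Rightarrow> (nat \<Rightarrow> int)) monoid" where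
  "WrZ_inf = (BijGroup UNIV) \<lparr>carrier := generate (BijGroup UNIV) wr_gens\<rparr>"

end

theory Submission
  imports Defs
begin

text \<open>
  It suffices to find elements \<open>f 0, f 1, \<dots>\<close> of \<open>H\<close>, none the identity, such that the closure of the
  support of \<open>f (n + 1)\<close> lies in the support of \<open>f n\<close>: a high power \<open>h n\<close> of \<open>f n\<close> then moves the
  support of \<open>f (n + 1)\<close> off itself, together with all its nontrivial iterates, and comparing the
  orbits of points under \<open>h 0, h 1, \<dots>\<close> with the coordinates on which the wreath product acts shows
  that the \<open>h n\<close> generate a copy of it.

  Suppose first that some \<open>x \<in> H\<close> has an orbital of which some \<open>y \<in> H\<close> fixes exactly one end,
  say the left end \<open>l\<close> but not the right end \<open>b\<close>.  A conjugate \<open>c\<close> of the commutator of \<open>x\<close> and \<open>y\<close>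
  moves \<open>b\<close>.  Large powers of \<open>x\<close> and \<open>y\<close> contract intervals towards finitely many points, so some
  word \<open>w\<close> in them contracts, in every component of the joint support, the support of \<open>c\<close> so much
  that it lands either where \<open>c\<close> is trivial or inside one orbital of \<open>c\<close>, and the orbital around \<open>b\<close>
  into itself.  A commutator of \<open>w c w\<^sup>-\<^sup>1\<close> with a power of \<open>c\<close> gets rid of the components of
  the first kind; its conjugates by the powers of \<open>w\<^sup>2\<close> form the required sequence.

  Otherwise any two intersecting orbitals of elements of \<open>H\<close> are equal or strictly nested, and an element
  with an orbital inside a larger orbital of another one has compact support there.  Commutators and
  conjugations then turn a deep tower into one whose members are trivial near any given finite set
  of points.  For \<open>h\<close> with a deep tower inside one of its orbitals, take these points to be the ends of
  the orbitals of \<open>h\<close>: if \<open>g\<close> is the top of the new tower, the commutator of \<open>g\<close> with a power of \<open>h\<close>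
  has support compactly inside that of \<open>h\<close> and still has a deep tower inside one of its orbitals.
\<close>

section \<open>Groups generated by nested displacements\<close>

no_notation m_inv  (\<open>(\<open>open_block notation=\<open>prefix inv\<close>\<close>inv\<index> _)\<close> [81] 80)

section \<open>Integer powers of bijections and the points they move\<close>

definition zpow :: "('a \<Rightarrow> 'a) \<Rightarrow> int \<Rightarrow> 'a \<Rightarrow> 'a" where
  "zpow f k = (if k \<ge> 0 then f ^^ nat k else inv f ^^ nat (- k))"

lemma zpow_0 [simp]: "zpow f 0 = id"
  by (simp add: zpow_def)

lemma zpow_of_nat: "zpow f (int n) = f ^^ n"
  by (simp add: zpow_def)

lemma zpow_minus_of_nat: "zpow f (- int n) = inv f ^^ n"
  by (cases "n = 0") (simp_all add: zpow_def)

lemma zpow_1 [simp]: "zpow f 1 = f"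
  by (simp add: zpow_def)

lemma bij_zpow: "bij f \<Longrightarrow> bij (zpow f k)"
  by (simp add: zpow_def bij_imp_bij_inv)

lemma zpow_plus1:
  assumes "bij f" shows "zpow f (k + 1) = f \<circ> zpow f k"
proof (cases "k \<ge> 0")
  case True
  then show ?thesis by (simp add: zpow_def nat_add_distrib)
next
  case False
  define n where "n = nat (- k - 1)"
  have k: "k = - int (Suc n)" using False by (simp add: n_def)
  have "f \<circ> inv f = id" using assms by (simp add: bij_is_surj flip: surj_iff)
  then have "f \<circ> (inv f \<circ> g) = g" for g :: "'a \<Rightarrow> 'a"
    by (simp add: o_assoc)
  then show ?thesis
    unfolding k zpow_minus_of_nat using zpow_minus_of_nat[of f n] by (simp del: of_nat_Suc add: of_nat_Suc[of n])
qed

lemma zpow_add: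
  assumes "bij f" shows "zpow f (k + l) = zpow f k \<circ> zpow f l"
proof (induction k rule: int_induct[where k = 0])
  case base
  show ?case by simp
next
  case (step1 i)
  have "zpow f (i + 1 + l) = f \<circ> zpow f (i + l)"
    using zpow_plus1[OF assms, of "i + l"] by (simp add: algebra_simps)
  then show ?case by (simp add: step1 zpow_plus1[OF assms] o_assoc)
next
  case (step2 i)
  have "f \<circ> zpow f (i - 1 + l) = zpow f (i + l)"
    using zpow_plus1[OF assms, of "i - 1 + l"] by (simp add: algebra_simps)
  also have "\<dots> = f \<circ> (zpow f (i - 1) \<circ> zpow f l)"
    using step2 zpow_plus1[OF assms, of "i - 1"] by (metis comp_assoc diff_add_cancel)
  finally show ?case
    using assms by (metis bij_is_inj inj_eq comp_apply)
qed

lemma zpow_add': "bij f \<Longrightarrow> zpow f (k + l) x = zpow f k (zpow f l x)"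
  by (simp add: zpow_add)

lemma inv_zpow: "bij f \<Longrightarrow> inv (zpow f k) = zpow f (- k)"
proof (rule inv_unique_comp)
  assume "bij f"
  then show "zpow f k \<circ> zpow f (- k) = id" "zpow f (- k) \<circ> zpow f k = id"
    by (simp_all flip: zpow_add)
qed

lemma zpow_mult:
  assumes "bij f" shows "zpow (zpow f m) k = zpow f (m * k)"
proof (induction k rule: int_induct[where k = 0])
  case base
  show ?case by simp
next
  case (step1 i)
  have "m * (i + 1) = m + m * i" by (simp add: algebra_simps)
  then show ?case
    using zpow_add[OF assms, of m "m * i"] by (simp add: zpow_plus1 bij_zpow assms step1)
next
  case (step2 i)
  have e: "m * i = m + m * (i - 1)" by (simp add: algebra_simps)
  have "zpow f m \<circ> zpow (zpow f m) (i - 1) = zpow (zpow f m) i"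
    using zpow_plus1[OF bij_zpow[OF assms], of m "i - 1"] by simp
  also have "\<dots> = zpow f m \<circ> zpow f (m * (i - 1))"
    using step2 e zpow_add[OF assms] by metis
  finally show ?case
    using bij_zpow[OF assms, of m] by (metis bij_is_inj inj_eq comp_apply)
qed

lemma zpow_fixed:
  assumes "bij f" "f x = x" shows "zpow f k x = x"
proof -
  have fp: "(g ^^ n) x = x" if "g x = x" for g :: "'a \<Rightarrow> 'a" and n
    using that by (induction n) simp_all
  have "inv f x = x" using assms by (metis bij_inv_eq_iff)
  then show ?thesis
    using assms(2) by (simp add: zpow_def fp)
qed

definition moved :: "('a \<Rightarrow> 'a) \<Rightarrow> 'a set" where
  "moved f = {x. f x \<noteq> x}"

lemma moved_apply_iff: "bij V \<Longrightarrow> V x \<in> moved V \<longleftrightarrow> x \<in> moved V"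
  by (auto simp: moved_def dest: bij_is_inj injD)

text \<open>A bijection permutes its moved points and fixes all others, so any set containing the
  moved points is invariant in both directions.\<close>

lemma moved_subset_mem_iff:
  assumes "bij V" "moved V \<subseteq> S" shows "V x \<in> S \<longleftrightarrow> x \<in> S"
proof (cases "V x = x")
  case False
  then have "x \<in> moved V" by (simp add: moved_def)
  then show ?thesis using moved_apply_iff[OF assms(1)] assms(2) by blast
qed simp

lemma moved_comp: "moved (f \<circ> g) \<subseteq> moved f \<union> moved g"
  by (auto simp: moved_def)

lemma moved_zpow: "bij f \<Longrightarrow> moved (zpow f k) \<subseteq> moved f"
  using zpow_fixed by (fastforce simp: moved_def)

lemma inv_comp_eq_id: "bij b \<Longrightarrow> inv b \<circ> a = id \<Longrightarrow> a = b"
  by (metis bij_is_surj comp_assoc comp_id id_comp surj_iff)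

section \<open>Addresses of points in a nested family of displaced sets\<close>

lemma bij_wr_gen: "bij (wr_gen j ys)"
proof (rule o_bij)
  \<comment> \<open>The test reads only coordinates below \<open>j\<close>, which a shift of
    coordinate \<open>j\<close> leaves alone, so subtracting 1 under the same test undoes
    it.\<close>
  let ?g = "\<lambda>c. if \<forall>i<j. c i = ys ! i then c(j := c j - 1) else c"
  show "?g \<circ> wr_gen j ys = id" "wr_gen j ys \<circ> ?g = id"
    by (auto simp: wr_gen_def fun_eq_iff)
qed

text \<open>By \<open>wander\<close> the translates of \<open>D (Suc n)\<close> under the powers of
  \<open>h n\<close> are pairwise disjoint, so the conjugates of \<open>h (Suc n)\<close> by these
  powers act on disjoint sets, as the base group of a wreath product does. \<open>D_0\<close> gives
  every point an address, and \<open>D_nonempty\<close> supplies points at every depth for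
  faithfulness.\<close>

locale wr_tower =
  fixes h :: "nat \<Rightarrow> 'a \<Rightarrow> 'a" and D :: "nat \<Rightarrow> 'a set"
  assumes bij_h: "bij (h n)"
    and D_0: "D 0 = UNIV"
    and D_nonempty: "D n \<noteq> {}"
    and D_Suc: "D (Suc n) \<subseteq> D n"
    and moved_h: "moved (h n) \<subseteq> D n"
    and wander: "k \<noteq> 0 \<Longrightarrow> x \<in> D (Suc n) \<Longrightarrow> zpow (h n) k x \<notin> D (Suc n)"
begin

lemma D_antimono: "m \<le> n \<Longrightarrow> D n \<subseteq> D m"
  using D_Suc by (rule lift_Suc_antimono_le)

text \<open>The power of the deepest level is applied first, so \<open>seg c 0 n\<close> carries
  \<open>D n\<close> onto the copy of \<open>D n\<close> whose address is \<open>c 0\<close>, ...,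
  \<open>c (n - 1)\<close>.\<close>

primrec seg :: "(nat \<Rightarrow> int) \<Rightarrow> nat \<Rightarrow> nat \<Rightarrow> 'a \<Rightarrow> 'a" where
  "seg c i 0 = id"
| "seg c i (Suc d) = seg c i d \<circ> zpow (h (i + d)) (c (i + d))"

lemma seg_add: "seg c i (d + e) = seg c i d \<circ> seg c (i + d) e"
  by (induction e) (simp_all add: o_assoc add.assoc)

lemma seg_cong: "(\<And>l. i \<le> l \<Longrightarrow> l < i + d \<Longrightarrow> c l = c' l) \<Longrightarrow> seg c i d = seg c' i d"
  by (induction d) simp_all

lemma bij_seg: "bij (seg c i d)"
proof (induction d)
  case 0
  show ?case by (simp only: seg.simps bij_id)
next
  case (Suc d)
  then show ?case by (simp only: seg.simps bij_comp bij_zpow bij_h)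
qed

lemma moved_seg: "moved (seg c i d) \<subseteq> D i"
proof (induction d)
  case 0
  show ?case by (simp add: moved_def)
next
  case (Suc d)
  have "moved (zpow (h (i + d)) (c (i + d))) \<subseteq> D i"
    using moved_zpow[OF bij_h] moved_h D_antimono[of i "i + d"] by (meson le_add1 order_trans)
  with Suc.IH show ?case unfolding seg.simps by (intro order_trans[OF moved_comp] Un_least)
qed

lemma seg_mem_iff: "k \<le> i \<Longrightarrow> seg c i d x \<in> D k \<longleftrightarrow> x \<in> D k"
  by (rule moved_subset_mem_iff[OF bij_seg order_trans[OF moved_seg D_antimono]])

text \<open>The counterpart of \<open>wr_gen j ys\<close>: the element \<open>h j\<close>,
  transported to the copy of \<open>D j\<close> with address \<open>ys\<close>.\<close>

definition tr :: "nat \<Rightarrow> int list \<Rightarrow> 'a \<Rightarrow> 'a" where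
  "tr j ys = seg ((!) ys) 0 j \<circ> h j \<circ> inv (seg ((!) ys) 0 j)"

lemma bij_tr: "bij (tr j ys)"
  unfolding tr_def by (intro bij_comp bij_h bij_seg bij_imp_bij_inv)

text \<open>All factors of level \<open>n\<close> and above are trivial outside \<open>D n\<close>.
  Hence undoing the conjugator leads back to \<open>s\<close>, which \<open>h j\<close>
  fixes.\<close>

lemma tr_fixes_local:
  assumes "n \<le> j" "s \<notin> D n"
  shows "tr j ys (seg ((!) ys) 0 n s) = seg ((!) ys) 0 n s"
proof -
  let ?V = "seg ((!) ys) n (j - n)"
  have U: "seg ((!) ys) 0 j = seg ((!) ys) 0 n \<circ> ?V"
    using seg_add[of "(!) ys" 0 n "j - n"] assms(1) by simp
  have V: "?V s = s" using moved_seg assms(2) by (auto simp: moved_def)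
  then have "inv (seg ((!) ys) 0 j) (seg ((!) ys) 0 n s) = s"
    using U by (metis bij_inv_eq_iff comp_apply bij_seg)
  moreover have "h j s = s"
    using moved_h[of j] D_antimono[OF assms(1)] assms(2) by (auto simp: moved_def)
  ultimately show ?thesis using U V by (simp add: tr_def)
qed

text \<open>Rewriting the point with the entry of \<open>ys\<close> at \<open>i\<close> leaves over
  the nonzero power \<open>c i - ys ! i\<close> of \<open>h i\<close>, which puts \<open>r\<close>
  outside \<open>D (Suc i)\<close>; then \<open>tr_fixes_local\<close> applies at level
  \<open>Suc i\<close>.\<close>

lemma tr_fixes_mismatch:
  assumes "i < j" "\<And>l. l < i \<Longrightarrow> c l = ys ! l" "c i \<noteq> ys ! i"
    and "\<And>k. k \<noteq> 0 \<Longrightarrow> zpow (h i) k r \<notin> D (Suc i)"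
  shows "tr j ys (seg c 0 (Suc i) r) = seg c 0 (Suc i) r"
proof -
  have "seg c 0 i = seg ((!) ys) 0 i" by (rule seg_cong) (simp add: assms)
  then have "seg c 0 (Suc i) r = seg ((!) ys) 0 (Suc i) (zpow (h i) (c i - ys ! i) r)"
    using zpow_add'[OF bij_h, of i "ys ! i" "c i - ys ! i" r] by simp
  then show ?thesis using tr_fixes_local[of "Suc i" j] assms by simp
qed

lemma first_mismatch:
  fixes j :: nat
  assumes "\<not> (\<forall>i<j. c i = c' i)"
  obtains i where "i < j" "c i \<noteq> c' i" "\<And>l. l < i \<Longrightarrow> c l = c' l"
proof -
  define i where "i = (LEAST i. i < j \<and> c i \<noteq> c' i)"
  have "\<exists>i. i < j \<and> c i \<noteq> c' i" using assms by auto
  then have i: "i < j \<and> c i \<noteq> c' i" unfolding i_def by (rule LeastI_ex)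
  moreover have "c l = c' l" if "l < i" for l
    using not_less_Least[OF that[unfolded i_def]] that i by auto
  ultimately show ?thesis using that by blast
qed

lemma seg_split_Suc: "i \<le> k \<Longrightarrow> seg c 0 (Suc k) q = seg c 0 (Suc i) (seg c (Suc i) (k - i) q)"
  using seg_add[of c 0 "Suc i" "k - i"] by simp

text \<open>If the address agrees with \<open>ys\<close> below \<open>j\<close>, the conjugator
  cancels and one more factor \<open>h j\<close> appears, raising coordinate \<open>j\<close>.
  Otherwise the first disagreement makes the point fixed, just as \<open>wr_gen\<close> does
  nothing.\<close>

lemma tr_seg:
  assumes "j \<le> k" "q \<in> D k"
  shows "tr j ys (seg c 0 (Suc k) q) = seg (wr_gen j ys c) 0 (Suc k) q"
proof (cases "\<forall>i<j. c i = ys ! i")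
  case True
  have w: "wr_gen j ys c = c(j := c j + 1)" using True by (simp add: wr_gen_def)
  have 1: "seg (c(j := c j + 1)) 0 j = seg c 0 j" "seg ((!) ys) 0 j = seg c 0 j"
    "seg (c(j := c j + 1)) (Suc j) (k - j) = seg c (Suc j) (k - j)"
    using True by (auto intro!: seg_cong)
  have "inv (seg c 0 j) (seg c 0 j x) = x" for x
    using bij_seg by (simp add: bij_is_inj)
  then show ?thesis
    using zpow_add'[OF bij_h, of j 1 "c j"]
    unfolding seg_split_Suc[OF assms(1)] w 1(3) by (simp add: 1(1,2)[unfolded add.commute[of _ 1]] tr_def add.commute[of _ 1])
next
  case False
  then obtain i where i: "i < j" "c i \<noteq> ys ! i" "\<And>l. l < i \<Longrightarrow> c l = ys ! l"
    using first_mismatch[of _ c "(!) ys"] by blast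
  have "q \<in> D (Suc i)" using assms i(1) D_antimono[of "Suc i" k] by auto
  then have "seg c (Suc i) (k - i) q \<in> D (Suc i)" by (simp add: seg_mem_iff)
  then have "tr j ys (seg c 0 (Suc k) q) = seg c 0 (Suc k) q"
    using tr_fixes_mismatch[of i j c ys] i wander assms(1) seg_split_Suc[of i k] by simp
  moreover have "wr_gen j ys c = c" by (simp only: wr_gen_def False if_False)
  ultimately show ?thesis by simp
qed

text \<open>Here \<open>wr_gen j ys\<close> can alter only coordinate \<open>j\<close>, beyond those
  that the address uses, so the task is to see that \<open>tr j ys\<close> fixes the point: either
  \<open>q\<close> itself lies outside \<open>D (Suc k)\<close>, or the address already disagrees
  with \<open>ys\<close>.\<close>

lemma tr_seg_deep:
  assumes "k < j" "q \<in> D k" "\<And>n. zpow (h k) n q \<notin> D (Suc k)"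
  shows "tr j ys (seg c 0 (Suc k) q) = seg (wr_gen j ys c) 0 (Suc k) q"
proof -
  have w: "seg (wr_gen j ys c) 0 (Suc k) = seg c 0 (Suc k)"
    using assms(1) by (intro seg_cong) (auto simp: wr_gen_def)
  show ?thesis
  proof (cases "\<forall>i<Suc k. c i = ys ! i")
    case True
    have "seg c 0 (Suc k) = seg ((!) ys) 0 (Suc k)"
      using True by (intro seg_cong) auto
    then show ?thesis
      using tr_fixes_local[of "Suc k" j q ys] assms(1) assms(3)[of 0] unfolding w
      by (simp del: seg.simps)
  next
    case False
    then obtain i where i: "i < Suc k" "c i \<noteq> ys ! i" "\<And>l. l < i \<Longrightarrow> c l = ys ! l"
      using first_mismatch[of _ c "(!) ys"] by blast
    have "zpow (h i) n (seg c (Suc i) (k - i) q) \<notin> D (Suc i)" if "n \<noteq> 0" for n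
    proof (cases "i = k")
      case False
      then have "q \<in> D (Suc i)" using assms i(1) D_antimono[of "Suc i" k] by auto
      then show ?thesis using wander that by (simp add: seg_mem_iff)
    qed (use assms(3) in simp)
    then show ?thesis
      using tr_fixes_mismatch[of i j c ys] i assms(1) seg_split_Suc[of i k] unfolding w by simp
  qed
qed

text \<open>Every point is \<open>seg c 0 (Suc k) q\<close> for some address \<open>c\<close>; the address ends at level \<open>k\<close> when the
  orbit of \<open>q\<close> under \<open>h k\<close> avoids the next set of the tower, or at the cut-off \<open>N\<close>.\<close>

definition addr :: "nat \<Rightarrow> nat \<Rightarrow> 'a \<Rightarrow> bool" where
  "addr N k q \<longleftrightarrow> k \<le> N \<and> q \<in> D k \<and> (k = N \<or> (\<forall>n. zpow (h k) n q \<notin> D (Suc k)))"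

lemma ex_addr: "\<exists>c k q. t = seg c 0 (Suc k) q \<and> addr N k q"
proof (induction N)
  case 0
  show ?case
    by (rule exI[of _ "\<lambda>_. 0"], rule exI[of _ 0], rule exI[of _ t]) (simp add: addr_def D_0)
next
  case (Suc N)
  then obtain c k q where t: "t = seg c 0 (Suc k) q" and a: "addr N k q" by blast
  show ?case
  proof (cases "\<forall>n. zpow (h k) n q \<notin> D (Suc k)")
    case True
    then have "addr (Suc N) k q" using a by (simp add: addr_def)
    then show ?thesis using t by blast
  next
    case False
    then obtain n where n: "zpow (h k) n q \<in> D (Suc k)" by blast
    have kN: "k = N" using a n by (auto simp: addr_def)
    \<comment> \<open>Replacing \<open>q\<close> by its image in \<open>D (Suc k)\<close> lengthens
      the address: the exponent at \<open>k\<close> absorbs the shift by \<open>n\<close>, and the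
      new last exponent is 0.\<close>
    define c' where "c' = (c(k := c k - n))(Suc k := 0)"
    have "seg c' 0 k = seg c 0 k" by (rule seg_cong) (simp add: c'_def)
    then have "seg c' 0 (Suc (Suc k)) (zpow (h k) n q) = t"
      using zpow_add'[OF bij_h, of k "c k - n" n q] by (simp add: t c'_def)
    moreover have "addr (Suc N) (Suc k) (zpow (h k) n q)"
      using n kN by (simp add: addr_def)
    ultimately show ?thesis by metis
  qed
qed

lemma tr_seg_addr:
  assumes "j \<le> N" "addr N k q"
  shows "tr j ys (seg c 0 (Suc k) q) = seg (wr_gen j ys c) 0 (Suc k) q"
proof (cases "j \<le> k")
  case True
  then show ?thesis using assms(2) by (intro tr_seg) (simp_all add: addr_def)
next
  case False
  then show ?thesis using assms by (intro tr_seg_deep) (auto simp: addr_def)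
qed

text \<open>After cancelling up to the first differing coordinate \<open>i\<close>, two points of
  \<open>D (Suc i)\<close> differ by a nonzero power of \<open>h i\<close>, against
  \<open>wander\<close>.\<close>

lemma seg_inject:
  assumes "seg c 0 n q = seg c' 0 n q" "q \<in> D n" "i < n"
  shows "c i = c' i"
proof (rule ccontr)
  assume "c i \<noteq> c' i"
  then have "\<not> (\<forall>i<n. c i = c' i)" using assms(3) by auto
  then obtain i where i: "i < n" "c i \<noteq> c' i" "\<And>l. l < i \<Longrightarrow> c l = c' l"
    using first_mismatch by blast
  have s: "seg c 0 i = seg c' 0 i" by (rule seg_cong) (simp add: i)
  define r r' where "r = seg c (Suc i) (n - Suc i) q" and "r' = seg c' (Suc i) (n - Suc i) q"
  have rD: "r \<in> D (Suc i)" "r' \<in> D (Suc i)"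
    using assms(2) i(1) D_antimono[of "Suc i" n] by (auto simp: r_def r'_def seg_mem_iff)
  obtain m where m: "n = Suc m" "i \<le> m" using i(1) by (cases n) auto
  have "seg c 0 i (zpow (h i) (c i) r) = seg c 0 i (zpow (h i) (c' i) r')"
    using assms(1) m seg_split_Suc[of i m] s by (simp add: r_def r'_def)
  then have "zpow (h i) (c i) r = zpow (h i) (c' i) r'"
    using bij_seg by (metis bij_inv_eq_iff)
  then have "zpow (h i) (- c' i) (zpow (h i) (c i) r) = r'"
    using zpow_add'[OF bij_h, of i "- c' i" "c' i" r'] by simp
  then have "zpow (h i) (- c' i + c i) r = r'" by (simp only: zpow_add'[OF bij_h])
  then show False using wander[of "- c' i + c i" r i] rD i(2) by auto
qed

text \<open>The graph of the isomorphism, before it is known to be a function or injective.\<close>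

inductive_set gam :: "(((nat \<Rightarrow> int) \<Rightarrow> (nat \<Rightarrow> int)) \<times> ('a \<Rightarrow> 'a)) set" where
  one: "(id, id) \<in> gam"
| incl: "length ys = j \<Longrightarrow> (wr_gen j ys, tr j ys) \<in> gam"
| inv: "length ys = j \<Longrightarrow> (inv (wr_gen j ys), inv (tr j ys)) \<in> gam"
| eng: "(\<phi>, f) \<in> gam \<Longrightarrow> (\<psi>, g) \<in> gam \<Longrightarrow> (\<phi> \<circ> \<psi>, f \<circ> g) \<in> gam"

lemma gam_bij: "(\<phi>, f) \<in> gam \<Longrightarrow> bij \<phi> \<and> bij f"
  by (induction rule: gam.induct) (simp_all only: bij_id bij_wr_gen bij_tr bij_imp_bij_inv bij_comp simp_thms)

lemma gam_inv: "(\<phi>, f) \<in> gam \<Longrightarrow> (inv \<phi>, inv f) \<in> gam"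
proof (induction rule: gam.induct)
  case one
  then show ?case using gam.one by (simp only: inv_id)
next
  case (incl ys j)
  then show ?case by (rule gam.inv)
next
  case (inv ys j)
  then show ?case
    using gam.incl[of ys j] by (simp add: inv_inv_eq bij_wr_gen bij_tr)
next
  case (eng \<phi> f \<psi> g)
  have "inv (\<phi> \<circ> \<psi>) = inv \<psi> \<circ> inv \<phi>" "inv (f \<circ> g) = inv g \<circ> inv f"
    using gam_bij[OF eng.hyps(1)] gam_bij[OF eng.hyps(2)] by (simp_all only: o_inv_distrib)
  then show ?case using gam.eng[OF eng.IH(2,1)] by (simp only:)
qed

text \<open>Addresses cut off at \<open>N\<close> reflect the action of \<open>tr j ys\<close> only
  for \<open>j \<le> N\<close>. A word involves finitely many generators, so one bound
  \<open>N0\<close> serves all of them.\<close>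

lemma gam_equivariant:
  "(\<phi>, f) \<in> gam \<Longrightarrow>
    \<exists>N0. \<forall>N\<ge>N0. \<forall>k q c. addr N k q \<longrightarrow> f (seg c 0 (Suc k) q) = seg (\<phi> c) 0 (Suc k) q"
proof (induction rule: gam.induct)
  case one
  show ?case by (simp only: id_apply simp_thms)
next
  case (incl ys j)
  show ?case by (intro exI[of _ j] allI impI tr_seg_addr)
next
  case (inv ys j)
  have "inv (tr j ys) (seg c 0 (Suc k) q) = seg (inv (wr_gen j ys) c) 0 (Suc k) q"
    if "N \<ge> j" "addr N k q" for N k q c
  proof -
    have "wr_gen j ys (inv (wr_gen j ys) c) = c" by (simp add: bij_is_surj bij_wr_gen surj_f_inv_f)
    then have "tr j ys (seg (inv (wr_gen j ys) c) 0 (Suc k) q) = seg c 0 (Suc k) q"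
      by (simp only: tr_seg_addr[OF that])
    then show ?thesis using bij_tr by (metis bij_inv_eq_iff)
  qed
  then show ?case by (intro exI[of _ j] allI impI)
next
  case (eng \<phi> f \<psi> g)
  then obtain N1 N2 where
    "\<forall>N\<ge>N1. \<forall>k q c. addr N k q \<longrightarrow> f (seg c 0 (Suc k) q) = seg (\<phi> c) 0 (Suc k) q"
    "\<forall>N\<ge>N2. \<forall>k q c. addr N k q \<longrightarrow> g (seg c 0 (Suc k) q) = seg (\<psi> c) 0 (Suc k) q"
    by blast
  then have "\<forall>N\<ge>max N1 N2. \<forall>k q c. addr N k q \<longrightarrow>
      (f \<circ> g) (seg c 0 (Suc k) q) = seg ((\<phi> \<circ> \<psi>) c) 0 (Suc k) q"
    by (metis comp_apply max.bounded_iff)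
  then show ?case by (rule exI[of _ "max N1 N2"])
qed

lemma gam_id_left: "(id, f) \<in> gam \<Longrightarrow> f = id"
proof -
  assume "(id, f) \<in> gam"
  from gam_equivariant[OF this]
  obtain N where N: "\<And>k q c. addr N k q \<Longrightarrow> f (seg c 0 (Suc k) q) = seg c 0 (Suc k) q"
    unfolding id_apply by blast
  have "f t = t" for t using ex_addr[of t N] N by metis
  then show "f = id" by auto
qed

lemma gam_id_right: "(\<phi>, id) \<in> gam \<Longrightarrow> \<phi> = id"
proof (intro ext)
  fix c i
  assume "(\<phi>, id) \<in> gam"
  from gam_equivariant[OF this]
  obtain N0 where N0: "\<And>N k q c. N \<ge> N0 \<Longrightarrow> addr N k q \<Longrightarrow> seg c 0 (Suc k) q = seg (\<phi> c) 0 (Suc k) q"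
    unfolding id_apply by blast
  define N where "N = max N0 i"
  obtain q where q: "q \<in> D (Suc N)" using D_nonempty by blast
  \<comment> \<open>At the cut-off level no condition on the orbit of \<open>q\<close> is imposed,
    so every exponent up to \<open>i\<close> can be read off from the point by
    \<open>seg_inject\<close>.\<close>
  then have "addr N N q" using D_Suc by (auto simp: addr_def)
  then have "seg c 0 (Suc N) q = seg (\<phi> c) 0 (Suc N) q" by (intro N0[of N]) (simp_all add: N_def)
  then have "c i = \<phi> c i" by (rule seg_inject) (use q in \<open>simp_all add: N_def\<close>)
  then show "\<phi> c i = id c i" by simp
qed

lemma gam_quotient:
  assumes "(\<phi>, f) \<in> gam" "(\<psi>, g) \<in> gam"
  shows "(inv \<psi> \<circ> \<phi>, inv g \<circ> f) \<in> gam"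
  by (rule gam.eng[OF gam_inv[OF assms(2)] assms(1)])

lemma gam_functional:
  assumes "(\<phi>, f) \<in> gam" "(\<psi>, f) \<in> gam"
  shows "\<phi> = \<psi>"
proof -
  have "inv f \<circ> f = id" using gam_bij[OF assms(1)] by (simp only: bij_is_inj inv_o_cancel)
  with gam_quotient[OF assms] have "(inv \<psi> \<circ> \<phi>, id) \<in> gam" by (simp only:)
  from gam_id_right[OF this] show ?thesis
    by (rule inv_comp_eq_id[OF conjunct1[OF gam_bij[OF assms(2)]]])
qed

lemma gam_injective:
  assumes "(\<phi>, f) \<in> gam" "(\<phi>, g) \<in> gam"
  shows "f = g"
proof -
  have "inv \<phi> \<circ> \<phi> = id" using gam_bij[OF assms(1)] by (simp only: bij_is_inj inv_o_cancel)
  with gam_quotient[OF assms] have "(id, inv g \<circ> f) \<in> gam" by (simp only:)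
  from gam_id_left[OF this] show ?thesis
    by (rule inv_comp_eq_id[OF conjunct2[OF gam_bij[OF assms(2)]]])
qed

section \<open>The isomorphism with the iterated wreath product\<close>

lemma generate_wr_gens: "generate (BijGroup UNIV) wr_gens = fst ` gam"
proof
  have M: "x \<otimes>\<^bsub>BijGroup UNIV\<^esub> y = x \<circ> y" if "bij x" "bij y" for x y :: "(nat \<Rightarrow> int) \<Rightarrow> (nat \<Rightarrow> int)"
    using that by (simp add: BijGroup_def Bij_def compose_def fun_eq_iff)
  have O: "\<one>\<^bsub>BijGroup UNIV\<^esub> = (id :: (nat \<Rightarrow> int) \<Rightarrow> (nat \<Rightarrow> int))"
    by (simp add: BijGroup_def fun_eq_iff)
  have I: "m_inv (BijGroup UNIV) x = inv x" if "bij x" for x :: "(nat \<Rightarrow> int) \<Rightarrow> (nat \<Rightarrow> int)"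
    using that by (simp add: inv_BijGroup Bij_def fun_eq_iff)
  show "generate (BijGroup UNIV) wr_gens \<subseteq> fst ` gam"
  proof
    fix x :: "(nat \<Rightarrow> int) \<Rightarrow> (nat \<Rightarrow> int)"
    assume "x \<in> generate (BijGroup UNIV) wr_gens"
    then show "x \<in> fst ` gam"
    proof (induction rule: generate.induct)
      case one
      show ?case unfolding O using gam.one by (rule image_eqI[rotated]) simp
    next
      case (incl x)
      then obtain j ys where x: "x = wr_gen j ys" "length ys = j" by (auto simp: wr_gens_def)
      show ?case unfolding x(1) using gam.incl[OF x(2)] by (rule image_eqI[rotated]) simp
    next
      case (inv x)
      then obtain j ys where x: "x = wr_gen j ys" "length ys = j" by (auto simp: wr_gens_def)
      show ?case unfolding x(1) I[OF bij_wr_gen] using gam.inv[OF x(2)]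
        by (rule image_eqI[rotated]) simp
    next
      case (eng x y)
      then obtain f g where "(x, f) \<in> gam" "(y, g) \<in> gam" by auto
      then have "(x \<circ> y, f \<circ> g) \<in> gam" "x \<otimes>\<^bsub>BijGroup UNIV\<^esub> y = x \<circ> y"
        using gam_bij M by (auto intro: gam.eng)
      then show ?case by (metis fst_conv image_eqI)
    qed
  qed
  have "\<phi> \<in> generate (BijGroup UNIV) wr_gens" if "(\<phi>, f) \<in> gam" for \<phi> f
    using that
  proof (induction rule: gam.induct)
    case one
    show ?case using generate.one[of "BijGroup UNIV" wr_gens] unfolding O .
  next
    case (incl ys j)
    then show ?case by (intro generate.incl) (auto simp: wr_gens_def)
  next
    case (inv ys j)
    then have "wr_gen j ys \<in> wr_gens" by (auto simp: wr_gens_def)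
    then show ?case using generate.inv[of "wr_gen j ys" wr_gens "BijGroup UNIV"] I bij_wr_gen by simp
  next
    case (eng \<phi> f \<psi> g)
    have "\<phi> \<otimes>\<^bsub>BijGroup UNIV\<^esub> \<psi> = \<phi> \<circ> \<psi>"
      using gam_bij[OF eng.hyps(1)] gam_bij[OF eng.hyps(2)] M by blast
    then show ?case using generate.eng[OF eng.IH] by (simp only:)
  qed
  then show "fst ` gam \<subseteq> generate (BijGroup UNIV) wr_gens" by auto
qed

lemma snd_gam_subset:
  assumes "id \<in> G" "\<And>f g. f \<in> G \<Longrightarrow> g \<in> G \<Longrightarrow> f \<circ> g \<in> G" "\<And>f. f \<in> G \<Longrightarrow> inv f \<in> G"
    and "\<And>n. h n \<in> G"
  shows "snd ` gam \<subseteq> G"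
proof -
  have z: "zpow f k \<in> G" if "f \<in> G" for f k
  proof -
    have "f ^^ n \<in> G" if "f \<in> G" for f n using that by (induction n) (auto intro: assms)
    then show ?thesis using that assms(3) by (simp add: zpow_def)
  qed
  have s: "seg c i d \<in> G" for c i d
    by (induction d) (simp_all only: seg.simps assms z)
  have t: "tr j ys \<in> G" for j ys unfolding tr_def by (intro assms s)
  have "f \<in> G" if "(\<phi>, f) \<in> gam" for \<phi> f
    using that by (induction rule: gam.induct) (simp_all only: assms t)
  then show ?thesis by auto
qed

lemma gam_comp_right: "(\<phi>, f) \<in> gam \<Longrightarrow> (\<psi>, g) \<in> gam \<Longrightarrow> (inv \<phi> \<circ> inv \<psi>, inv (g \<circ> f)) \<in> gam"
  using gam.eng[OF gam_inv gam_inv] gam_bij by (simp only: o_inv_distrib)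

text \<open>The product of \<^term>\<open>PLo_group\<close> is composition in the opposite order, so the isomorphism
  inverts.\<close>

lemma ex_iso_WrZ_inf:
  assumes "\<And>f g. monoid.mult M f g = g \<circ> f" "carrier M = snd ` gam"
  shows "M \<cong> WrZ_inf"
proof -
  define \<Phi> where "\<Phi> f = (THE \<phi>. (\<phi>, inv f) \<in> gam)" for f
  have \<Phi>: "\<Phi> f = \<phi>" if "(\<phi>, inv f) \<in> gam" for f \<phi>
    unfolding \<Phi>_def using that gam_functional by blast
  have ex: "\<exists>\<phi>. (\<phi>, f) \<in> gam \<and> \<Phi> f = inv \<phi>" if "f \<in> carrier M" for f
    using that assms(2) \<Phi> gam_inv by force
  have M: "x \<otimes>\<^bsub>WrZ_inf\<^esub> y = x \<circ> y" if "bij x" "bij y" for x y :: "(nat \<Rightarrow> int) \<Rightarrow> (nat \<Rightarrow> int)"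
    using that by (simp add: WrZ_inf_def BijGroup_def Bij_def compose_def fun_eq_iff)
  have C: "carrier WrZ_inf = fst ` gam" by (simp add: WrZ_inf_def generate_wr_gens)
  have "\<Phi> \<in> hom M WrZ_inf"
  proof (rule homI)
    fix f assume "f \<in> carrier M"
    then obtain \<phi> where "(\<phi>, f) \<in> gam" "\<Phi> f = inv \<phi>" using ex by blast
    then show "\<Phi> f \<in> carrier WrZ_inf" using gam_inv C by (metis fst_conv image_eqI)
  next
    fix f g assume "f \<in> carrier M" "g \<in> carrier M"
    then obtain \<phi> \<psi> where *: "(\<phi>, f) \<in> gam" "\<Phi> f = inv \<phi>" "(\<psi>, g) \<in> gam" "\<Phi> g = inv \<psi>"
      using ex by meson
    have "\<Phi> (g \<circ> f) = inv \<phi> \<circ> inv \<psi>" by (rule \<Phi>) (rule gam_comp_right[OF *(1,3)])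
    then show "\<Phi> (f \<otimes>\<^bsub>M\<^esub> g) = \<Phi> f \<otimes>\<^bsub>WrZ_inf\<^esub> \<Phi> g"
      using * gam_bij[OF *(1)] gam_bij[OF *(3)] by (simp add: assms(1) M bij_imp_bij_inv)
  qed
  moreover have "bij_betw \<Phi> (carrier M) (carrier WrZ_inf)"
  proof (rule bij_betw_imageI)
    show "inj_on \<Phi> (carrier M)"
    proof (rule inj_onI)
      fix f g assume "f \<in> carrier M" "g \<in> carrier M" "\<Phi> f = \<Phi> g"
      then obtain \<phi> \<psi> where *: "(\<phi>, f) \<in> gam" "(\<psi>, g) \<in> gam" "inv \<phi> = inv \<psi>"
        using ex by metis
      have "\<phi> = \<psi>" using *(3) gam_bij[OF *(1)] gam_bij[OF *(2)] by (metis inv_inv_eq)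
      then show "f = g" using *(1,2) gam_injective by blast
    qed
    show "\<Phi> ` carrier M = carrier WrZ_inf"
    proof
      show "\<Phi> ` carrier M \<subseteq> carrier WrZ_inf"
      proof (rule image_subsetI)
        fix f assume "f \<in> carrier M"
        then obtain \<phi> where "(\<phi>, f) \<in> gam" "\<Phi> f = inv \<phi>" using ex by blast
        then show "\<Phi> f \<in> carrier WrZ_inf" using gam_inv C by (metis fst_conv image_eqI)
      qed
      have "\<phi> \<in> \<Phi> ` carrier M" if "(\<phi>, f) \<in> gam" for \<phi> f
      proof -
        have "inv (inv f) = f" using gam_bij[OF that] by (simp add: inv_inv_eq)
        then have "\<Phi> (inv f) = \<phi>" using \<Phi> that by simp
        moreover have "inv f \<in> carrier M" using gam_inv[OF that] assms(2) by force
        ultimately show ?thesis by force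
      qed
      then show "carrier WrZ_inf \<subseteq> \<Phi> ` carrier M" unfolding C by auto
    qed
  qed
  ultimately show ?thesis unfolding is_iso_def iso_def by blast
qed

end

section \<open>Piecewise linear homeomorphisms\<close>

text \<open>Elements are treated as maps of the whole line, being the identity off the unit
  interval; continuity then follows from monotonicity and surjectivity.\<close>

definition homeo :: "(real \<Rightarrow> real) \<Rightarrow> bool" where
  "homeo f \<longleftrightarrow> strict_mono f \<and> surj f"

lemma homeo_bij: "homeo f \<Longrightarrow> bij f"
  by (simp add: homeo_def bij_def strict_mono_imp_inj_on)

lemma homeo_less_iff: "homeo f \<Longrightarrow> f x < f y \<longleftrightarrow> x < y"
  by (simp add: homeo_def strict_mono_less)

lemma homeo_le_iff: "homeo f \<Longrightarrow> f x \<le> f y \<longleftrightarrow> x \<le> y"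
  by (simp add: homeo_def strict_mono_less_eq)

lemma homeo_eq_iff: "homeo f \<Longrightarrow> f x = f y \<longleftrightarrow> x = y"
  by (simp add: homeo_def strict_mono_eq)

lemma homeo_inv1 [simp]: "homeo f \<Longrightarrow> inv f (f x) = x"
  by (simp add: homeo_bij bij_is_inj)

lemma homeo_inv2 [simp]: "homeo f \<Longrightarrow> f (inv f x) = x"
  by (simp add: homeo_def surj_f_inv_f)

lemma homeo_id: "homeo id"
  by (simp add: homeo_def strict_mono_def)

lemma homeo_comp: "homeo f \<Longrightarrow> homeo g \<Longrightarrow> homeo (f \<circ> g)"
  by (simp add: homeo_def strict_mono_def comp_surj del: o_apply) simp

lemma homeo_inv:
  assumes "homeo f" shows "homeo (inv f)"
proof -
  have "inv f x < inv f y" if "x < y" for x y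
    using that homeo_less_iff[OF assms, of "inv f x" "inv f y"] assms by simp
  then show ?thesis
    using homeo_bij[OF assms] by (simp add: homeo_def strict_mono_def bij_imp_bij_inv bij_is_surj)
qed

lemma homeo_zpow:
  assumes "homeo f" shows "homeo (zpow f k)"
proof -
  have "homeo (g ^^ n)" if "homeo g" for g n
  proof (induction n)
    case 0
    show ?case by (simp only: funpow.simps homeo_id)
  next
    case (Suc n)
    then show ?case by (simp only: funpow.simps homeo_comp that)
  qed
  then show ?thesis using assms homeo_inv by (simp add: zpow_def)
qed

lemma homeo_continuous:
  assumes "homeo f" shows "continuous_on A f"
proof (rule continuous_on_subset)
  have "f x \<le> f y" if "x \<le> y" for x y using homeo_le_iff[OF assms] that by blast
  then show "continuous_on UNIV f"
    using assms by (intro continuous_onI_mono) (auto simp: homeo_def)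
qed simp

lemma homeo_isCont: "homeo f \<Longrightarrow> isCont f x"
  using homeo_continuous[of f UNIV] by (simp add: continuous_on_eq_continuous_at)

section \<open>One-sided germs\<close>

definition germ :: "real \<Rightarrow> real filter \<Rightarrow> bool" where
  "germ e F \<longleftrightarrow> F = at_right e \<or> F = at_left e"

lemma germ_not_bot: "germ e F \<Longrightarrow> F \<noteq> bot"
  using trivial_limit_at_right_real[of e] trivial_limit_at_left_real[of e]
  by (auto simp only: germ_def trivial_limit_def)

lemma germ_not_both: "germ e F \<Longrightarrow> \<forall>\<^sub>F t in F. P t \<Longrightarrow> \<forall>\<^sub>F t in F. \<not> P t \<Longrightarrow> False"
  using eventually_happens[OF eventually_conj[of P F "\<lambda>t. \<not> P t"]] germ_not_bot by blast

lemma germ_le_at: "germ e F \<Longrightarrow> F \<le> at e"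
  unfolding germ_def by (auto simp: at_le)

lemma germ_filterlim:
  assumes "germ e F" "homeo f" "f e = e"
  shows "filterlim f F F"
proof -
  have "filterlim f (nhds e) F"
    using homeo_isCont[OF assms(2), of e] germ_le_at[OF assms(1)] assms(3)
    by (simp add: isCont_def tendsto_mono)
  moreover have "\<forall>\<^sub>F x in at_right e. e < f x" "\<forall>\<^sub>F x in at_left e. f x < e"
    using homeo_less_iff[OF assms(2), of e] homeo_less_iff[OF assms(2), of _ e] assms(3)
    by (simp_all add: eventually_at_filter)
  ultimately show ?thesis using assms(1) unfolding germ_def
    by (auto simp: filterlim_at elim!: eventually_mono)
qed

text \<open>A local form of piecewise linearity, affine on each side of every point. The finiteness
  that is needed is recovered in \<open>finite_fr\<close> by compactness.\<close>

definition pl_homeo :: "(real \<Rightarrow> real) \<Rightarrow> bool" where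
  "pl_homeo f \<longleftrightarrow> homeo f \<and> (\<forall>x. x \<le> 0 \<or> 1 \<le> x \<longrightarrow> f x = x)
     \<and> (\<forall>e F. germ e F \<longrightarrow> (\<exists>a. \<forall>\<^sub>F x in F. f x = f e + a * (x - e)))"

lemma pl_homeo_homeo: "pl_homeo f \<Longrightarrow> homeo f"
  by (simp add: pl_homeo_def)

lemma pl_homeo_outside: "pl_homeo f \<Longrightarrow> f x \<noteq> x \<Longrightarrow> 0 < x \<and> x < 1"
  unfolding pl_homeo_def by (meson not_le)

text \<open>Piecewise linearity enters only through this dichotomy and through \<open>comm_trivial_germ\<close>.\<close>

lemma germ_cases:
  assumes "pl_homeo f" "germ e F"
  obtains (fixed) "\<forall>\<^sub>F x in F. f x = x" | (moved) "\<forall>\<^sub>F x in F. f x \<noteq> x"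
proof -
  obtain a where a: "\<forall>\<^sub>F x in F. f x = f e + a * (x - e)"
    using assms unfolding pl_homeo_def by blast
  have ne: "\<forall>\<^sub>F x in F. x \<noteq> e"
    using germ_le_at[OF assms(2)] by (auto simp: eventually_at_filter le_filter_def)
  show ?thesis
  proof (cases "f e = e")
    case True
    show ?thesis
    proof (cases "a = 1")
      case 1: True
      have "\<forall>\<^sub>F x in F. f x = x" using a by eventually_elim (simp add: True 1)
      then show ?thesis by (rule fixed)
    next
      case 1: False
      have "\<forall>\<^sub>F x in F. f x \<noteq> x" using a ne
      proof eventually_elim
        case (elim x)
        have "f x - x = (a - 1) * (x - e)" using elim True by (simp add: algebra_simps)
        then show ?case using elim 1 by (metis eq_iff_diff_eq_0 mult_eq_0_iff)
      qed
      then show ?thesis by (rule moved)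
    qed
  next
    case False
    have "filterlim (\<lambda>x. f x - x) (nhds (f e - e)) F"
      using homeo_isCont[OF pl_homeo_homeo[OF assms(1)], of e] germ_le_at[OF assms(2)]
      by (intro tendsto_diff tendsto_mono[of F "at e"] tendsto_ident_at) (simp_all add: isCont_def)
    then have "\<forall>\<^sub>F x in F. f x - x \<noteq> 0"
      by (rule tendsto_imp_eventually_ne) (use False in simp)
    then have "\<forall>\<^sub>F x in F. f x \<noteq> x" by eventually_elim simp
    then show ?thesis by (rule moved)
  qed
qed

definition comm :: "('a \<Rightarrow> 'a) \<Rightarrow> ('a \<Rightarrow> 'a) \<Rightarrow> 'a \<Rightarrow> 'a" where
  "comm f g = f \<circ> g \<circ> inv f \<circ> inv g"

text \<open>One-sided germs at a common fixed point are linear, hence commute.\<close>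

lemma comm_trivial_germ:
  assumes f: "pl_homeo f" "f e = e" and g: "pl_homeo g" "g e = e" and F: "germ e F"
  shows "\<forall>\<^sub>F t in F. comm f g t = t"
proof -
  note hf = pl_homeo_homeo[OF f(1)] and hg = pl_homeo_homeo[OF g(1)]
  obtain a b where ab: "\<forall>\<^sub>F x in F. f x = f e + a * (x - e)" "\<forall>\<^sub>F x in F. g x = g e + b * (x - e)"
    using f(1) g(1) F unfolding pl_homeo_def by metis
  have "\<forall>\<^sub>F x in F. f (g x) = e + a * (g x - e)" "\<forall>\<^sub>F x in F. g (f x) = e + b * (f x - e)"
    using eventually_compose_filterlim[OF ab(1) germ_filterlim[OF F hg g(2)]]
      eventually_compose_filterlim[OF ab(2) germ_filterlim[OF F hf f(2)]] f g by simp_all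
  with ab have fg: "\<forall>\<^sub>F x in F. f (g x) = g (f x)"
    by eventually_elim (simp add: f g)
  have i: "inv f e = e" "inv g e = e" using homeo_inv1[OF hf, of e] homeo_inv1[OF hg, of e] f g by simp_all
  have "filterlim (\<lambda>t. inv f (inv g t)) F F"
    by (intro filterlim_compose[OF germ_filterlim[OF F homeo_inv[OF hf] i(1)]]
        germ_filterlim[OF F homeo_inv[OF hg] i(2)])
  from eventually_compose_filterlim[OF fg this] show ?thesis
    by eventually_elim (simp add: comm_def hf hg)
qed

section \<open>Orbitals, given by their ends\<close>

definition orb :: "(real \<Rightarrow> real) \<Rightarrow> real \<Rightarrow> real \<Rightarrow> bool" where
  "orb f u v \<longleftrightarrow> u < v \<and> f u = u \<and> f v = v \<and> (\<forall>x. u < x \<and> x < v \<longrightarrow> f x \<noteq> x)"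

lemma orb_unique:
  "orb f u v \<Longrightarrow> orb f u' v' \<Longrightarrow> u < x \<Longrightarrow> x < v \<Longrightarrow> u' < x \<Longrightarrow> x < v' \<Longrightarrow> u = u' \<and> v = v'"
  unfolding orb_def by (smt (verit))

lemma orb_fixed_outside: "orb f u v \<Longrightarrow> f t = t \<Longrightarrow> t \<le> u \<or> v \<le> t"
  unfolding orb_def by force

lemma fixed_closed: "homeo f \<Longrightarrow> closed {t. f t = t}"
  by (intro closed_Collect_eq homeo_continuous continuous_on_id)

text \<open>The ends are the nearest points of the closed set on either side of \<open>x\<close>. It
  is applied to the fixed points of one map and to the common fixed points of two.\<close>

lemma ex_orb_gen:
  fixes S :: "real set"
  assumes S: "closed S" "a \<in> S" "b \<in> S" "a \<le> x" "x \<le> b" and x: "x \<notin> S"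
  obtains u v where "u \<in> S" "v \<in> S" "u < x" "x < v" "\<And>t. u < t \<Longrightarrow> t < v \<Longrightarrow> t \<notin> S" "a \<le> u" "v \<le> b"
proof -
  define u where "u = Sup (S \<inter> {..x})"
  define v where "v = Inf (S \<inter> {x..})"
  have u: "u \<in> S \<inter> {..x}" unfolding u_def
    by (rule closed_contains_Sup) (use S in auto)
  have v: "v \<in> S \<inter> {x..}" unfolding v_def
    by (rule closed_contains_Inf) (use S in auto)
  have "u < x" "x < v" using u v x by (auto simp: less_le)
  moreover have "t \<le> u" if "t \<in> S" "t \<le> x" for t
    unfolding u_def by (rule cSup_upper) (use that in auto)
  moreover have "v \<le> t" if "t \<in> S" "x \<le> t" for t
    unfolding v_def by (rule cInf_lower) (use that in auto)
  ultimately show ?thesis using that[of u v] u v S by (smt (verit) IntE)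
qed

lemma ex_orb:
  assumes "pl_homeo f" "f x \<noteq> x"
  obtains u v where "orb f u v" "u < x" "x < v"
proof -
  have x: "0 < x" "x < 1" using pl_homeo_outside[OF assms] by auto
  have S: "closed {t. f t = t}" by (rule fixed_closed[OF pl_homeo_homeo[OF assms(1)]])
  have "f 0 = 0" "f 1 = 1" using assms(1) by (auto simp: pl_homeo_def)
  with assms(2) x obtain u v where "u \<in> {t. f t = t}" "v \<in> {t. f t = t}" "u < x" "x < v"
    "\<And>t. u < t \<Longrightarrow> t < v \<Longrightarrow> t \<notin> {t. f t = t}"
    using ex_orb_gen[OF S, of 0 1 x] unfolding mem_Collect_eq by (smt (verit, best))
  then show ?thesis using that[of u v] by (auto simp: orb_def)
qed

lemma orb_conj:
  assumes "homeo g" "orb f u v"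
  shows "orb (g \<circ> f \<circ> inv g) (g u) (g v)"
proof -
  have "f (inv g x) \<noteq> inv g x" if "g u < x" "x < g v" for x
  proof -
    have "u < inv g x" "inv g x < v"
      using that homeo_less_iff[OF assms(1), of u "inv g x"] homeo_less_iff[OF assms(1), of "inv g x" v]
        assms(1) by simp_all
    then show ?thesis using assms(2) by (simp add: orb_def)
  qed
  then show ?thesis
    using assms by (simp add: orb_def homeo_less_iff) (metis homeo_inv1)
qed

lemma homeo_fixed_ends:
  assumes "homeo g" "g u = u" "g v = v"
  shows "u < g x \<longleftrightarrow> u < x" "g x < v \<longleftrightarrow> x < v"
  using homeo_less_iff[OF assms(1), of u x] homeo_less_iff[OF assms(1), of x v] assms(2,3) by auto

text \<open>The displacement is continuous and has no zero on the orbital, so the intermediate value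
  theorem fixes its sign.\<close>

lemma orb_sign:
  assumes "homeo f" "orb f u v"
  shows "(\<forall>x. u < x \<and> x < v \<longrightarrow> x < f x) \<or> (\<forall>x. u < x \<and> x < v \<longrightarrow> f x < x)"
proof (rule ccontr)
  assume "\<not> ?thesis"
  then obtain x y where xy: "u < x" "x < v" "f x \<le> x" "u < y" "y < v" "y \<le> f y" by (auto simp: not_less)
  let ?h = "\<lambda>t. f t - t"
  have "connected (?h ` {u<..<v})"
    by (intro connected_continuous_image continuous_intros homeo_continuous assms) simp
  moreover have "?h x \<in> ?h ` {u<..<v}" "?h y \<in> ?h ` {u<..<v}" using xy by auto
  ultimately have "0 \<in> ?h ` {u<..<v}"
    using xy by (intro connectedD_interval[of _ "?h x" "?h y" 0]) auto
  then show False using assms(2) by (auto simp: orb_def)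
qed

text \<open>The iterates of \<open>\<alpha>\<close> increase. If they never passed
  \<open>\<beta>\<close> they would converge to a fixed point inside the orbital.\<close>

lemma orb_escape_up:
  assumes f: "homeo f" "orb f u v" and up: "\<And>x. u < x \<Longrightarrow> x < v \<Longrightarrow> x < f x"
    and \<alpha>: "u < \<alpha>" "\<alpha> < v" and "\<beta> < v"
  shows "\<forall>\<^sub>F n in sequentially. \<beta> < (f ^^ n) \<alpha>"
proof -
  define a where "a n = (f ^^ n) \<alpha>" for n
  have Suc: "a (Suc n) = f (a n)" for n by (simp add: a_def)
  have in_uv: "u < a n \<and> a n < v" for n
  proof (induction n)
    case 0
    then show ?case using \<alpha> by (simp add: a_def)
  next
    case (Suc n)
    then show ?case
      using homeo_fixed_ends[OF f(1), of u v "a n"] f(2) by (simp add: Suc orb_def \<open>a (Suc n) = f (a n)\<close>)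
  qed
  have inc: "incseq a" using in_uv up by (intro incseq_SucI) (simp add: Suc less_imp_le)
  show ?thesis
  proof (cases "\<exists>n. \<beta> < a n")
    case True
    then obtain N where "\<beta> < a N" by blast
    then have "\<beta> < a n" if "n \<ge> N" for n using inc that by (meson incseqD less_le_trans)
    then show ?thesis unfolding eventually_sequentially a_def by blast
  next
    case False
    then have bd: "a n \<le> \<beta>" for n by (simp add: not_less)
    obtain L where L: "a \<longlonglongrightarrow> L" "\<And>n. a n \<le> L" using incseq_convergent[OF inc, of \<beta>] bd by auto
    have "(\<lambda>n. f (a n)) \<longlonglongrightarrow> f L" using homeo_isCont[OF f(1)] L(1) by (rule isCont_tendsto_compose)
    then have "(\<lambda>n. a (Suc n)) \<longlonglongrightarrow> f L" by (simp add: Suc)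
    then have "f L = L" using LIMSEQ_unique L(1) LIMSEQ_Suc by blast
    moreover have "L \<le> \<beta>" using bd by (intro LIMSEQ_le_const2[OF L(1)]) auto
    moreover have "u < L" using L(2)[of 0] \<alpha> by (simp add: a_def)
    ultimately show ?thesis using f(2) \<open>\<beta> < v\<close> by (auto simp: orb_def)
  qed
qed

lemma orb_inv: "homeo f \<Longrightarrow> orb f u v \<Longrightarrow> orb (inv f) u v"
  unfolding orb_def by (metis homeo_inv1 homeo_inv2)

lemma orb_zpow_less:
  assumes "homeo f" "orb f u v"
  shows "u < zpow f k x \<longleftrightarrow> u < x" "zpow f k x < v \<longleftrightarrow> x < v"
proof -
  have "zpow f k u = u" "zpow f k v = v" using assms by (simp_all add: orb_def zpow_fixed homeo_bij)
  then show "u < zpow f k x \<longleftrightarrow> u < x" "zpow f k x < v \<longleftrightarrow> x < v"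
    by (rule homeo_fixed_ends[OF homeo_zpow[OF assms(1)]])+
qed

text \<open>The sign \<open>s\<close> records the direction of \<open>f\<close> on the orbital, so
  that later arguments can push towards either end without distinguishing cases.\<close>

lemma orb_escape:
  assumes f: "homeo f" "orb f u v"
  shows "\<exists>s::int. (s = 1 \<or> s = -1)
    \<and> (\<forall>\<alpha> \<beta>. u < \<alpha> \<longrightarrow> \<alpha> < v \<longrightarrow> \<beta> < v \<longrightarrow> (\<forall>\<^sub>F n in sequentially. \<beta> < zpow f (s * int n) \<alpha>))
    \<and> (\<forall>\<alpha> \<beta>. u < \<alpha> \<longrightarrow> \<alpha> < v \<longrightarrow> u < \<beta> \<longrightarrow> (\<forall>\<^sub>F n in sequentially. zpow f (- (s * int n)) \<alpha> < \<beta>))"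
proof -
  obtain s :: int where s: "s = 1 \<or> s = -1"
    and up: "\<And>\<alpha> \<beta>. u < \<alpha> \<Longrightarrow> \<alpha> < v \<Longrightarrow> \<beta> < v \<Longrightarrow> \<forall>\<^sub>F n in sequentially. \<beta> < zpow f (s * int n) \<alpha>"
  proof (cases "\<forall>x. u < x \<and> x < v \<longrightarrow> x < f x")
    case True
    show ?thesis
      by (rule that[of 1]) (use orb_escape_up[OF f] True in \<open>auto simp: zpow_of_nat\<close>)
  next
    case False
    then have down: "f x < x" if "u < x" "x < v" for x using orb_sign[OF f] that by blast
    have "x < inv f x" if "u < x" "x < v" for x
    proof -
      have "u < inv f x" "inv f x < v"
        using orb_zpow_less[OF f, of "-1"] that by (simp_all add: zpow_def)
      then show ?thesis using down[of "inv f x"] f(1) by simp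
    qed
    then show ?thesis
      by (intro that[of "-1"]) (use orb_escape_up[OF homeo_inv[OF f(1)] orb_inv[OF f]] in \<open>auto simp: zpow_minus_of_nat\<close>)
  qed
  have "\<forall>\<^sub>F n in sequentially. zpow f (- (s * int n)) \<alpha> < \<beta>" if *: "u < \<alpha>" "\<alpha> < v" "u < \<beta>" for \<alpha> \<beta>
  proof -
    have uv: "u < v" using f(2) by (simp add: orb_def)
    \<comment> \<open>Once the forward power lifts \<open>\<gamma>\<close> above
      \<open>\<alpha>\<close>, the backward power brings \<open>\<alpha>\<close> below
      \<open>\<gamma>\<close>, hence below \<open>\<beta>\<close>.\<close>
    obtain \<gamma> where \<gamma>: "u < \<gamma>" "\<gamma> < \<beta>" "\<gamma> < v" using dense[of u "min \<beta> v"] * uv by auto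
    have "\<forall>\<^sub>F n in sequentially. \<alpha> < zpow f (s * int n) \<gamma>" by (rule up) (use \<gamma> * in auto)
    then show ?thesis
    proof eventually_elim
      case (elim n)
      then have "zpow f (- (s * int n)) \<alpha> < zpow f (- (s * int n)) (zpow f (s * int n) \<gamma>)"
        by (simp add: homeo_less_iff[OF homeo_zpow[OF f(1)]])
      also have "\<dots> = \<gamma>" by (simp flip: zpow_add'[OF homeo_bij[OF f(1)]])
      finally show ?case using \<gamma> by simp
    qed
  qed
  then show ?thesis using up s by (intro exI[of _ s]) simp
qed

section \<open>The frontier of the support and displacement of compact sets\<close>

text \<open>For a homeomorphism this is the topological frontier of \<open>moved f\<close>; it
  contains all ends of orbitals.\<close>

definition fr :: "(real \<Rightarrow> real) \<Rightarrow> real set" where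
  "fr f = {e. f e = e \<and> \<not> (\<forall>\<^sub>F t in at e. f t = t)}"

lemma at_germs: "(\<forall>\<^sub>F t in at e. P t) \<longleftrightarrow> (\<forall>F. germ e F \<longrightarrow> (\<forall>\<^sub>F t in F. P t))" for e :: real
  unfolding germ_def using eventually_at_split[of P e] by auto

lemma orb_fr:
  assumes "orb f u v" shows "u \<in> fr f" "v \<in> fr f"
proof -
  have uv: "u < v" "f u = u" "f v = v" "\<And>x. u < x \<Longrightarrow> x < v \<Longrightarrow> f x \<noteq> x" using assms by (auto simp: orb_def)
  have "\<forall>\<^sub>F t in at_right u. f t \<noteq> t" "\<forall>\<^sub>F t in at_left v. f t \<noteq> t"
    using eventually_at_right_field uv by (auto simp: eventually_at_right_field eventually_at_left_field)
  then have "\<not> (\<forall>\<^sub>F t in at_right u. f t = t)" "\<not> (\<forall>\<^sub>F t in at_left v. f t = t)"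
    using germ_not_both[of u "at_right u" "\<lambda>t. f t = t"] germ_not_both[of v "at_left v" "\<lambda>t. f t = t"]
    by (auto simp: germ_def)
  then show "u \<in> fr f" "v \<in> fr f" using uv by (auto simp: fr_def eventually_at_split)
qed

text \<open>An infinite frontier would accumulate at some \<open>l\<close>; but on each side of
  \<open>l\<close> the map is eventually the identity or eventually without fixed points, and
  neither leaves frontier points near \<open>l\<close>.\<close>

lemma finite_fr:
  assumes "pl_homeo f" shows "finite (fr f)"
proof (rule ccontr)
  assume inf: "infinite (fr f)"
  have "fr f \<subseteq> {0..1}"
  proof
    fix e assume e: "e \<in> fr f"
    show "e \<in> {0..1}"
    proof (rule ccontr)
      assume "e \<notin> {0..1}"
      then have "e \<in> - {0..1}" "open (- {0..1::real})" by auto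
      then have "\<forall>\<^sub>F t in at e. t \<in> - {0..1}" using eventually_at_in_open' by blast
      then have "\<forall>\<^sub>F t in at e. f t = t"
        by eventually_elim (use pl_homeo_outside[OF assms] in force)
      then show False using e by (simp add: fr_def)
    qed
  qed
  then obtain l where l: "l islimpt fr f"
    using inf compact_eq_Bolzano_Weierstrass[of "{0..1::real}"] by auto
  have "\<forall>\<^sub>F e in F. e \<notin> fr f" if F: "germ l F" for F
  proof -
    \<comment> \<open>One-sided neighbourhoods of \<open>l\<close> are open intervals, so what holds
      near \<open>l\<close> on one side holds around each nearby point of that side.\<close>
    have op: "\<forall>\<^sub>F e in F. \<forall>\<^sub>F t in at e. P t" if P: "\<forall>\<^sub>F t in F. P t" for P
    proof -
      have ev: "\<forall>\<^sub>F t in at e. P t" if "open S" "e \<in> S" "\<And>t. t \<in> S \<Longrightarrow> P t" for e S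
        using that eventually_at_topological by blast
      from F show ?thesis unfolding germ_def
      proof
        assume *: "F = at_right l" 
        then obtain b where "l < b" "\<And>y. l < y \<Longrightarrow> y < b \<Longrightarrow> P y" using P by (auto simp: eventually_at_right_field)
        then show ?thesis unfolding * eventually_at_right_field
          using ev[of "{l<..<b}"] by (intro exI[of _ b]) auto
      next
        assume *: "F = at_left l" 
        then obtain b where "b < l" "\<And>y. b < y \<Longrightarrow> y < l \<Longrightarrow> P y" using P by (auto simp: eventually_at_left_field)
        then show ?thesis unfolding * eventually_at_left_field
          using ev[of "{b<..<l}"] by (intro exI[of _ b]) auto
      qed
    qed
    show ?thesis
    proof (rule germ_cases[OF assms F])
      assume "\<forall>\<^sub>F x in F. f x = x"
      from op[OF this] show ?thesis by eventually_elim (simp add: fr_def)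
    next
      assume "\<forall>\<^sub>F x in F. f x \<noteq> x"
      then show ?thesis by eventually_elim (simp add: fr_def)
    qed
  qed
  then have "\<forall>\<^sub>F e in at l. e \<notin> fr f" by (simp add: at_germs)
  then show False using l by (simp add: islimpt_iff_eventually)
qed

text \<open>An interval that meets an orbital but no frontier point cannot reach an end of that
  orbital.\<close>

lemma no_fr_cases:
  assumes "pl_homeo f" "{s..t} \<inter> fr f = {}"
  obtains (fixed) "\<And>x. s \<le> x \<Longrightarrow> x \<le> t \<Longrightarrow> f x = x"
  | (orbital) u v where "orb f u v" "u < s" "t < v"
proof (cases "\<forall>x. s \<le> x \<and> x \<le> t \<longrightarrow> f x = x")
  case False
  then obtain x where x: "s \<le> x" "x \<le> t" "f x \<noteq> x" by blast
  obtain u v where uv: "orb f u v" "u < x" "x < v" using ex_orb[OF assms(1) x(3)] by blast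
  then have "u < s" "t < v" using orb_fr[OF uv(1)] assms(2) x by (auto simp: disjoint_iff) (meson le_less_trans less_imp_le not_le order_trans)+
  then show ?thesis using orbital uv by blast
qed (use fixed in blast)

text \<open>Within one orbital the compact set lies between its least point \<open>a\<close> and its
  greatest point \<open>b\<close>, and high powers carry \<open>a\<close> beyond \<open>b\<close>,
  or \<open>b\<close> below \<open>a\<close> in the opposite direction. The ends of orbitals lie in
  the finite set \<open>fr f\<close>, so one bound on the exponent works for all orbitals.\<close>

lemma compact_wanders:
  assumes f: "pl_homeo f" and K: "compact K" "K \<subseteq> moved f"
  shows "\<forall>\<^sub>F n in sequentially. \<forall>x\<in>K. zpow f (int n) x \<notin> K \<and> zpow f (- int n) x \<notin> K"
proof -
  note h = pl_homeo_homeo[OF f]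
  define W where "W p n \<longleftrightarrow> (\<forall>x\<in>K. orb f (fst p) (snd p) \<and> fst p < x \<and> x < snd p \<longrightarrow>
    zpow f (int n) x \<notin> K \<and> zpow f (- int n) x \<notin> K)" for p n
  have "\<forall>\<^sub>F n in sequentially. W p n" for p
  proof (cases "orb f (fst p) (snd p) \<and> K \<inter> {fst p .. snd p} \<noteq> {}")
    case True
    define u v where "u = fst p" and "v = snd p"
    have o: "orb f u v" and ne: "K \<inter> {u..v} \<noteq> {}" using True by (auto simp: u_def v_def)
    have c: "compact (K \<inter> {u..v})" using K(1) by (intro compact_Int) auto
    define a b where "a = Inf (K \<inter> {u..v})" and "b = Sup (K \<inter> {u..v})"
    have cl: "closed (K \<inter> {u..v})" and bdd: "bdd_below (K \<inter> {u..v})" "bdd_above (K \<inter> {u..v})"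
      using compact_imp_closed[OF c] compact_imp_bounded[OF c]
      by (simp_all only: bounded_imp_bdd_below bounded_imp_bdd_above)
    have ab: "a \<in> K \<inter> {u..v}" "b \<in> K \<inter> {u..v}"
      unfolding a_def b_def
      by (rule closed_contains_Inf[OF ne bdd(1) cl], rule closed_contains_Sup[OF ne bdd(2) cl])
    have "u \<notin> K" "v \<notin> K" using o K(2) by (auto simp: orb_def moved_def)
    then have uv: "u < a" "a < v" "u < b" "b < v" using ab by (auto simp: less_le)
    have bd: "a \<le> x \<and> x \<le> b" if "x \<in> K" "u < x" "x < v" for x
      unfolding a_def b_def using that
      by (intro conjI cInf_lower[OF _ bdd(1)] cSup_upper[OF _ bdd(2)]) auto
    obtain s :: int where s: "s = 1 \<or> s = -1"
      and s1: "\<forall>\<^sub>F n in sequentially. b < zpow f (s * int n) a"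
      and s2: "\<forall>\<^sub>F n in sequentially. zpow f (- (s * int n)) b < a"
      using orb_escape[OF h o] uv by blast
    show ?thesis using s1 s2
    proof eventually_elim
      case (elim n)
      have "zpow f (s * int n) x \<notin> K \<and> zpow f (- (s * int n)) x \<notin> K" if x: "x \<in> K" "u < x" "x < v" for x
      proof -
        have "b < zpow f (s * int n) x" "zpow f (- (s * int n)) x < a"
          using elim bd[OF x] homeo_le_iff[OF homeo_zpow[OF h], of "s * int n" a x]
            homeo_le_iff[OF homeo_zpow[OF h], of "- (s * int n)" x b] by linarith+
        then show ?thesis using bd[of "zpow f (s * int n) x"] bd[of "zpow f (- (s * int n)) x"]
            orb_zpow_less[OF h o] x by fastforce
      qed
      then show ?case using s unfolding W_def u_def v_def by auto
    qed
  next
    case False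
    then show ?thesis by (intro always_eventually) (auto simp: W_def)
  qed
  then have "\<forall>\<^sub>F n in sequentially. \<forall>p \<in> fr f \<times> fr f. W p n"
    using finite_fr[OF f] by (intro eventually_ball_finite) auto
  then show ?thesis
  proof eventually_elim
    case (elim n)
    show ?case
    proof
      fix x assume x: "x \<in> K"
      then have "f x \<noteq> x" using K(2) by (auto simp: moved_def)
      then obtain u v where uv: "orb f u v" "u < x" "x < v" using ex_orb[OF f] by blast
      then have "W (u, v) n" using elim orb_fr[OF uv(1)] by auto
      then show "zpow f (int n) x \<notin> K \<and> zpow f (- int n) x \<notin> K"
        using x uv by (auto simp: W_def)
    qed
  qed
qed

section \<open>Words in two homeomorphisms\<close>

lemma comm_apply: "bij g \<Longrightarrow> g (inv k z) = inv k z \<Longrightarrow> bij k \<Longrightarrow> comm g k z = g z"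
  unfolding comm_def by (metis comp_apply bij_inv_eq_iff)

lemma comm_localised:
  assumes g: "bij g" and k: "bij k" "moved k \<subseteq> V" "k ` V = V"
    and S: "S = moved g \<inter> V" "g ` S = S" "k ` S \<inter> S = {}"
  shows "z \<in> S \<Longrightarrow> comm g k z = g z" and "moved (comm g k) \<subseteq> S \<union> k ` S"
proof -
  have gi: "g (inv g z) = z" "inv g (g z) = z" and ki: "k (inv k z) = z" "inv k (k z) = z" for z
    using g k(1) by (simp_all add: bij_is_inj bij_is_surj surj_f_inv_f)
  have kV: "inv k z \<in> V \<longleftrightarrow> z \<in> V" for z using k(3) ki by (metis imageE imageI)
  have gS: "inv g z \<in> S \<longleftrightarrow> z \<in> S" for z using S(2) gi by (metis imageE imageI)
  have fx: "g z = z" if "z \<in> V" "z \<notin> S" for z using that S(1) by (auto simp: moved_def)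
  have fx': "inv g z = z" if "z \<in> V" "z \<notin> S" for z using fx[OF that] gi by metis
  have c: "comm g k z = g (k (inv g (inv k z)))" for z by (simp add: comm_def)
  show 1: "comm g k z = g z" if "z \<in> S" for z
  proof -
    have "inv k z \<notin> S" using S(3) that ki by (metis disjoint_iff imageI)
    then show ?thesis using fx'[of "inv k z"] that kV S(1) by (simp add: c ki)
  qed
  have "comm g k z = z" if z: "z \<notin> S" "z \<notin> k ` S" for z
  proof (cases "z \<in> V")
    case True
    have "inv k z \<notin> S" using z(2) ki by (metis imageI)
    then have "inv g (inv k z) = inv k z" using fx' kV True by blast
    then show ?thesis using fx[OF True z(1)] by (simp add: c ki)
  next
    case False
    have "inv k z = z" using k(2) False ki by (metis (mono_tags, lifting) mem_Collect_eq moved_def subsetD)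
    moreover have "inv g z \<notin> V"
    proof
      assume v: "inv g z \<in> V"
      then have "inv g z \<notin> S" using gS z(1) by blast
      then have "inv g z = z" using fx v gi by metis
      then show False using v False by simp
    qed
    then have "k (inv g z) = inv g z" using k(2) by (auto simp: moved_def)
    ultimately show ?thesis by (simp add: c gi)
  qed
  then show "moved (comm g k) \<subseteq> S \<union> k ` S" by (auto simp: moved_def)
qed

lemma moved_conj: "bij w \<Longrightarrow> moved (w \<circ> f \<circ> inv w) = w ` moved f"
proof (intro equalityI subsetI)
  fix z assume w: "bij w" and "z \<in> moved (w \<circ> f \<circ> inv w)"
  then have "inv w z \<in> moved f" by (auto simp: moved_def bij_is_surj surj_f_inv_f)
  then show "z \<in> w ` moved f" using w by (metis bij_inv_eq_iff image_eqI)
next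
  fix z assume w: "bij w" and "z \<in> w ` moved f"
  then show "z \<in> moved (w \<circ> f \<circ> inv w)" by (auto simp: moved_def bij_is_inj inj_eq)
qed

lemma closure_image_homeo:
  assumes "homeo g" shows "closure (g ` A) \<subseteq> g ` closure A"
proof (rule closure_minimal)
  have "g ` closure A = inv g -` closure A"
    using assms by (auto simp: image_iff) (metis homeo_inv2)
  moreover have "closed (inv g -` closure A)"
    using continuous_closed_vimage[of "closure A" "inv g"] homeo_isCont[OF homeo_inv[OF assms]] by simp
  ultimately show "closed (g ` closure A)" by simp
qed (simp add: closure_subset image_mono)

section \<open>Groups of piecewise linear homeomorphisms and words in two elements\<close>

locale pl_group =
  fixes H :: "(real \<Rightarrow> real) set"
  assumes pl: "f \<in> H \<Longrightarrow> pl_homeo f"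
    and id_mem: "id \<in> H"
    and comp_mem: "f \<in> H \<Longrightarrow> g \<in> H \<Longrightarrow> f \<circ> g \<in> H"
    and inv_mem: "f \<in> H \<Longrightarrow> inv f \<in> H"
begin

lemma hom: "f \<in> H \<Longrightarrow> homeo f"
  by (rule pl_homeo_homeo[OF pl])

lemma bijH: "f \<in> H \<Longrightarrow> bij f"
  by (rule homeo_bij[OF hom])

lemma funpow_mem: "f \<in> H \<Longrightarrow> f ^^ n \<in> H"
proof (induction n)
  case 0
  show ?case by (simp only: funpow.simps id_mem)
next
  case (Suc n)
  then show ?case by (simp only: funpow.simps comp_mem)
qed

lemma zpow_mem: "f \<in> H \<Longrightarrow> zpow f k \<in> H"
  by (simp add: zpow_def funpow_mem inv_mem)

lemma comm_mem: "f \<in> H \<Longrightarrow> g \<in> H \<Longrightarrow> comm f g \<in> H"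
  unfolding comm_def by (intro comp_mem inv_mem)

lemma conj_mem: "f \<in> H \<Longrightarrow> g \<in> H \<Longrightarrow> f \<circ> g \<circ> inv f \<in> H"
  by (intro comp_mem inv_mem)

end

text \<open>Nesting is required of the closures because these are compact, as
  \<open>compact_wanders\<close> demands.\<close>

definition descending :: "(real \<Rightarrow> real) set \<Rightarrow> bool" where
  "descending H \<longleftrightarrow> (\<exists>f :: nat \<Rightarrow> real \<Rightarrow> real.
     \<forall>n. f n \<in> H \<and> f n \<noteq> id \<and> closure (moved (f (Suc n))) \<subseteq> moved (f n))"

inductive_set words :: "(real \<Rightarrow> real) \<Rightarrow> (real \<Rightarrow> real) \<Rightarrow> (real \<Rightarrow> real) set" for x y where
  words_id: "id \<in> words x y"
| words_l: "z \<in> words x y \<Longrightarrow> x \<circ> z \<in> words x y"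
| words_li: "z \<in> words x y \<Longrightarrow> inv x \<circ> z \<in> words x y"
| words_r: "z \<in> words x y \<Longrightarrow> y \<circ> z \<in> words x y"
| words_ri: "z \<in> words x y \<Longrightarrow> inv y \<circ> z \<in> words x y"

lemma words_comp:
  "z \<in> words x y \<Longrightarrow> z' \<in> words x y \<Longrightarrow> z \<circ> z' \<in> words x y"
  by (induction rule: words.induct) (simp_all only: id_comp comp_assoc words.intros)

lemma words_funpow:
  assumes "a \<in> words x y" shows "a ^^ n \<in> words x y"
proof (induction n)
  case 0
  show ?case by (simp only: funpow.simps words_id)
next
  case (Suc n)
  then show ?case by (simp only: funpow.simps words_comp assms)
qed

lemma words_zpow:
  assumes "a = x \<or> a = y" shows "zpow a k \<in> words x y"
proof -
  have "a \<in> words x y" "inv a \<in> words x y"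
    using assms words.intros(2-5)[OF words_id[of x y]] by (auto simp only: comp_id)
  then show ?thesis unfolding zpow_def using words_funpow by simp
qed

lemma (in pl_group) words_mem: "x \<in> H \<Longrightarrow> y \<in> H \<Longrightarrow> z \<in> words x y \<Longrightarrow> z \<in> H"
proof -
  assume "x \<in> H" "y \<in> H" 
  show "z \<in> words x y \<Longrightarrow> z \<in> H"
    by (induction rule: words.induct) (simp_all only: id_mem comp_mem inv_mem \<open>x \<in> H\<close> \<open>y \<in> H\<close>)
qed

lemma words_fixed:
  assumes "homeo x" "homeo y" "x t = t" "y t = t"
  shows "z \<in> words x y \<Longrightarrow> z t = t"
proof (induction rule: words.induct)
  case (words_li z)
  then show ?case using homeo_inv1[OF assms(1), of t] assms(3) by simp
next
  case (words_ri z)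
  then show ?case using homeo_inv1[OF assms(2), of t] assms(4) by simp
qed (simp_all add: assms)

section \<open>Moving intervals off a finite set\<close>

lemma gap_right:
  fixes P :: "real set"
  assumes "finite P" "u < v"
  obtains \<beta> where "u < \<beta>" "\<beta> < v" "P \<inter> {u<..<\<beta>} = {}"
proof -
  define \<beta> where "\<beta> = Min (insert ((u + v) / 2) (P \<inter> {u<..}))"
  have *: "\<beta> \<in> insert ((u + v) / 2) (P \<inter> {u<..})" unfolding \<beta>_def by (rule Min_in) (use assms in auto)
  have fin: "finite (insert ((u + v) / 2) (P \<inter> {u<..}))" using assms(1) by simp
  have "\<beta> \<le> (u + v) / 2" "\<And>p. p \<in> P \<Longrightarrow> u < p \<Longrightarrow> \<beta> \<le> p"
    unfolding \<beta>_def by (rule Min_le[OF fin], simp)+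
  then show ?thesis using that[of \<beta>] * assms(2) by force
qed

lemma gap_left:
  fixes P :: "real set"
  assumes "finite P" "u < v"
  obtains \<beta> where "u < \<beta>" "\<beta> < v" "P \<inter> {\<beta><..<v} = {}"
proof -
  define \<beta> where "\<beta> = Max (insert ((u + v) / 2) (P \<inter> {..<v}))"
  have *: "\<beta> \<in> insert ((u + v) / 2) (P \<inter> {..<v})" unfolding \<beta>_def by (rule Max_in) (use assms in auto)
  have fin: "finite (insert ((u + v) / 2) (P \<inter> {..<v}))" using assms(1) by simp
  have "(u + v) / 2 \<le> \<beta>" "\<And>p. p \<in> P \<Longrightarrow> p < v \<Longrightarrow> p \<le> \<beta>"
    unfolding \<beta>_def by (rule Max_ge[OF fin], simp)+
  then show ?thesis using that[of \<beta>] * assms(2) by force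
qed

text \<open>As \<open>P\<close> contains the frontier of the support, a \<open>P\<close>-free
  interval is either fixed pointwise or lies inside one orbital of \<open>a\<close>. In the second
  case high powers squeeze it against an end of the orbital, into a gap of \<open>P\<close>.\<close>

lemma gap_free_zpow:
  assumes a: "pl_homeo a" and P: "finite P" "fr a \<subseteq> P" and st: "s \<le> t" "{s..t} \<inter> P = {}"
    and \<sigma>: "\<sigma> = 1 \<or> \<sigma> = (-1::int)"
  shows "\<forall>\<^sub>F n in sequentially. {zpow a (\<sigma> * int n) s .. zpow a (\<sigma> * int n) t} \<inter> P = {}"
proof -
  note h = pl_homeo_homeo[OF a]
  have "{s..t} \<inter> fr a = {}" using st(2) P(2) by blast
  then show ?thesis
  proof (rule no_fr_cases[OF a])
    assume "\<And>x. s \<le> x \<Longrightarrow> x \<le> t \<Longrightarrow> a x = x"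
    then have "zpow a k s = s" "zpow a k t = t" for k using st(1) by (simp_all add: zpow_fixed homeo_bij[OF h])
    then show ?thesis using st(2) by simp
  next
    fix u v assume uv: "orb a u v" "u < s" "t < v"
    obtain d :: int where d: "d = 1 \<or> d = -1"
      and up: "\<forall>\<alpha> \<beta>. u < \<alpha> \<longrightarrow> \<alpha> < v \<longrightarrow> \<beta> < v \<longrightarrow> (\<forall>\<^sub>F n in sequentially. \<beta> < zpow a (d * int n) \<alpha>)"
      and down: "\<forall>\<alpha> \<beta>. u < \<alpha> \<longrightarrow> \<alpha> < v \<longrightarrow> u < \<beta> \<longrightarrow> (\<forall>\<^sub>F n in sequentially. zpow a (- (d * int n)) \<alpha> < \<beta>)"
      using orb_escape[OF h uv(1)] by blast
    have in_uv: "u < zpow a k s" "zpow a k t < v" for k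
      using orb_zpow_less[OF h uv(1)] uv by simp_all
    consider "\<sigma> = d" | "\<sigma> = - d" using \<sigma> d by auto
    then show ?thesis
    proof cases
      case 1
      obtain \<beta> where \<beta>: "u < \<beta>" "\<beta> < v" "P \<inter> {\<beta><..<v} = {}"
        using gap_left[OF P(1)] uv(1) unfolding orb_def by metis
      have "\<forall>\<^sub>F n in sequentially. \<beta> < zpow a (d * int n) s" by (rule up[rule_format]) (use uv st \<beta> in auto)
      then show ?thesis
      proof eventually_elim
        case (elim n)
        have "{zpow a (\<sigma> * int n) s .. zpow a (\<sigma> * int n) t} \<subseteq> {\<beta><..<v}"
          using elim in_uv(2)[of "d * int n"] 1 by auto
        then show ?case using \<beta>(3) by blast
      qed
    next
      case 2
      obtain \<beta> where \<beta>: "u < \<beta>" "\<beta> < v" "P \<inter> {u<..<\<beta>} = {}"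
        using gap_right[OF P(1)] uv(1) unfolding orb_def by metis
      have "\<forall>\<^sub>F n in sequentially. zpow a (- (d * int n)) t < \<beta>" by (rule down[rule_format]) (use uv st \<beta> in auto)
      then show ?thesis
      proof eventually_elim
        case (elim n)
        have "{zpow a (\<sigma> * int n) s .. zpow a (\<sigma> * int n) t} \<subseteq> {u<..<\<beta>}"
          using elim in_uv(1)[of "- (d * int n)"] 2 by auto
        then show ?case using \<beta>(3) by blast
      qed
    qed
  qed
qed

definition joint_orb :: "(real \<Rightarrow> real) \<Rightarrow> (real \<Rightarrow> real) \<Rightarrow> real \<Rightarrow> real \<Rightarrow> bool" where
  "joint_orb x y l r \<longleftrightarrow> l < r \<and> x l = l \<and> y l = l \<and> x r = r \<and> y r = r
     \<and> (\<forall>t. l < t \<and> t < r \<longrightarrow> x t \<noteq> t \<or> y t \<noteq> t)"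

lemma ex_joint_orb:
  assumes "pl_homeo x" "pl_homeo y" "x t \<noteq> t \<or> y t \<noteq> t"
  obtains l r where "joint_orb x y l r" "l < t" "t < r"
proof -
  have t: "0 < t" "t < 1" using pl_homeo_outside assms by blast+
  have S: "closed {t. x t = t \<and> y t = t}"
    using closed_Int[OF fixed_closed fixed_closed, OF pl_homeo_homeo pl_homeo_homeo, OF assms(1,2)]
    by (simp add: Collect_conj_eq)
  have "x 0 = 0" "y 0 = 0" "x 1 = 1" "y 1 = 1" using assms(1,2) by (auto simp: pl_homeo_def)
  then obtain l r where "l \<in> {t. x t = t \<and> y t = t}" "r \<in> {t. x t = t \<and> y t = t}" "l < t" "t < r"
    "\<And>s. l < s \<Longrightarrow> s < r \<Longrightarrow> s \<notin> {t. x t = t \<and> y t = t}"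
    using ex_orb_gen[OF S, of 0 1 t] assms(3) t unfolding mem_Collect_eq by (smt (verit, best))
  then show ?thesis using that[of l r] unfolding joint_orb_def by auto
qed

lemma joint_orb_bounds:
  assumes "joint_orb x y l r" "\<And>z. s \<le> z \<Longrightarrow> z \<le> t \<Longrightarrow> x z \<noteq> z \<or> y z \<noteq> z"
    and "s \<le> p" "p \<le> t" "l < p" "p < r"
  shows "l < s" "t < r"
  using assms(2)[of l] assms(2)[of r] assms(1,3-) unfolding joint_orb_def by force+

locale pl_pair = 
  fixes x y :: "real \<Rightarrow> real" and P :: "real set"
  assumes x: "pl_homeo x" and y: "pl_homeo y" and P: "finite P" "fr x \<subseteq> P" "fr y \<subseteq> P"
begin

lemma words_homeo: "z \<in> words x y \<Longrightarrow> homeo z"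
  by (induction rule: words.induct)
    (simp_all only: homeo_id homeo_comp homeo_inv pl_homeo_homeo x y)

lemma joint_orb_words:
  assumes "joint_orb x y l r" "z \<in> words x y"
  shows "l < z t \<longleftrightarrow> l < t" "z t < r \<longleftrightarrow> t < r"
proof -
  have "z l = l" "z r = r"
    using assms words_fixed[OF pl_homeo_homeo[OF x] pl_homeo_homeo[OF y]] by (auto simp: joint_orb_def)
  then show "l < z t \<longleftrightarrow> l < t" "z t < r \<longleftrightarrow> t < r"
    using homeo_fixed_ends[OF words_homeo[OF assms(2)]] by blast+
qed

definition free :: "(real \<Rightarrow> real) \<Rightarrow> (real \<times> real) set \<Rightarrow> bool" where
  "free g \<K> \<longleftrightarrow> (\<forall>s t. (s, t) \<in> \<K> \<longrightarrow> {g s .. g t} \<inter> P = {})"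

lemma free_comp: "free g (map_prod f f ` \<K>) = free (g \<circ> f) \<K>"
  by (force simp: free_def)

lemma free_zpow:
  assumes "a = x \<or> a = y" "finite \<K>" "\<And>s t. (s, t) \<in> \<K> \<Longrightarrow> s \<le> t" "free id \<K>"
    and "\<sigma> = 1 \<or> \<sigma> = (-1::int)"
  shows "\<forall>\<^sub>F n in sequentially. free (zpow a (\<sigma> * int n)) \<K>"
proof -
  have "pl_homeo a" "fr a \<subseteq> P" using assms(1) x y P by auto
  then have "\<forall>\<^sub>F n in sequentially. \<forall>p\<in>\<K>. {zpow a (\<sigma> * int n) (fst p) .. zpow a (\<sigma> * int n) (snd p)} \<inter> P = {}"
    using assms P
    by (intro eventually_ball_finite ballI gap_free_zpow) (simp_all add: free_def split_paired_all)
  then show ?thesis by eventually_elim (force simp: free_def)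
qed

text \<open>Powers of the letters keep \<open>P\<close>-free intervals \<open>P\<close>-free; among all such words, one that
  minimises the number of points of \<open>P\<close> in \<open>{l<..g t}\<close> leaves none.\<close>

lemma push_left:
  assumes "joint_orb x y l r" "l < t" "t < r"
    and "finite \<K>" "\<And>s t. (s, t) \<in> \<K> \<Longrightarrow> s \<le> t" "free id \<K>"
  shows "\<exists>g \<in> words x y. free g \<K> \<and> P \<inter> {l<..g t} = {}"
  using assms(2-)
proof (induction "card (P \<inter> {l<..t})" arbitrary: t \<K> rule: less_induct)
  case less
  show ?case
  proof (cases "P \<inter> {l<..t} = {}")
    case True
    then show ?thesis using less.prems(5) words_id by (intro bexI[of _ id]) auto
  next
    case False
    have fin: "finite (P \<inter> {l<..t})" using P(1) by simp
    define p where "p = Max (P \<inter> {l<..t})"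
    have p: "p \<in> P" "l < p" "p \<le> t" using Max_in[OF fin False] by (auto simp: p_def)
    have p_max: "q \<le> p" if "q \<in> P" "l < q" "q \<le> t" for q
      unfolding p_def by (rule Max_ge[OF fin]) (use that in auto)
    have "x p \<noteq> p \<or> y p \<noteq> p" using assms(1) p less.prems(2) by (auto simp: joint_orb_def)
    then obtain a where a: "a = x \<or> a = y" "a p \<noteq> p" by blast
    have pla: "pl_homeo a" "fr a \<subseteq> P" using a(1) x y P by auto
    note h = pl_homeo_homeo[OF pla(1)]
    obtain u v where uv: "orb a u v" "u < p" "p < v" using ex_orb[OF pla(1) a(2)] by blast
    have "a l = l" using a(1) assms(1) by (auto simp: joint_orb_def)
    then have lu: "l \<le> u" using orb_fixed_outside[OF uv(1)] uv p by fastforce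
    \<comment> \<open>Otherwise \<open>v\<close>, a frontier point and so a member of
      \<open>P\<close>, would be a point of \<open>P\<close> in \<open>{l<..t}\<close> beyond the
      largest one.\<close>
    have tv: "t < v"
    proof (rule ccontr)
      assume "\<not> t < v"
      then have "v \<le> p" using p_max[of v] orb_fr[OF uv(1)] pla(2) uv p by auto
      then show False using uv by simp
    qed
    obtain \<beta> where \<beta>: "u < \<beta>" "\<beta> < v" "P \<inter> {u<..<\<beta>} = {}"
      using gap_right[OF P(1)] uv by (metis less_trans)
    obtain d :: int where d: "d = 1 \<or> d = -1"
      and down: "\<forall>\<alpha> \<beta>. u < \<alpha> \<longrightarrow> \<alpha> < v \<longrightarrow> u < \<beta> \<longrightarrow> (\<forall>\<^sub>F n in sequentially. zpow a (- (d * int n)) \<alpha> < \<beta>)"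
      using orb_escape[OF h uv(1)] by blast
    have ev: "\<forall>\<^sub>F n in sequentially. zpow a (- (d * int n)) t < \<beta>"
      by (rule down[rule_format]) (use uv p tv \<beta> in auto)
    have "\<forall>\<^sub>F n in sequentially. free (zpow a (- d * int n)) \<K>"
      by (rule free_zpow) (use a d less.prems in auto)
    then obtain n where n: "free (zpow a (- d * int n)) \<K>" "zpow a (- (d * int n)) t < \<beta>"
      using eventually_happens[OF eventually_conj[OF _ ev]] by auto
    define f where "f = zpow a (- d * int n)"
    have fw: "f \<in> words x y" unfolding f_def by (rule words_zpow[OF a(1)])
    have ft: "f t < \<beta>" "u < f t"
      using n(2) orb_zpow_less(1)[OF h uv(1), of "- d * int n" t] uv p by (simp_all add: f_def)
    \<comment> \<open>The push brings \<open>f t\<close> into the gap of \<open>P\<close> just above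
      \<open>u\<close>, so \<open>p\<close> is no longer counted and nothing new is.\<close>
    have "P \<inter> {l<..f t} \<subseteq> P \<inter> {l<..t} - {p}"
    proof
      fix q assume q: "q \<in> P \<inter> {l<..f t}"
      have "q \<notin> {u<..<\<beta>}" using \<beta>(3) q by blast
      then have "q \<le> u" using q ft(1) by simp
      then show "q \<in> P \<inter> {l<..t} - {p}" using q uv p by simp
    qed
    then have "card (P \<inter> {l<..f t}) < card (P \<inter> {l<..t})"
      using p fin by (intro psubset_card_mono) auto
    moreover have "l < f t" "f t < r" using joint_orb_words[OF assms(1) fw] less.prems by auto
    moreover have "s \<le> t" if "(s, t) \<in> map_prod f f ` \<K>" for s t
      using that less.prems(4) homeo_le_iff[OF words_homeo[OF fw]] by auto
    moreover have "free id (map_prod f f ` \<K>)"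
      unfolding free_comp id_comp using n(1) by (simp only: f_def)
    moreover have "finite (map_prod f f ` \<K>)" using less.prems by simp
    ultimately obtain g where g: "g \<in> words x y" "free g (map_prod f f ` \<K>)" "P \<inter> {l<..g (f t)} = {}"
      using less.hyps[of "f t" "map_prod f f ` \<K>"] by metis
    show ?thesis
      by (intro bexI[of _ "g \<circ> f"] words_comp g fw) (use g in \<open>simp add: free_comp del: o_apply\<close>, simp)
  qed
qed

text \<open>The intervals are treated one at a time: \<open>push_left\<close> drives the next one
  towards the left end of its joint orbital, where it avoids \<open>P\<close>, while keeping the
  earlier ones free.\<close>

lemma merge:
  assumes "finite \<K>" "\<And>s t. (s, t) \<in> \<K> \<Longrightarrow> s \<le> t \<and> (\<forall>z. s \<le> z \<and> z \<le> t \<longrightarrow> x z \<noteq> z \<or> y z \<noteq> z)"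
  shows "\<exists>g \<in> words x y. free g \<K>"
  using assms
proof (induction \<K>)
  case empty
  then show ?case using words_id by (auto simp: free_def)
next
  case (insert p \<K>)
  obtain s t where p: "p = (s, t)" by (cases p)
  obtain f where f: "f \<in> words x y" "free f \<K>" using insert by auto
  have st: "s \<le> t" "\<And>z. s \<le> z \<Longrightarrow> z \<le> t \<Longrightarrow> x z \<noteq> z \<or> y z \<noteq> z" using insert.prems p by auto
  obtain l r where lr: "joint_orb x y l r" "l < t" "t < r"
    using ex_joint_orb[OF x y] st by blast
  have "l < s" using joint_orb_bounds(1)[OF lr(1) st(2) _ _ lr(2,3)] st(1) by blast
  have *: "s' \<le> t'" if "(s', t') \<in> map_prod f f ` \<K>" for s' t'
    using that insert.prems homeo_le_iff[OF words_homeo[OF f(1)]] by auto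
  have "free id (map_prod f f ` \<K>)" unfolding free_comp id_comp by (rule f(2))
  moreover have "l < f t" "f t < r" using joint_orb_words[OF lr(1) f(1)] lr by auto
  ultimately obtain g where g: "g \<in> words x y" "free g (map_prod f f ` \<K>)" "P \<inter> {l<..g (f t)} = {}"
    using push_left[OF lr(1), of "f t" "map_prod f f ` \<K>"] * insert.hyps by blast
  have "l < g (f s)" using joint_orb_words(1)[OF lr(1)] f(1) g(1) \<open>l < s\<close> by simp
  then have "{g (f s) .. g (f t)} \<inter> P = {}" using g(3) by force
  then have "free (g \<circ> f) (insert p \<K>)" using g(2) unfolding free_comp by (simp add: p free_def)
  then show ?case using words_comp g(1) f(1) by blast
qed

end

section \<open>Contracting elements\<close>

text \<open>Otherwise \<open>x\<close> and \<open>y\<close> commute along the whole orbit of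
  \<open>b\<close> under the group they generate, so \<open>x\<close>, fixing \<open>b\<close>,
  fixes the orbit pointwise. The infimum of the orbit is a common fixed point and must be
  \<open>l\<close>; then some orbit point lies strictly between \<open>l\<close> and
  \<open>b\<close>, where \<open>x\<close> fixes nothing.\<close>

lemma ex_word_moved_by_comm:
  assumes px: "pl_homeo x" and py: "pl_homeo y" and o: "orb x l b" and yl: "y l = l" and yb: "y b \<noteq> b"
  shows "\<exists>z \<in> words x y. comm x y (z b) \<noteq> z b"
proof (rule ccontr)
  assume "\<not> ?thesis"
  then have comm: "comm x y (z b) = z b" if "z \<in> words x y" for z using that by blast
  note hx = pl_homeo_homeo[OF px] and hy = pl_homeo_homeo[OF py]
  \<comment> \<open>The commutator is evaluated at \<open>y (x (z b))\<close>, where its two inverse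
    factors cancel.\<close>
  have xy: "x (y (z b)) = y (x (z b))" if "z \<in> words x y" for z
    using comm[OF words_r[OF words_l[OF that]]] by (simp add: comm_def hx hy)
  have x_fix: "x (z b) = z b" if "z \<in> words x y" for z
    using that
  proof (induction rule: words.induct)
    case words_id
    then show ?case using o by (simp add: orb_def)
  next
    case (words_l z)
    then show ?case by simp
  next
    case (words_li z)
    then show ?case by (metis comp_apply homeo_inv1 homeo_inv2 hx)
  next
    case (words_r z)
    then show ?case using xy by simp
  next
    case (words_ri z)
    have "y (x (inv y (z b))) = x (z b)"
      using xy[OF words.words_ri[OF words_ri.hyps]] hy by simp
    then have "y (x (inv y (z b))) = z b" using words_ri.IH by simp
    then show ?case using hy by (metis comp_apply homeo_inv1)
  qed
  define B where "B = (\<lambda>z. z b) ` words x y"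
  have lb: "l < b" "x l = l" using o by (auto simp: orb_def)
  interpret pl_pair x y "fr x \<union> fr y" by unfold_locales (use px py finite_fr in auto)
  have l_less: "l < z b" if "z \<in> words x y" for z
    using homeo_fixed_ends(1)[OF words_homeo[OF that] words_fixed[OF hx hy lb(2) yl that] words_fixed[OF hx hy lb(2) yl that]] lb(1) by simp
  have bO: "b \<in> B" unfolding B_def using words_id by (force intro: image_eqI[of _ _ id])
  have bdd: "bdd_below B" using l_less by (auto simp: B_def intro!: bdd_belowI[of _ l] less_imp_le)
  define m where "m = Inf B"
  have m_le: "m \<le> t" if "t \<in> B" for t unfolding m_def by (rule cInf_lower[OF that bdd])
  have le_m: "t \<le> m" if "\<And>s. s \<in> B \<Longrightarrow> t \<le> s" for t
    unfolding m_def by (rule cInf_greatest) (use bO that in auto)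
  \<comment> \<open>The infimum of a set invariant under an increasing bijection and its inverse is
    fixed by it.\<close>
  have m_fix: "a m = m" if "homeo a" "\<And>t. t \<in> B \<Longrightarrow> a t \<in> B" "\<And>t. t \<in> B \<Longrightarrow> inv a t \<in> B" for a
  proof (rule antisym)
    show "a m \<le> m"
    proof (rule le_m)
      fix s assume "s \<in> B"
      then have "m \<le> inv a s" by (intro m_le that)
      then show "a m \<le> s" using homeo_le_iff[OF that(1), of m "inv a s"] that(1) by simp
    qed
    have "inv a m \<le> m"
    proof (rule le_m)
      fix s assume "s \<in> B"
      then have "m \<le> a s" by (intro m_le that)
      then show "inv a m \<le> s" using homeo_le_iff[OF homeo_inv[OF that(1)], of m "a s"] that(1) by simp
    qed
    then show "m \<le> a m" using homeo_le_iff[OF that(1), of "inv a m" m] that(1) by simp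
  qed
  have "x m = m" by (rule m_fix[OF hx]) (auto simp: B_def intro: image_eqI[OF _ words_l] image_eqI[OF _ words_li])
  moreover have "y m = m" by (rule m_fix[OF hy]) (auto simp: B_def intro: image_eqI[OF _ words_r] image_eqI[OF _ words_ri])
  moreover have "l \<le> m" by (rule le_m) (use l_less in \<open>auto simp: B_def less_imp_le\<close>)
  moreover have "m \<le> b" using m_le bO by blast
  \<comment> \<open>Between \<open>l\<close> and \<open>b\<close> every point is moved by
    \<open>x\<close>, and \<open>b\<close> is moved by \<open>y\<close>.\<close>
  ultimately have "m = l" using o yb unfolding orb_def by (metis order_le_less)
  then obtain t where t: "t \<in> B" "t < b" using le_m[of b] lb(1) by (meson not_le)
  then have "x t = t" "l < t" using x_fix l_less by (auto simp: B_def)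
  then show False using o t(2) by (auto simp: orb_def)
qed

text \<open>The support of \<open>c\<close> conjugated by \<open>w\<close> meets that of
  \<open>c\<close> only inside orbitals of \<open>c\<close> that \<open>w\<close> maps strictly into
  themselves. A commutator with a power of \<open>c\<close> discards the rest, and the conjugates of
  the result by powers of \<open>w \<circ> w\<close> shrink.\<close>

lemma (in pl_group) contraction_descending:
  assumes c: "c \<in> H" and w: "w \<in> H"
    and split: "\<And>u v. orb c u v \<Longrightarrow> (\<forall>z. w u \<le> z \<and> z \<le> w v \<longrightarrow> c z = z) \<or>
      (\<exists>u' v'. orb c u' v' \<and> u' < w u \<and> w v < v' \<and> u' < w u' \<and> w v' < v')"
    and contr: "orb c u0 v0" "u0 < w u0" "w v0 < v0"
  shows "descending H"
proof -
  note hc = hom[OF c] and hw = hom[OF w] and plc = pl[OF c]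
  define cw where "cw = w \<circ> c \<circ> inv w"
  have cwH: "cw \<in> H" unfolding cw_def by (rule conj_mem[OF w c])
  have moved_cw: "moved cw = w ` moved c" unfolding cw_def by (rule moved_conj[OF bijH[OF w]])
  define S where "S = moved cw \<inter> moved c"
  \<comment> \<open>\<open>N\<close> collects the orbitals that \<open>w\<close> contracts into
    themselves, and \<open>R\<close> below those that \<open>w\<close> sends into one of
    \<open>N\<close>; \<open>S\<close> is the union of the open \<open>w\<close>-images of the
    members of \<open>R\<close>.\<close>
  define N where "N = {(u, v). orb c u v \<and> u < w u \<and> w v < v}"
  have finN: "finite N"
    by (rule finite_subset[of _ "fr c \<times> fr c"]) (use orb_fr finite_fr[OF plc] in \<open>auto simp: N_def\<close>)
  define R where "R = {(u, v). orb c u v \<and> (\<exists>(u', v') \<in> N. u' < w u \<and> w v < v')}"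
  have finR: "finite R"
    by (rule finite_subset[of _ "fr c \<times> fr c"]) (use orb_fr finite_fr[OF plc] in \<open>auto simp: R_def\<close>)
  have S_R: "\<exists>(u, v) \<in> R. w u < z \<and> z < w v" if "z \<in> S" for z
  proof -
    have "z \<in> w ` moved c" using that moved_cw unfolding S_def by blast
    then obtain t where t: "c t \<noteq> t" "z = w t" by (auto simp: moved_def)
    obtain u v where uv: "orb c u v" "u < t" "t < v" using ex_orb[OF plc t(1)] by blast
    have z: "w u < z" "z < w v" using uv t hw by (simp_all add: homeo_less_iff)
    have "c z \<noteq> z" using that by (simp add: S_def moved_def)
    then have "(u, v) \<in> R" using split[OF uv(1)] z uv(1) by (auto simp: R_def N_def)
    then show ?thesis using z by blast
  qed
  have R_S: "w u < z \<Longrightarrow> z < w v \<Longrightarrow> z \<in> S" if "(u, v) \<in> R" for u v z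
  proof -
    assume z: "w u < z" "z < w v"
    have o: "orb c u v" using that by (simp add: R_def)
    obtain u' v' where o': "orb c u' v'" "u' < w u" "w v < v'"
      using \<open>(u, v) \<in> R\<close> by (auto simp: R_def N_def)
    have "z \<in> moved c" using o' z by (auto simp: orb_def moved_def)
    moreover have "z \<in> moved cw"
      using orb_conj[OF hw o] z by (auto simp: orb_def moved_def cw_def)
    ultimately show ?thesis by (simp add: S_def)
  qed
  have N_R: "N \<subseteq> R" by (auto simp: R_def N_def)
  \<comment> \<open>Taking closed images gives a compact set, still inside the support of
    \<open>c\<close>, so a power \<open>k\<close> of \<open>c\<close> displaces it and hence
    \<open>S\<close>.\<close>
  define K where "K = (\<Union>(u, v)\<in>R. {w u .. w v})"
  have K: "compact K" "K \<subseteq> moved c"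
  proof -
    show "compact K" unfolding K_def using finR by (intro compact_UN) auto
    show "K \<subseteq> moved c" by (force simp: K_def R_def N_def orb_def moved_def)
  qed
  have S_K: "S \<subseteq> K" using S_R by (force simp: K_def)
  obtain M where M: "\<And>z. z \<in> K \<Longrightarrow> zpow c (int M) z \<notin> K"
    using eventually_happens[OF compact_wanders[OF plc K]] by auto
  define k where "k = zpow c (int M)"
  have kH: "k \<in> H" unfolding k_def by (rule zpow_mem[OF c])
  have mvk: "moved k \<subseteq> moved c" unfolding k_def by (rule moved_zpow[OF bijH[OF c]])
  have kV: "k ` moved c = moved c"
  proof -
    have *: "k z \<in> moved c \<longleftrightarrow> z \<in> moved c" for z by (rule moved_subset_mem_iff[OF bijH[OF kH] mvk])
    show ?thesis
    proof (intro equalityI subsetI)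
      fix z assume "z \<in> moved c"
      then have "inv k z \<in> moved c" using *[of "inv k z"] hom[OF kH] by simp
      then show "z \<in> k ` moved c" using hom[OF kH] by (metis homeo_inv2 image_eqI)
    qed (use * in auto)
  qed
  have cwS: "cw ` S = S"
  proof -
    have *: "cw z \<in> S \<longleftrightarrow> z \<in> S" for z
    proof -
      have "w u < cw z \<longleftrightarrow> w u < z" "cw z < w v \<longleftrightarrow> z < w v" if "orb c u v" for u v
        using orb_zpow_less[OF hom[OF cwH] orb_conj[OF hw that, folded cw_def], of 1] by simp_all
      then have "(\<exists>(u, v) \<in> R. w u < cw z \<and> cw z < w v) \<longleftrightarrow> (\<exists>(u, v) \<in> R. w u < z \<and> z < w v)"
        by (force simp: R_def)
      then show ?thesis using S_R R_S by blast
    qed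
    show ?thesis
    proof (intro equalityI subsetI)
      fix z assume "z \<in> S"
      then have "inv cw z \<in> S" using *[of "inv cw z"] hom[OF cwH] by simp
      then show "z \<in> cw ` S" using hom[OF cwH] by (metis homeo_inv2 image_eqI)
    qed (use * in auto)
  qed
  have kS: "k ` S \<inter> S = {}" using M S_K by (auto simp: k_def)
  define h where "h = comm cw k"
  have hH: "h \<in> H" unfolding h_def by (rule comm_mem[OF cwH kH])
  have h_S: "h z = cw z" if "z \<in> S" for z
    unfolding h_def by (rule comm_localised(1)[OF bijH[OF cwH] bijH[OF kH] mvk kV S_def cwS kS that])
  have moved_h: "moved h \<subseteq> S \<union> k ` S"
    unfolding h_def by (rule comm_localised(2)[OF bijH[OF cwH] bijH[OF kH] mvk kV S_def cwS kS])
  have S_h: "S \<subseteq> moved h" using h_S by (auto simp: moved_def S_def)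
  have moved_h_N: "\<exists>(u, v) \<in> N. u < z \<and> z < v" if "z \<in> moved h" for z
  proof -
    have *: "\<exists>(u, v) \<in> N. u < z \<and> z < v" if z: "z \<in> S" for z
    proof -
      obtain u v where uv: "(u, v) \<in> R" "w u < z" "z < w v" using S_R[OF z] by blast
      obtain u' v' where "(u', v') \<in> N" "u' < w u" "w v < v'" using uv(1) by (auto simp: R_def)
      then show ?thesis using uv by (intro bexI[of _ "(u', v')"]) auto
    qed
    from that moved_h consider "z \<in> S" | s where "s \<in> S" "z = k s" by blast
    then show ?thesis
    proof cases
      case 2
      obtain u v where uv: "(u, v) \<in> N" "u < s" "s < v" using *[OF 2(1)] by blast
      then have "u < z" "z < v" using orb_zpow_less[OF hc, of u v] 2 by (auto simp: N_def k_def)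
      then show ?thesis using uv by blast
    qed (rule *)
  qed
  \<comment> \<open>One application of \<open>w\<close> sends the closure of an orbital in
    \<open>N\<close> to an interval whose ends may lie outside \<open>S\<close>; a second one brings
    the closed interval into the open image, and so into \<open>S\<close>.\<close>
  define w2 where "w2 = w \<circ> w"
  have w2H: "w2 \<in> H" unfolding w2_def by (rule comp_mem[OF w w])
  define L where "L = (\<Union>(u, v)\<in>N. {w2 u .. w2 v})"
  have "compact L" unfolding L_def using finN by (intro compact_UN) auto
  then have clL: "closed L" by (rule compact_imp_closed)
  have "w2 ` moved h \<subseteq> L"
  proof
    fix z assume "z \<in> w2 ` moved h"
    then obtain t where t: "t \<in> moved h" "z = w2 t" by blast
    obtain u v where uv: "(u, v) \<in> N" "u < t" "t < v" using moved_h_N[OF t(1)] by blast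
    then have "z \<in> {w2 u .. w2 v}" using t(2) homeo_less_iff[OF hom[OF w2H]] by (simp add: less_imp_le)
    then show "z \<in> L" unfolding L_def using uv(1) by blast
  qed
  moreover have "L \<subseteq> S"
  proof
    fix z assume "z \<in> L"
    then obtain u v where uv: "(u, v) \<in> N" "w2 u \<le> z" "z \<le> w2 v" unfolding L_def by auto
    then have "w u < w2 u" "w2 v < w v" using homeo_less_iff[OF hw] by (auto simp: N_def w2_def)
    then show "z \<in> S" using R_S[of u v z] N_R uv by force
  qed
  ultimately have step: "closure (w2 ` moved h) \<subseteq> moved h"
    using closure_minimal[OF _ clL] S_h by blast
  have "u0 < v0" "(u0, v0) \<in> N" using contr by (auto simp: N_def orb_def)
  moreover obtain z where "w u0 < z" "z < w v0" using dense homeo_less_iff[OF hw, of u0 v0] \<open>u0 < v0\<close> by blast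
  ultimately have "z \<in> moved h" using R_S N_R S_h by blast
  then have h_ne: "moved h \<noteq> {}" by blast
  define f where "f n = w2 ^^ n \<circ> h \<circ> inv (w2 ^^ n)" for n
  have wn: "w2 ^^ n \<in> H" for n by (rule funpow_mem[OF w2H])
  have mvf: "moved (f n) = (w2 ^^ n) ` moved h" for n
    unfolding f_def by (rule moved_conj[OF bijH[OF wn]])
  have "f n \<in> H" for n unfolding f_def by (rule conj_mem[OF wn hH])
  moreover have "f n \<noteq> id" for n
    using mvf[of n] h_ne by (auto simp: moved_def)
  moreover have "closure (moved (f (Suc n))) \<subseteq> moved (f n)" for n
  proof -
    have "moved (f (Suc n)) = (w2 ^^ n) ` (w2 ` moved h)"
      unfolding mvf funpow_Suc_right by (simp add: image_comp)
    then have "closure (moved (f (Suc n))) \<subseteq> (w2 ^^ n) ` closure (w2 ` moved h)"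
      using closure_image_homeo[OF hom[OF wn]] by metis
    also have "\<dots> \<subseteq> moved (f n)" unfolding mvf by (rule image_mono[OF step])
    finally show ?thesis .
  qed
  ultimately show ?thesis unfolding descending_def by blast
qed

text \<open>A contracting word \<open>w\<close> as required by \<open>contraction_descending\<close>
  is assembled in three stages: free all relevant intervals from the frontier points, push the
  orbital of \<open>c\<close> around \<open>b\<close> towards \<open>l\<close>, then use powers of
  \<open>x\<close> to bring it up just below \<open>b\<close>.\<close>

lemma (in pl_group) unbalanced_descending:
  assumes xH: "x \<in> H" and yH: "y \<in> H" and o: "orb x l b" and yl: "y l = l" and yb: "y b \<noteq> b"
  shows "descending H"
proof -
  note hx = hom[OF xH] and hy = hom[OF yH]
  obtain z where z: "z \<in> words x y" "comm x y (z b) \<noteq> z b"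
    using ex_word_moved_by_comm[OF pl[OF xH] pl[OF yH] o yl yb] by blast
  have zH: "z \<in> H" by (rule words_mem[OF xH yH z(1)])
  note hz = hom[OF zH]
  define c where "c = inv z \<circ> comm x y \<circ> z"
  have cH: "c \<in> H" unfolding c_def by (intro comp_mem inv_mem comm_mem xH yH zH)
  note plc = pl[OF cH]
  have cb: "c b \<noteq> b" using z(2) hz by (metis c_def comp_apply homeo_inv2)
  \<comment> \<open>The commutator is trivial near common fixed points of \<open>x\<close> and
    \<open>y\<close>, and \<open>z\<close> fixes these. Hence each closed orbital of
    \<open>c\<close> lies within the joint support, where words can move it freely.\<close>
  have c_germ: "\<forall>\<^sub>F t in F. c t = t" if e: "x e = e" "y e = e" and F: "germ e F" for e F
  proof -
    have ze: "z e = e" by (rule words_fixed[OF hx hy e z(1)])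
    have "\<forall>\<^sub>F t in F. comm x y (z t) = z t"
      by (rule eventually_compose_filterlim[OF comm_trivial_germ[OF pl[OF xH] e(1) pl[OF yH] e(2) F] germ_filterlim[OF F hz ze]])
    then show ?thesis by eventually_elim (simp add: c_def hz)
  qed
  have c_fix: "c t = t" if t: "x t = t" "y t = t" for t
  proof -
    have "inv x t = t" "inv y t = t" using homeo_inv1[OF hx, of t] homeo_inv1[OF hy, of t] t by simp_all
    then show ?thesis
      using words_fixed[OF hx hy t z(1)] homeo_inv1[OF hz, of t] t by (simp add: c_def comm_def)
  qed
  have c_orb_moved: "x t \<noteq> t \<or> y t \<noteq> t" if uv: "orb c u v" "u \<le> t" "t \<le> v" for u v t
  proof (rule ccontr)
    assume "\<not> ?thesis"
    then have t: "x t = t" "y t = t" by auto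
    then have "t = u \<or> t = v" using c_fix[OF t] uv by (force simp: orb_def)
    moreover have "\<forall>\<^sub>F s in at t. c s = s" using c_germ[OF t] by (simp add: at_germs)
    ultimately show False using orb_fr[OF uv(1)] by (auto simp: fr_def)
  qed
  define P where "P = fr x \<union> fr y \<union> fr c"
  interpret pl_pair x y P
    by unfold_locales (use xH yH pl finite_fr cH in \<open>auto simp: P_def\<close>)
  have bP: "b \<in> P" using orb_fr(2)[OF o] by (simp add: P_def)
  define \<K> where "\<K> = {(s, t) \<in> fr c \<times> fr c. s \<le> t \<and> (\<forall>z. s \<le> z \<and> z \<le> t \<longrightarrow> x z \<noteq> z \<or> y z \<noteq> z)}"
  have fin\<K>: "finite \<K>"
    by (rule finite_subset[of _ "fr c \<times> fr c"]) (use finite_fr[OF plc] in \<open>auto simp: \<K>_def\<close>)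
  obtain f where f: "f \<in> words x y" "free f \<K>" using merge[OF fin\<K>] by (auto simp: \<K>_def)
  obtain u0 v0 where uv0: "orb c u0 v0" "u0 < b" "b < v0" using ex_orb[OF plc cb] by blast
  obtain l' r where lr: "joint_orb x y l' r" "l' < b" "b < r" using ex_joint_orb[OF pl[OF xH] pl[OF yH]] yb by blast
  have lb: "l < b" "x l = l" using o by (auto simp: orb_def)
  have "l' = l"
  proof (rule ccontr)
    assume "l' \<noteq> l"
    then consider "l' < l" | "l < l'" by linarith
    then show False
    proof cases
      case 1
      then show False using lr lb yl by (auto simp: joint_orb_def)
    next
      case 2
      then show False using o lr by (auto simp: orb_def joint_orb_def)
    qed
  qed
  note lr = lr[unfolded this]
  have u0v0: "l < u0" "v0 < r"
    using joint_orb_bounds[OF lr(1) c_orb_moved[OF uv0(1)], of u0 v0 b] uv0 lr by auto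
  have f\<K>: "s \<le> t" if "(s, t) \<in> map_prod f f ` \<K>" for s t
    using that homeo_le_iff[OF words_homeo[OF f(1)]] by (auto simp: \<K>_def)
  have "free id (map_prod f f ` \<K>)" unfolding free_comp id_comp by (rule f(2))
  moreover have "l < f v0" "f v0 < r" using joint_orb_words[OF lr(1) f(1)] uv0 lr u0v0 by auto
  ultimately obtain g where g: "g \<in> words x y" "free g (map_prod f f ` \<K>)" "P \<inter> {l<..g (f v0)} = {}"
    using push_left[OF lr(1), of "f v0" "map_prod f f ` \<K>"] f\<K> fin\<K> by blast
  define q where "q = g \<circ> f"
  have qw: "q \<in> words x y" unfolding q_def by (rule words_comp[OF g(1) f(1)])
  have q_free: "free q \<K>" using g(2) unfolding free_comp q_def .
  have q0: "l < q u0" "q v0 < b" "q u0 \<le> q v0"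
  proof -
    show "l < q u0" using joint_orb_words(1)[OF lr(1) qw] u0v0 by simp
    show "q u0 \<le> q v0" using homeo_le_iff[OF words_homeo[OF qw]] uv0 by simp
    show "q v0 < b" using g(3) bP lb(1) by (auto simp: q_def not_le[symmetric])
  qed
  \<comment> \<open>In the last gap of \<open>P\<close> before \<open>b\<close> there is no end of
    an orbital of \<open>c\<close>; as \<open>u0\<close> lies in \<open>P\<close>, the gap is
    contained in the orbital from \<open>u0\<close> to \<open>v0\<close>.\<close>
  obtain \<beta> where \<beta>: "l < \<beta>" "\<beta> < b" "P \<inter> {\<beta><..<b} = {}" using gap_left[OF P(1) lb(1)] by blast
  obtain d :: int where d: "d = 1 \<or> d = -1"
    and up: "\<forall>\<alpha> \<beta>. l < \<alpha> \<longrightarrow> \<alpha> < b \<longrightarrow> \<beta> < b \<longrightarrow> (\<forall>\<^sub>F n in sequentially. \<beta> < zpow x (d * int n) \<alpha>)"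
    using orb_escape[OF hx o] by blast
  have ev: "\<forall>\<^sub>F n in sequentially. \<beta> < zpow x (d * int n) (q u0)"
    by (rule up[rule_format]) (use q0 \<beta> in auto)
  have q\<K>: "s \<le> t" if "(s, t) \<in> map_prod q q ` \<K>" for s t
    using that homeo_le_iff[OF words_homeo[OF qw]] by (auto simp: \<K>_def)
  have "free id (map_prod q q ` \<K>)" unfolding free_comp id_comp by (rule q_free)
  then have "\<forall>\<^sub>F n in sequentially. free (zpow x (d * int n)) (map_prod q q ` \<K>)"
    using q\<K> fin\<K> d by (intro free_zpow) auto
  from eventually_happens[OF eventually_conj[OF this ev]]
  obtain n where n: "free (zpow x (d * int n)) (map_prod q q ` \<K>)" "\<beta> < zpow x (d * int n) (q u0)" by auto
  define w where "w = zpow x (d * int n) \<circ> q"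
  have ww: "w \<in> words x y" unfolding w_def by (intro words_comp words_zpow qw) simp
  have wH: "w \<in> H" by (rule words_mem[OF xH yH ww])
  have w_free: "free w \<K>" using n(1) unfolding free_comp w_def .
  have w0: "\<beta> < w u0" "w v0 < b" using n(2) orb_zpow_less(2)[OF hx o] q0 by (simp_all add: w_def)
  have contr: "u0 < w u0" "w v0 < v0"
  proof -
    have "u0 \<in> P" using orb_fr[OF uv0(1)] by (simp add: P_def)
    then have "u0 \<le> \<beta>" using \<beta>(3) uv0 by auto
    then show "u0 < w u0" using w0 by simp
    show "w v0 < v0" using w0 uv0 by simp
  qed
  have free_cases: "(\<forall>z. w s \<le> z \<and> z \<le> w t \<longrightarrow> c z = z) \<or> (\<exists>u' v'. orb c u' v' \<and> u' < w s \<and> w t < v')"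
    if "(s, t) \<in> \<K>" for s t
  proof -
    have "{w s .. w t} \<inter> P = {}" using w_free that unfolding free_def by blast
    then have "{w s .. w t} \<inter> fr c = {}" unfolding P_def by blast
    then show ?thesis by (rule no_fr_cases[OF plc]) blast+
  qed
  have orb_\<K>: "(u, v) \<in> \<K>" if "orb c u v" for u v
    using orb_fr[OF that] c_orb_moved[OF that] that by (auto simp: \<K>_def orb_def)
  have split: "(\<forall>z. w u \<le> z \<and> z \<le> w v \<longrightarrow> c z = z) \<or>
      (\<exists>u' v'. orb c u' v' \<and> u' < w u \<and> w v < v' \<and> u' < w u' \<and> w v' < v')" if uv: "orb c u v" for u v
  proof -
    from free_cases[OF orb_\<K>[OF uv]] show ?thesis
    proof
      assume "\<exists>u' v'. orb c u' v' \<and> u' < w u \<and> w v < v'"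
      then obtain u' v' where uv': "orb c u' v'" "u' < w u" "w v < v'" by blast
      have le: "u < v" "w u < w v" "u' < v'" using uv uv' homeo_less_iff[OF hom[OF wH]] by (auto simp: orb_def)
      \<comment> \<open>The hull of the orbital and of the one that receives its image. Its own
        image is free of \<open>P\<close> and meets the receiving orbital, so it lies inside that
        orbital, which shows that \<open>w\<close> contracts the receiving orbital too.\<close>
      define s t where "s = min u u'" and "t = max v v'"
      have "x (w u) \<noteq> w u \<or> y (w u) \<noteq> w u" by (rule c_orb_moved[OF uv'(1)]) (use uv' le in auto)
      then obtain l1 r1 where h1: "joint_orb x y l1 r1" "l1 < w u" "w u < r1"
        using ex_joint_orb[OF pl[OF xH] pl[OF yH]] by blast
      have b': "l1 < u'" "v' < r1"
        using joint_orb_bounds[OF h1(1) c_orb_moved[OF uv'(1)], of u' v' "w u"] uv' le h1 by auto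
      have "l1 < u" "v < r1" using joint_orb_words[OF h1(1) ww, of u] joint_orb_words[OF h1(1) ww, of v] h1 b' uv' by auto
      then have "x z \<noteq> z \<or> y z \<noteq> z" if "s \<le> z" "z \<le> t" for z
      proof -
        have "l1 < z" "z < r1" using that b' \<open>l1 < u\<close> \<open>v < r1\<close> by (simp_all add: s_def t_def min_le_iff_disj le_max_iff_disj) linarith+
        then show ?thesis using h1(1) by (simp add: joint_orb_def)
      qed
      moreover have "s \<in> fr c" "t \<in> fr c" using orb_fr[OF uv] orb_fr[OF uv'(1)] by (auto simp: s_def t_def min_def max_def)
      moreover have "s \<le> t" using le by (auto simp: s_def t_def)
      ultimately have st: "(s, t) \<in> \<K>" by (simp add: \<K>_def)
      have wst: "w s \<le> w u" "w v \<le> w t" "w s \<le> w u'" "w v' \<le> w t"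
        by (simp_all add: s_def t_def homeo_le_iff[OF hom[OF wH]])
      have "c (w u) \<noteq> w u" using uv' le by (auto simp: orb_def)
      then obtain u2 v2 where uv2: "orb c u2 v2" "u2 < w s" "w t < v2"
        using free_cases[OF st] wst le by (meson less_imp_le order_trans)
      then have "u2 = u' \<and> v2 = v'"
        using orb_unique[OF uv2(1) uv'(1), of "w u"] uv' wst le by linarith
      then show ?thesis using uv2 uv' wst by (intro disjI2 exI[of _ u'] exI[of _ v']) auto
    qed blast
  qed
  show ?thesis by (rule contraction_descending[OF cH wH split uv0(1) contr])
qed

section \<open>Balanced groups\<close>

text \<open>Conjugation by the reflection of the unit interval, which exchanges left and right
  ends.\<close>

definition mirror :: "(real \<Rightarrow> real) \<Rightarrow> real \<Rightarrow> real" where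
  "mirror f = (\<lambda>x. 1 - f (1 - x))"

lemma mirror_mirror [simp]: "mirror (mirror f) = f"
  by (simp add: mirror_def)

lemma homeo_mirror: "homeo f \<Longrightarrow> homeo (mirror f)"
proof -
  assume f: "homeo f"
  have "y = mirror f (1 - inv f (1 - y))" for y using f by (simp add: mirror_def)
  then have "surj (mirror f)" by (rule surjI[OF sym])
  then show ?thesis
    using homeo_less_iff[OF f] by (simp add: homeo_def strict_mono_def mirror_def)
qed

lemma mirror_comp: "mirror f \<circ> mirror g = mirror (f \<circ> g)"
  by (simp add: mirror_def fun_eq_iff)

lemma mirror_id: "mirror id = id"
  by (simp add: mirror_def fun_eq_iff)

lemma mirror_inv:
  assumes "homeo f" shows "inv (mirror f) = mirror (inv f)"
proof (rule inv_unique_comp)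
  have "f \<circ> inv f = id" "inv f \<circ> f = id" using assms by (auto simp: fun_eq_iff)
  then show "mirror f \<circ> mirror (inv f) = id" "mirror (inv f) \<circ> mirror f = id"
    by (simp_all only: mirror_comp mirror_id)
qed

lemma eventually_at_left_mirror:
  "(\<forall>\<^sub>F x in at_left (1 - e). P x) \<longleftrightarrow> (\<forall>\<^sub>F x in at_right e. P (1 - x))" for e :: real
proof
  assume "\<forall>\<^sub>F x in at_left (1 - e). P x"
  then obtain b where "b < 1 - e" "\<And>y. b < y \<Longrightarrow> y < 1 - e \<Longrightarrow> P y" by (auto simp: eventually_at_left_field)
  then show "\<forall>\<^sub>F x in at_right e. P (1 - x)"
    unfolding eventually_at_right_field by (intro exI[of _ "1 - b"]) auto
next
  assume "\<forall>\<^sub>F x in at_right e. P (1 - x)"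
  then obtain b where b: "b > e" "\<And>y. e < y \<Longrightarrow> y < b \<Longrightarrow> P (1 - y)" by (auto simp: eventually_at_right_field)
  then show "\<forall>\<^sub>F x in at_left (1 - e). P x"
    unfolding eventually_at_left_field by (intro exI[of _ "1 - b"]) (use b(2)[of "1 - _"] in auto)
qed

lemma eventually_at_right_mirror:
  "(\<forall>\<^sub>F x in at_right (1 - e). P x) \<longleftrightarrow> (\<forall>\<^sub>F x in at_left e. P (1 - x))" for e :: real
  using eventually_at_left_mirror[of "\<lambda>x. P (1 - x)" "1 - e"] by simp

lemma pl_homeo_mirror:
  assumes "pl_homeo f" shows "pl_homeo (mirror f)"
  unfolding pl_homeo_def
proof (intro conjI allI impI)
  show "homeo (mirror f)" using assms by (intro homeo_mirror pl_homeo_homeo)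
  show "mirror f x = x" if "x \<le> 0 \<or> 1 \<le> x" for x
  proof -
    have "1 - x \<le> 0 \<or> 1 \<le> 1 - x" using that by auto
    then have "f (1 - x) = 1 - x" using assms unfolding pl_homeo_def by blast
    then show ?thesis by (simp add: mirror_def)
  qed
  fix e F assume "germ e F"
  then consider "F = at_right e" | "F = at_left e" by (auto simp: germ_def)
  then show "\<exists>a. \<forall>\<^sub>F x in F. mirror f x = mirror f e + a * (x - e)"
  proof cases
    case 1
    obtain a where "\<forall>\<^sub>F x in at_left (1 - e). f x = f (1 - e) + a * (x - (1 - e))"
      using assms unfolding pl_homeo_def germ_def by blast
    then have "\<forall>\<^sub>F x in at_right e. mirror f x = mirror f e + a * (x - e)"
      unfolding eventually_at_left_mirror by eventually_elim (simp add: mirror_def algebra_simps)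
    then show ?thesis using 1 by blast
  next
    case 2
    obtain a where "\<forall>\<^sub>F x in at_right (1 - e). f x = f (1 - e) + a * (x - (1 - e))"
      using assms unfolding pl_homeo_def germ_def by blast
    then have "\<forall>\<^sub>F x in at_left e. mirror f x = mirror f e + a * (x - e)"
      unfolding eventually_at_right_mirror by eventually_elim (simp add: mirror_def algebra_simps)
    then show ?thesis using 2 by blast
  qed
qed

lemma moved_mirror: "moved (mirror f) = (\<lambda>x. 1 - x) ` moved f"
proof (intro equalityI subsetI)
  fix x assume "x \<in> moved (mirror f)"
  then have "1 - x \<in> moved f" by (auto simp: moved_def mirror_def)
  then show "x \<in> (\<lambda>x. 1 - x) ` moved f" by (intro image_eqI[of _ _ "1 - x"]) auto
qed (auto simp: moved_def mirror_def)

lemma orb_mirror: "orb f u v \<Longrightarrow> orb (mirror f) (1 - v) (1 - u)"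
  unfolding orb_def mirror_def
proof (intro conjI allI impI; (elim conjE)?)
  fix x assume f: "\<forall>x. u < x \<and> x < v \<longrightarrow> f x \<noteq> x" "1 - v < x" "x < 1 - u"
  then have "f (1 - x) \<noteq> 1 - x" by simp
  then show "1 - f (1 - x) \<noteq> x" by linarith
qed simp_all

lemma descending_mirror:
  assumes "descending (mirror ` H)" shows "descending H"
proof -
  obtain f where f: "\<And>n. f n \<in> mirror ` H" "\<And>n. f n \<noteq> id"
    "\<And>n. closure (moved (f (Suc n))) \<subseteq> moved (f n)"
    using assms unfolding descending_def by blast
  have "mirror (f n) \<in> H" for n using f(1)[of n] by auto
  moreover have "mirror (f n) \<noteq> id" for n using f(2)[of n] mirror_mirror mirror_id by metis
  moreover have "closure (moved (mirror (f (Suc n)))) \<subseteq> moved (mirror (f n))" for n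
  proof -
    have "closure ((\<lambda>x. 1 - x) ` moved (f (Suc n))) \<subseteq> (\<lambda>x. 1 - x) ` closure (moved (f (Suc n)))"
    proof (rule closure_minimal)
      have "(\<lambda>x. 1 - x) ` A = (\<lambda>x. 1 - x) -` A" for A :: "real set" by force
      then show "closed ((\<lambda>x. 1 - x) ` closure (moved (f (Suc n))))"
        by (simp add: continuous_closed_vimage)
    qed (simp add: closure_subset image_mono)
    then show ?thesis unfolding moved_mirror using f(3)[of n] by blast
  qed
  ultimately show ?thesis unfolding descending_def by (intro exI[of _ "\<lambda>n. mirror (f n)"]) blast
qed

lemma (in pl_group) pl_group_mirror: "pl_group (mirror ` H)"
proof
  show "pl_homeo f" if "f \<in> mirror ` H" for f using that pl pl_homeo_mirror by blast
  show "id \<in> mirror ` H" using id_mem mirror_id by (metis image_eqI)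
  show "f \<circ> g \<in> mirror ` H" if "f \<in> mirror ` H" "g \<in> mirror ` H" for f g
    using that comp_mem mirror_comp by (metis (no_types, lifting) image_iff)
  show "inv f \<in> mirror ` H" if "f \<in> mirror ` H" for f
    using that inv_mem mirror_inv hom by (metis (no_types, lifting) image_iff)
qed

lemma (in pl_group) unbalanced_descending_mirror:
  assumes "x \<in> H" "y \<in> H" "orb x b r" "y r = r" "y b \<noteq> b"
  shows "descending H"
proof (rule descending_mirror)
  interpret M: pl_group "mirror ` H" by (rule pl_group_mirror)
  show "descending (mirror ` H)"
    by (rule M.unbalanced_descending[of "mirror x" "mirror y" "1 - r" "1 - b"])
      (use assms orb_mirror in \<open>auto simp: mirror_def\<close>)
qed

lemma joint_orb_sym: "joint_orb x y l r \<longleftrightarrow> joint_orb y x l r"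
  by (auto simp: joint_orb_def)

lemma germ_orb:
  assumes f: "pl_homeo f" and F: "germ e F" and m: "\<forall>\<^sub>F t in F. f t \<noteq> t"
  obtains u v where "orb f u v" "\<forall>\<^sub>F t in F. u < t \<and> t < v" "u \<le> e" "e \<le> v"
proof -
  from F consider "F = at_right e" | "F = at_left e" by (auto simp: germ_def)
  then show ?thesis
  proof cases
    case 1
    then obtain d where d: "e < d" "\<And>t. e < t \<Longrightarrow> t < d \<Longrightarrow> f t \<noteq> t"
      using m by (auto simp: eventually_at_right_field)
    obtain t where t: "e < t" "t < d" using dense d(1) by blast
    obtain u v where uv: "orb f u v" "u < t" "t < v" using ex_orb[OF f d(2)[OF t]] by blast
    have "f u = u" using uv by (simp add: orb_def)
    then have "u \<le> e" using d(2)[of u] uv t by force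
    moreover have "\<forall>\<^sub>F s in F. u < s \<and> s < v"
      unfolding 1 eventually_at_right_field using t uv \<open>u \<le> e\<close> by (intro exI[of _ t]) auto
    ultimately show ?thesis using that uv t by force
  next
    case 2
    then obtain d where d: "d < e" "\<And>t. d < t \<Longrightarrow> t < e \<Longrightarrow> f t \<noteq> t"
      using m by (auto simp: eventually_at_left_field)
    obtain t where t: "d < t" "t < e" using dense d(1) by blast
    obtain u v where uv: "orb f u v" "u < t" "t < v" using ex_orb[OF f d(2)[OF t]] by blast
    have "f v = v" using uv by (simp add: orb_def)
    then have "e \<le> v" using d(2)[of v] uv t by force
    moreover have "\<forall>\<^sub>F s in F. u < s \<and> s < v"
      unfolding 2 eventually_at_left_field using t uv \<open>e \<le> v\<close> by (intro exI[of _ t]) auto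
    ultimately show ?thesis using that uv t by force
  qed
qed

lemma germ_orb_unique:
  assumes "germ e F" "orb f u v" "\<forall>\<^sub>F t in F. u < t \<and> t < v" "orb f u' v'" "\<forall>\<^sub>F t in F. u' < t \<and> t < v'"
  shows "u = u' \<and> v = v'"
proof -
  obtain t where "u < t \<and> t < v" "u' < t \<and> t < v'"
    using eventually_happens[OF eventually_conj[OF assms(3,5)]] germ_not_bot[OF assms(1)] by blast
  then show ?thesis using orb_unique[OF assms(2,4)] by blast
qed

text \<open>A right germ is pushed to the left end of the orbital and a left germ to the right end.
  With this choice, one point \<open>t1\<close> pushed far enough forces all points between
  \<open>e\<close> and \<open>t1\<close> into the region where \<open>c\<close> is trivial, even if
  \<open>e\<close> is itself an end of the orbital.\<close>

lemma push_germ: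
  assumes g: "homeo g" "orb g u v" and F: "germ e F" "\<forall>\<^sub>F t in F. u < t \<and> t < v"
    and c: "\<forall>\<^sub>F t in at_right u. c t = t" "\<forall>\<^sub>F t in at_left v. c t = t"
  shows "\<exists>M. \<forall>\<^sub>F t in F. c (zpow g M t) = zpow g M t"
proof -
  obtain s :: int where
    up: "\<forall>\<alpha> \<beta>. u < \<alpha> \<longrightarrow> \<alpha> < v \<longrightarrow> \<beta> < v \<longrightarrow> (\<forall>\<^sub>F n in sequentially. \<beta> < zpow g (s * int n) \<alpha>)" and
    down: "\<forall>\<alpha> \<beta>. u < \<alpha> \<longrightarrow> \<alpha> < v \<longrightarrow> u < \<beta> \<longrightarrow> (\<forall>\<^sub>F n in sequentially. zpow g (- (s * int n)) \<alpha> < \<beta>)"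
    using orb_escape[OF g] by blast
  obtain d where d: "u < d" "\<And>t. u < t \<Longrightarrow> t < d \<Longrightarrow> c t = t" using c(1) by (auto simp: eventually_at_right_field)
  obtain d' where d': "d' < v" "\<And>t. d' < t \<Longrightarrow> t < v \<Longrightarrow> c t = t" using c(2) by (auto simp: eventually_at_left_field)
  from F(1) consider "F = at_right e" | "F = at_left e" by (auto simp: germ_def)
  then show ?thesis
  proof cases
    case 1
    obtain b where b: "e < b" "\<And>t. e < t \<Longrightarrow> t < b \<Longrightarrow> u < t \<and> t < v"
      using F(2) unfolding 1 eventually_at_right_field by blast
    obtain t1 where t1: "e < t1" "t1 < b" using dense b(1) by blast
    have "\<forall>\<^sub>F n in sequentially. zpow g (- (s * int n)) t1 < d"
      by (rule down[rule_format]) (use b t1 d in auto)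
    then obtain n where n: "zpow g (- (s * int n)) t1 < d" using eventually_happens by force
    have "c (zpow g (- (s * int n)) t) = zpow g (- (s * int n)) t" if "e < t" "t < t1" for t
    proof (rule d(2))
      show "u < zpow g (- (s * int n)) t" using orb_zpow_less[OF g] b(2)[of t] that t1 by simp
      show "zpow g (- (s * int n)) t < d"
        using n homeo_less_iff[OF homeo_zpow[OF g(1)]] that by (meson less_trans)
    qed
    then have "\<forall>\<^sub>F t in F. c (zpow g (- (s * int n)) t) = zpow g (- (s * int n)) t"
      unfolding 1 eventually_at_right_field using t1 by blast
    then show ?thesis by (rule exI)
  next
    case 2
    obtain b where b: "b < e" "\<And>t. b < t \<Longrightarrow> t < e \<Longrightarrow> u < t \<and> t < v"
      using F(2) unfolding 2 eventually_at_left_field by blast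
    obtain t1 where t1: "b < t1" "t1 < e" using dense b(1) by blast
    have "\<forall>\<^sub>F n in sequentially. d' < zpow g (s * int n) t1"
      by (rule up[rule_format]) (use b t1 d' in auto)
    then obtain n where n: "d' < zpow g (s * int n) t1" using eventually_happens by force
    have "c (zpow g (s * int n) t) = zpow g (s * int n) t" if "t1 < t" "t < e" for t
    proof (rule d'(2))
      show "zpow g (s * int n) t < v" using orb_zpow_less[OF g] b(2)[of t] that t1 by simp
      show "d' < zpow g (s * int n) t"
        using n homeo_less_iff[OF homeo_zpow[OF g(1)]] that by (meson less_trans)
    qed
    then have "\<forall>\<^sub>F t in F. c (zpow g (s * int n) t) = zpow g (s * int n) t"
      unfolding 2 eventually_at_left_field using t1 by blast
    then show ?thesis by (rule exI)
  qed
qed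

lemma germ_trivial_fixed:
  assumes "homeo g" "germ e F" "\<forall>\<^sub>F t in F. g t = t"
  shows "g e = e"
proof -
  have "filterlim g (nhds (g e)) F"
    using homeo_isCont[OF assms(1), of e] germ_le_at[OF assms(2)] unfolding isCont_def by (rule tendsto_mono[rotated])
  moreover have "filterlim g (nhds e) F"
    using tendsto_mono[OF germ_le_at[OF assms(2)] tendsto_ident_at] tendsto_cong[OF assms(3), of e] by simp
  ultimately show ?thesis using tendsto_unique[OF germ_not_bot[OF assms(2)]] by blast
qed

section \<open>Nesting of orbitals in a balanced group\<close>

locale balanced_group = pl_group +
  assumes balanced: "x \<in> H \<Longrightarrow> y \<in> H \<Longrightarrow> orb x l b \<Longrightarrow> y l = l \<longleftrightarrow> y b = b"
begin

text \<open>The orbital of \<open>x\<close> starting at \<open>l\<close> cannot stop before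
  \<open>r\<close>: its right end would be moved by \<open>y\<close>, whereas \<open>y\<close> fixes
  \<open>l\<close>, contrary to balance.\<close>

lemma joint_orb_germ_right_orb:
  assumes "x \<in> H" "y \<in> H" "joint_orb x y l r" "\<forall>\<^sub>F t in at_right l. x t \<noteq> t"
  shows "orb x l r"
proof -
  have xl: "x l = l" "y l = l" "x r = r" "l < r" using assms(3) by (auto simp: joint_orb_def)
  obtain u v where uv: "orb x u v" "\<forall>\<^sub>F t in at_right l. u < t \<and> t < v" "u \<le> l" "l \<le> v"
    using germ_orb[OF pl[OF assms(1)] _ assms(4), of l] by (auto simp: germ_def)
  obtain t where t: "l < t" "u < t" "t < v" "t < r"
  proof -
    have "\<forall>\<^sub>F t in at_right l. l < t" "\<forall>\<^sub>F t in at_right l. t < r"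
      using xl by (auto simp: eventually_at_right_field)
    with uv(2) have "\<forall>\<^sub>F t in at_right l. l < t \<and> u < t \<and> t < v \<and> t < r" by eventually_elim simp
    then show ?thesis using eventually_happens that by fastforce
  qed
  have "u = l" using uv(1,3) t xl orb_fixed_outside[OF uv(1) xl(1)] by auto
  have "v \<le> r" using orb_fixed_outside[OF uv(1) xl(3)] t by auto
  moreover have "\<not> v < r"
  proof
    assume "v < r"
    moreover have "x v = v" using uv(1) by (simp add: orb_def)
    ultimately have "y v \<noteq> v" using assms(3) t by (auto simp: joint_orb_def)
    then show False using balanced[OF assms(1,2) uv(1)] \<open>u = l\<close> xl by simp
  qed
  ultimately show ?thesis using uv(1) \<open>u = l\<close> by simp
qed

lemma joint_orb_germ_left_orb:
  assumes "x \<in> H" "y \<in> H" "joint_orb x y l r" "\<forall>\<^sub>F t in at_left r. x t \<noteq> t"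
  shows "orb x l r"
proof -
  have xr: "x r = r" "y r = r" "x l = l" "l < r" using assms(3) by (auto simp: joint_orb_def)
  obtain u v where uv: "orb x u v" "\<forall>\<^sub>F t in at_left r. u < t \<and> t < v" "u \<le> r" "r \<le> v"
    using germ_orb[OF pl[OF assms(1)] _ assms(4), of r] by (auto simp: germ_def)
  obtain t where t: "t < r" "u < t" "t < v" "l < t"
  proof -
    have "\<forall>\<^sub>F t in at_left r. t < r" "\<forall>\<^sub>F t in at_left r. l < t"
      using xr by (auto simp: eventually_at_left_field)
    with uv(2) have "\<forall>\<^sub>F t in at_left r. t < r \<and> u < t \<and> t < v \<and> l < t" by eventually_elim simp
    then show ?thesis using eventually_happens that by fastforce
  qed
  have "v = r" using uv(1,4) t xr orb_fixed_outside[OF uv(1) xr(1)] by auto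
  have "l \<le> u" using orb_fixed_outside[OF uv(1) xr(3)] t by auto
  moreover have "\<not> l < u"
  proof
    assume "l < u"
    moreover have "x u = u" using uv(1) by (simp add: orb_def)
    ultimately have "y u \<noteq> u" using assms(3) t by (auto simp: joint_orb_def)
    then show False using balanced[OF assms(1,2) uv(1)] \<open>v = r\<close> xr by simp
  qed
  ultimately show ?thesis using uv(1) \<open>v = r\<close> by simp
qed

lemma joint_orb_orb:
  assumes "x \<in> H" "y \<in> H" "joint_orb x y l r"
  shows "orb x l r \<or> orb y l r"
proof (rule germ_cases[OF pl[OF assms(1)], of l "at_right l"])
  assume "\<forall>\<^sub>F t in at_right l. x t = t"
  moreover have "\<forall>\<^sub>F t in at_right l. l < t \<and> t < r"
    using assms(3) by (auto simp: eventually_at_right_field joint_orb_def)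
  ultimately have "\<forall>\<^sub>F t in at_right l. y t \<noteq> t"
    by eventually_elim (use assms(3) in \<open>auto simp: joint_orb_def\<close>)
  then show ?thesis using joint_orb_germ_right_orb[OF assms(2,1)] assms(3) joint_orb_sym by blast
qed (use joint_orb_germ_right_orb[OF assms] in \<open>auto simp: germ_def\<close>)

text \<open>The joint orbital around the smaller orbital is an orbital of \<open>x\<close> or of
  \<open>y\<close>, which forces it to be the larger one. As \<open>y\<close> does not have it as an
  orbital, \<open>y\<close> can move no germ at its ends.\<close>

lemma nested_orb:
  assumes "x \<in> H" "y \<in> H" "orb x a b" "orb y p q" "a \<le> p" "q \<le> b" "(p, q) \<noteq> (a, b)"
  shows "joint_orb x y a b" "\<forall>\<^sub>F t in at_right a. y t = t" "\<forall>\<^sub>F t in at_left b. y t = t"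
proof -
  have "p < q" using assms(4) by (simp add: orb_def)
  then obtain t where t: "p < t" "t < q" using dense by blast
  then have yt: "y t \<noteq> t" using assms(4) by (simp add: orb_def)
  obtain l r where lr: "joint_orb x y l r" "l < t" "t < r" using ex_joint_orb[OF pl[OF assms(1)] pl[OF assms(2)]] yt by blast
  have *: "x l = l" "x r = r" using lr by (auto simp: joint_orb_def)
  have "l \<le> a" "b \<le> r"
    using orb_fixed_outside[OF assms(3) *(1)] orb_fixed_outside[OF assms(3) *(2)] t lr assms(5,6) by auto
  from joint_orb_orb[OF assms(1,2) lr(1)] have "l = a \<and> r = b"
  proof
    assume "orb x l r"
    then show ?thesis using orb_unique[OF _ assms(3), of l r t] t lr assms(5,6) by auto
  next
    assume "orb y l r"
    then have "l = p \<and> r = q" using orb_unique[OF _ assms(4), of l r t] t lr by auto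
    then show ?thesis using \<open>l \<le> a\<close> \<open>b \<le> r\<close> assms(5-7) by auto
  qed
  then show h: "joint_orb x y a b" using lr by simp
  have "\<not> orb y a b" using orb_unique[OF _ assms(4), of a b t] t assms(5-7) by auto
  then show "\<forall>\<^sub>F t in at_right a. y t = t" "\<forall>\<^sub>F t in at_left b. y t = t"
    using joint_orb_germ_right_orb[OF assms(2,1)] joint_orb_germ_left_orb[OF assms(2,1)] h
      germ_cases[OF pl[OF assms(2)], of a "at_right a"] germ_cases[OF pl[OF assms(2)], of b "at_left b"]
    unfolding joint_orb_sym[of x] germ_def by metis+
qed

text \<open>The joint orbital around the given one belongs to \<open>x\<close> or to
  \<open>g\<close>; by the maximality assumption it has the ends \<open>p\<close> and
  \<open>q\<close> in either case, and joint orbitals have common fixed points as ends.\<close>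

lemma fixes_orb_ends:
  assumes "x \<in> H" "g \<in> H" "orb g p q"
    and "\<And>u v. orb x u v \<Longrightarrow> u \<le> p \<Longrightarrow> q \<le> v \<Longrightarrow> u = p \<and> v = q"
  shows "x p = p" "x q = q"
proof -
  have "p < q" using assms(3) by (simp add: orb_def)
  then obtain t where t: "p < t" "t < q" using dense by blast
  then have gt: "g t \<noteq> t" using assms(3) by (simp add: orb_def)
  obtain l r where lr: "joint_orb x g l r" "l < t" "t < r" using ex_joint_orb[OF pl[OF assms(1)] pl[OF assms(2)]] gt by blast
  have *: "g l = l" "g r = r" "x l = l" "x r = r" using lr by (auto simp: joint_orb_def)
  have "l \<le> p" "q \<le> r"
    using orb_fixed_outside[OF assms(3) *(1)] orb_fixed_outside[OF assms(3) *(2)] t lr by auto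
  from joint_orb_orb[OF assms(1,2) lr(1)] have "l = p \<and> r = q"
  proof
    assume "orb x l r"
    then show ?thesis using assms(4) \<open>l \<le> p\<close> \<open>q \<le> r\<close> by blast
  next
    assume "orb g l r"
    then show ?thesis using orb_unique[OF _ assms(3), of l r t] t lr by auto
  qed
  then show "x p = p" "x q = q" using * by auto
qed

text \<open>The commutator of \<open>g\<close> with a high power of \<open>x\<close> still agrees
  with \<open>g\<close> on the smaller orbital and is trivial near ends of orbitals of
  \<open>g\<close> that \<open>x\<close> fixes. Conjugating by a power of \<open>g\<close> then
  carries the germ \<open>F\<close> to where the commutator is trivial.\<close>

lemma localise_orb:
  assumes x: "x \<in> H" and g: "g \<in> H" and X: "orb x a b" and A: "orb g p q"
    and sub: "a \<le> p" "q \<le> b" "(p, q) \<noteq> (a, b)" and F: "germ e F"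
    and ends: "(\<forall>\<^sub>F t in F. g t = t) \<and> (\<forall>\<^sub>F t in F. x t = t) \<or>
      (\<exists>u v. orb g u v \<and> (\<forall>\<^sub>F t in F. u < t \<and> t < v) \<and> x u = u \<and> x v = v)"
  shows "\<exists>f \<in> H. orb f p q \<and> (\<forall>\<^sub>F t in F. f t = t)"
proof -
  note hx = hom[OF x] and hg = hom[OF g]
  have pq: "p < q" "g p = p" "g q = q" using A by (auto simp: orb_def)
  \<comment> \<open>Together with \<open>d\<close> below, this bounds the support of
    \<open>g\<close> inside the orbital of \<open>x\<close> by a compact interval, which powers of
    \<open>x\<close> displace.\<close>
  obtain s where s: "a < s" "\<And>t. a < t \<Longrightarrow> t < s \<Longrightarrow> g t = t"
    using nested_orb(2)[OF x g X A sub] by (auto simp: eventually_at_right_field)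
  obtain d where d: "d < b" "\<And>t. d < t \<Longrightarrow> t < b \<Longrightarrow> g t = t"
    using nested_orb(3)[OF x g X A sub] by (auto simp: eventually_at_left_field)
  have bd: "s \<le> z \<and> z \<le> d" if "a < z" "z < b" "g z \<noteq> z" for z
    using s(2)[of z] d(2)[of z] that by (meson not_le)
  have sp: "s \<le> p"
  proof (rule ccontr)
    assume "\<not> s \<le> p"
    then obtain z where "p < z" "z < min s q" using dense[of p "min s q"] pq by auto
    then show False using A bd[of z] sub by (auto simp: orb_def)
  qed
  have qd: "q \<le> d"
  proof (rule ccontr)
    assume "\<not> q \<le> d"
    then obtain z where "max d p < z" "z < q" using dense[of "max d p" q] pq by auto
    then show False using A bd[of z] sub by (auto simp: orb_def)
  qed
  have "{s..d} \<subseteq> moved x" using X s(1) d(1) by (auto simp: orb_def moved_def)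
  from eventually_happens[OF compact_wanders[OF pl[OF x] compact_Icc this]]
  obtain N where N: "\<And>z. z \<in> {s..d} \<Longrightarrow> zpow x (- int N) z \<notin> {s..d}"
    using trivial_limit_sequentially by blast
  define k where "k = zpow x (int N)"
  have kH: "k \<in> H" unfolding k_def by (rule zpow_mem[OF x])
  have ik: "inv k = zpow x (- int N)" unfolding k_def by (rule inv_zpow[OF bijH[OF x]])
  define c where "c = comm g k"
  have cH: "c \<in> H" unfolding c_def by (rule comm_mem[OF g kH])
  have c_g: "c z = g z" if z: "p \<le> z" "z \<le> q" for z
    unfolding c_def
  proof (rule comm_apply[OF bijH[OF g] _ bijH[OF kH]])
    have "a < inv k z" "inv k z < b"
      unfolding ik using orb_zpow_less[OF hx X] z s d sp qd by auto
    moreover have "inv k z \<notin> {s..d}" unfolding ik using N z sp qd by auto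
    ultimately show "g (inv k z) = inv k z" using bd by auto
  qed
  have oc: "orb c p q" using A c_g unfolding orb_def by simp
  \<comment> \<open>Powers of \<open>g\<close> fix \<open>p\<close> and \<open>q\<close>, so
    conjugating by them keeps the orbital.\<close>
  have conj: "orb (zpow g (- M) \<circ> c \<circ> inv (zpow g (- M))) p q" for M
  proof -
    have "zpow g (- M) p = p" "zpow g (- M) q = q" using zpow_fixed[OF bijH[OF g]] pq by auto
    then show ?thesis using orb_conj[OF homeo_zpow[OF hg] oc, of "- M"] by simp
  qed
  have "\<exists>M. \<forall>\<^sub>F t in F. c (zpow g M t) = zpow g M t"
    using ends
  proof
    assume "(\<forall>\<^sub>F t in F. g t = t) \<and> (\<forall>\<^sub>F t in F. x t = t)"
    then have gx: "\<forall>\<^sub>F t in F. g t = t" "\<forall>\<^sub>F t in F. x t = t" by auto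
    then have "\<forall>\<^sub>F t in F. c (zpow g 0 t) = zpow g 0 t"
    proof eventually_elim
      case (elim t)
      have "k t = t" unfolding k_def by (rule zpow_fixed[OF bijH[OF x] elim(2)])
      moreover have "inv k t = t" unfolding ik by (rule zpow_fixed[OF bijH[OF x] elim(2)])
      moreover have "inv g t = t" using elim homeo_inv1[OF hg, of t] by simp
      ultimately show ?case using elim by (simp add: c_def comm_def)
    qed
    then show ?thesis by (rule exI)
  next
    assume "\<exists>u v. orb g u v \<and> (\<forall>\<^sub>F t in F. u < t \<and> t < v) \<and> x u = u \<and> x v = v"
    then obtain u v where uv: "orb g u v" "\<forall>\<^sub>F t in F. u < t \<and> t < v" "x u = u" "x v = v" by blast
    have "g u = u" "g v = v" "k u = u" "k v = v"
      using uv zpow_fixed[OF bijH[OF x]] by (auto simp: orb_def k_def)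
    then have "\<forall>\<^sub>F t in at_right u. c t = t" "\<forall>\<^sub>F t in at_left v. c t = t"
      using comm_trivial_germ[OF pl[OF g] _ pl[OF kH], of u "at_right u"]
        comm_trivial_germ[OF pl[OF g] _ pl[OF kH], of v "at_left v"]
      by (simp_all add: c_def germ_def)
    then show ?thesis by (rule push_germ[OF hg uv(1) F uv(2)])
  qed
  then obtain M where M: "\<forall>\<^sub>F t in F. c (zpow g M t) = zpow g M t" by blast
  define f where "f = zpow g (- M) \<circ> c \<circ> inv (zpow g (- M))"
  have "f \<in> H" unfolding f_def by (intro conj_mem zpow_mem g cH)
  moreover have "orb f p q" unfolding f_def by (rule conj)
  moreover have "\<forall>\<^sub>F t in F. f t = t" using M
  proof eventually_elim
    case (elim t)
    have "inv (zpow g (- M)) = zpow g M" using inv_zpow[OF bijH[OF g], of "- M"] by simp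
    then show ?case using elim zpow_add'[OF bijH[OF g], of "- M" M t] by (simp add: f_def)
  qed
  ultimately show ?thesis by blast
qed

end

section \<open>Deep towers\<close>

definition nest :: "(nat \<Rightarrow> real) \<Rightarrow> (nat \<Rightarrow> real) \<Rightarrow> bool" where
  "nest u v \<longleftrightarrow> (\<forall>k. u k \<le> u (Suc k) \<and> v (Suc k) \<le> v k \<and> (u k, v k) \<noteq> (u (Suc k), v (Suc k)))"

lemma nest_less:
  assumes "nest u v" "i < j"
  shows "u i \<le> u j" "v j \<le> v i" "(u j, v j) \<noteq> (u i, v i)"
proof -
  have u: "u i \<le> u j" if "i \<le> j" for i j
    by (rule lift_Suc_mono_le[OF _ that]) (use assms(1) in \<open>auto simp: nest_def\<close>)
  have v: "v j \<le> v i" if "i \<le> j" for i j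
    by (rule lift_Suc_antimono_le[OF _ that]) (use assms(1) in \<open>auto simp: nest_def\<close>)
  show "u i \<le> u j" "v j \<le> v i" using u v assms(2) by auto
  have "u i \<le> u (Suc i)" "u (Suc i) \<le> u j" "v j \<le> v (Suc i)" "v (Suc i) \<le> v i"
    using u v assms(2) by auto
  moreover have "(u i, v i) \<noteq> (u (Suc i), v (Suc i))" using assms(1) unfolding nest_def by blast
  ultimately show "(u j, v j) \<noteq> (u i, v i)" by auto
qed

lemma nest_shift: "nest u v \<Longrightarrow> nest (\<lambda>k. u (k + m)) (\<lambda>k. v (k + m))"
  by (simp add: nest_def)

text \<open>The set \<open>G\<close> will shrink to subgroups with trivial germs, while
  \<open>a\<close> and \<open>b\<close> bound an interval that continues to contain the
  tower.\<close>

definition deep_tower :: "(real \<Rightarrow> real) set \<Rightarrow> real \<Rightarrow> real \<Rightarrow> bool" where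
  "deep_tower G a b \<longleftrightarrow> (\<exists>g u v. nest u v \<and> a \<le> u 0 \<and> v 0 \<le> b \<and> (\<forall>k. g k \<in> G \<and> orb (g k) (u k) (v k)))"

context balanced_group
begin

lemma localise_tower:
  assumes n: "nest u v" and g: "\<And>k. g k \<in> H" "\<And>k. orb (g k) (u k) (v k)" and F: "germ e F"
    and ends: "\<And>k. 0 < k \<Longrightarrow> (\<forall>\<^sub>F t in F. g k t = t) \<and> (\<forall>\<^sub>F t in F. g 0 t = t) \<or>
      (\<exists>p q. orb (g k) p q \<and> (\<forall>\<^sub>F t in F. p < t \<and> t < q) \<and> g 0 p = p \<and> g 0 q = q)"
  shows "deep_tower {f \<in> H. \<forall>\<^sub>F t in F. f t = t} (u 0) (v 0)"
proof -
  have "\<exists>f. f \<in> H \<and> orb f (u k) (v k) \<and> (\<forall>\<^sub>F t in F. f t = t)" if "0 < k" for k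
    using localise_orb[OF g(1) g(1) g(2) g(2) nest_less[OF n that] F ends[OF that]] by blast
  \<comment> \<open>The top member \<open>g 0\<close> is spent on forming commutators, so the new
    tower starts at index 1.\<close>
  then obtain f where f: "\<And>k. f (Suc k) \<in> H \<and> orb (f (Suc k)) (u (Suc k)) (v (Suc k)) \<and> (\<forall>\<^sub>F t in F. f (Suc k) t = t)"
    by (metis zero_less_Suc)
  show ?thesis unfolding deep_tower_def
    by (rule exI[of _ "\<lambda>k. f (Suc k)"], rule exI[of _ "\<lambda>k. u (k + 1)"], rule exI[of _ "\<lambda>k. v (k + 1)"])
      (use f nest_shift[OF n, of 1] nest_less(1,2)[OF n, of 0 1] in auto)
qed

text \<open>If \<open>g k\<close> moves the germ along an orbital, no orbital of \<open>g 0\<close>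
  contains that one, as \<open>g 0\<close> is trivial at the germ. So \<open>fixes_orb_ends\<close>
  shows that \<open>g 0\<close> fixes its ends, as \<open>localise_tower\<close> requires.\<close>

lemma localise_tower_trivial:
  assumes n: "nest u v" and g: "\<And>k. g k \<in> H" "\<And>k. orb (g k) (u k) (v k)" and F: "germ e F"
    and triv: "\<forall>\<^sub>F t in F. g 0 t = t"
  shows "deep_tower {f \<in> H. \<forall>\<^sub>F t in F. f t = t} (u 0) (v 0)"
proof (rule localise_tower[OF n g F])
  fix k :: nat
  show "(\<forall>\<^sub>F t in F. g k t = t) \<and> (\<forall>\<^sub>F t in F. g 0 t = t) \<or>
      (\<exists>p q. orb (g k) p q \<and> (\<forall>\<^sub>F t in F. p < t \<and> t < q) \<and> g 0 p = p \<and> g 0 q = q)"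
  proof (rule germ_cases[OF pl[OF g(1)[of k]] F])
    assume "\<forall>\<^sub>F t in F. g k t \<noteq> t"
    from germ_orb[OF pl[OF g(1)] F this] obtain p q
      where pq: "orb (g k) p q" "\<forall>\<^sub>F t in F. p < t \<and> t < q" by blast
    have no: "\<not> (orb (g 0) p' q' \<and> p' \<le> p \<and> q \<le> q')" for p' q'
    proof
      assume *: "orb (g 0) p' q' \<and> p' \<le> p \<and> q \<le> q'"
      from pq(2) have "\<forall>\<^sub>F t in F. g 0 t \<noteq> t"
        by eventually_elim (use * in \<open>auto simp: orb_def\<close>)
      then show False using germ_not_both[OF F triv] by blast
    qed
    have "g 0 p = p" "g 0 q = q" by (rule fixes_orb_ends[OF g(1) g(1) pq(1)]; use no in blast)+
    then show ?thesis using pq by blast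
  qed (use triv in blast)
qed

text \<open>If some member of the tower is trivial at the germ, commutators with it localise the smaller ones.
  Otherwise let \<open>(p k, q k)\<close> be the orbital of \<open>g k\<close> at the germ.  If it shrinks strictly between two
  indices \<open>i < j\<close>, a power of \<open>g i\<close> conjugates \<open>g j\<close> to an element trivial at the germ; if it never
  does, \<open>g 0\<close> fixes all \<open>p k\<close> and \<open>q k\<close>, and commutators with \<open>g 0\<close> work.\<close>

lemma deep_tower_germ:
  assumes d: "deep_tower H a b" and F: "germ e F"
  shows "deep_tower {f \<in> H. \<forall>\<^sub>F t in F. f t = t} a b"
proof -
  obtain g u v where n: "nest u v" and ab: "a \<le> u 0" "v 0 \<le> b"
    and g: "\<And>k. g k \<in> H" "\<And>k. orb (g k) (u k) (v k)"
    using d unfolding deep_tower_def by blast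
  have widen: "deep_tower G a b" if "deep_tower G a' b'" "a \<le> a'" "b' \<le> b" for G a' b'
    using that unfolding deep_tower_def by (meson order_trans)
  have u0: "a \<le> u k" "v k \<le> b" for k
    using nest_less(1,2)[OF n, of 0 k] ab by (cases k; auto)+
  show ?thesis
  proof (cases "\<exists>m. \<forall>\<^sub>F t in F. g m t = t")
    case True
    then obtain m where m: "\<forall>\<^sub>F t in F. g m t = t" by blast
    have "deep_tower {f \<in> H. \<forall>\<^sub>F t in F. f t = t} (u (0 + m)) (v (0 + m))"
      by (rule localise_tower_trivial[OF nest_shift[OF n] g F]) (use m in simp)
    then show ?thesis by (rule widen) (use u0 in auto)
  next
    case False
    have "\<exists>p q. orb (g k) p q \<and> (\<forall>\<^sub>F t in F. p < t \<and> t < q)" for k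
      using germ_cases[OF pl[OF g(1)[of k]] F] germ_orb[OF pl[OF g(1)[of k]] F] False by metis
    then obtain p q where pq: "\<And>k. orb (g k) (p k) (q k)" "\<And>k. \<forall>\<^sub>F t in F. p k < t \<and> t < q k" by metis
    show ?thesis
    proof (cases "\<exists>i j. i < j \<and> p i \<le> p j \<and> q j \<le> q i \<and> (p j, q j) \<noteq> (p i, q i)")
      case True
      then obtain i j where ij: "i < j" "p i \<le> p j" "q j \<le> q i" "(p j, q j) \<noteq> (p i, q i)" by blast
      obtain M where M: "\<forall>\<^sub>F t in F. g j (zpow (g i) M t) = zpow (g i) M t"
        using push_germ[OF hom[OF g(1)] pq(1) F pq(2)] nested_orb(2,3)[OF g(1) g(1) pq(1) pq(1) ij(2-4)] by blast
      define w where "w = zpow (g i) (- M)"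
      have wH: "w \<in> H" unfolding w_def by (rule zpow_mem[OF g(1)])
      have iw: "inv w = zpow (g i) M" unfolding w_def using inv_zpow[OF bijH[OF g(1)], of i "- M"] by simp
      have wuv: "u i < w t \<longleftrightarrow> u i < t" "w t < v i \<longleftrightarrow> t < v i" for t
        unfolding w_def using orb_zpow_less[OF hom[OF g(1)] g(2)] by blast+
      have "deep_tower {f \<in> H. \<forall>\<^sub>F t in F. f t = t} (w (u (0 + j))) (w (v (0 + j)))"
      proof (rule localise_tower_trivial[where g = "\<lambda>k. w \<circ> g (k + j) \<circ> inv w" and u = "\<lambda>k. w (u (k + j))" and v = "\<lambda>k. w (v (k + j))", OF _ _ _ F])
        show "nest (\<lambda>k. w (u (k + j))) (\<lambda>k. w (v (k + j)))"
          using nest_shift[OF n, of j] by (simp add: nest_def homeo_le_iff[OF hom[OF wH]] homeo_eq_iff[OF hom[OF wH]])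
        show "w \<circ> g (k + j) \<circ> inv w \<in> H" for k by (rule conj_mem[OF wH g(1)])
        show "orb (w \<circ> g (k + j) \<circ> inv w) (w (u (k + j))) (w (v (k + j)))" for k
          by (rule orb_conj[OF hom[OF wH] g(2)])
        show "\<forall>\<^sub>F t in F. (w \<circ> g (0 + j) \<circ> inv w) t = t" using M
        proof eventually_elim
          case (elim t)
          then show ?case using homeo_inv2[OF hom[OF wH], of t] by (simp add: iw)
        qed
      qed
      then show ?thesis
      proof (rule widen)
        \<comment> \<open>\<open>w\<close> is a power of \<open>g i\<close> and preserves its
          orbital, so the conjugated tower stays between \<open>u i\<close> and
          \<open>v i\<close>.\<close>
        have "w (u i) = u i" "w (v i) = v i"
          unfolding w_def using g(2)[of i] zpow_fixed[OF bijH[OF g(1)]] by (auto simp: orb_def)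
        then have "u i \<le> w (u j)" "w (v j) \<le> v i"
          using nest_less(1,2)[OF n ij(1)] homeo_le_iff[OF hom[OF wH], of "u i" "u j"]
            homeo_le_iff[OF hom[OF wH], of "v j" "v i"] by auto
        then show "a \<le> w (u (0 + j))" "w (v (0 + j)) \<le> b" using u0[of i] by auto
      qed
    next
      case no: False
      have "deep_tower {f \<in> H. \<forall>\<^sub>F t in F. f t = t} (u 0) (v 0)"
      proof (rule localise_tower[OF n g F], rule disjI2)
        fix k :: nat
        assume k: "0 < k"
        \<comment> \<open>Such an orbital of \<open>g 0\<close> contains the germ, so it runs from
          \<open>p 0\<close> to \<open>q 0\<close>; as the orbitals at the germ never shrink
          strictly, it equals that of \<open>g k\<close>.\<close>
        have max: "p' = p k \<and> q' = q k" if o: "orb (g 0) p' q'" "p' \<le> p k" "q k \<le> q'" for p' q'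
        proof -
          have "\<forall>\<^sub>F t in F. p' < t \<and> t < q'" using pq(2)[of k] by eventually_elim (use o in auto)
          then have "p' = p 0 \<and> q' = q 0" using germ_orb_unique[OF F o(1) _ pq(1,2)] by blast
          then show ?thesis using no k o by (metis Pair_inject)
        qed
        have "g 0 (p k) = p k" "g 0 (q k) = q k"
          by (rule fixes_orb_ends[OF g(1) g(1) pq(1)[of k] max]; assumption)+
        then show "\<exists>p q. orb (g k) p q \<and> (\<forall>\<^sub>F t in F. p < t \<and> t < q) \<and> g 0 p = p \<and> g 0 q = q"
          using pq by blast
      qed
      then show ?thesis by (rule widen) (use ab in auto)
    qed
  qed
qed

lemma balanced_group_germ: "balanced_group {f \<in> H. \<forall>\<^sub>F t in F. f t = t}"
proof
  show "pl_homeo f" if "f \<in> {f \<in> H. \<forall>\<^sub>F t in F. f t = t}" for f using that pl by blast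
  show "id \<in> {f \<in> H. \<forall>\<^sub>F t in F. f t = t}" using id_mem by simp
  show "f \<circ> g \<in> {f \<in> H. \<forall>\<^sub>F t in F. f t = t}"
    if "f \<in> {f \<in> H. \<forall>\<^sub>F t in F. f t = t}" "g \<in> {f \<in> H. \<forall>\<^sub>F t in F. f t = t}" for f g
  proof -
    from that have "\<forall>\<^sub>F t in F. f t = t" "\<forall>\<^sub>F t in F. g t = t" by auto
    then have "\<forall>\<^sub>F t in F. (f \<circ> g) t = t" by eventually_elim simp
    then show ?thesis using that comp_mem by blast
  qed
  show "inv f \<in> {f \<in> H. \<forall>\<^sub>F t in F. f t = t}" if "f \<in> {f \<in> H. \<forall>\<^sub>F t in F. f t = t}" for f
  proof -
    from that have f: "f \<in> H" "\<forall>\<^sub>F t in F. f t = t" by auto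
    from f(2) have "\<forall>\<^sub>F t in F. inv f t = t"
      by eventually_elim (use homeo_inv1[OF hom[OF f(1)]] in metis)
    then show ?thesis using f(1) inv_mem by blast
  qed
  show "y l = l \<longleftrightarrow> y b = b"
    if "x \<in> {f \<in> H. \<forall>\<^sub>F t in F. f t = t}" "y \<in> {f \<in> H. \<forall>\<^sub>F t in F. f t = t}" "orb x l b" for x y l b
    using that balanced by blast
qed

end

text \<open>Localising at one germ leaves a balanced group with a deep tower in the same interval,
  so the germs can be treated one after another.\<close>

lemma deep_tower_germs:
  assumes "finite \<F>" "\<And>F. F \<in> \<F> \<Longrightarrow> \<exists>e. germ e F"
    and "balanced_group H" "deep_tower H a b"
  shows "deep_tower {f \<in> H. \<forall>F\<in>\<F>. \<forall>\<^sub>F t in F. f t = t} a b"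
  using assms
proof (induction \<F> arbitrary: H)
  case empty
  then show ?case by simp
next
  case (insert F \<F>)
  obtain e where e: "germ e F" using insert.prems(1) by blast
  interpret balanced_group H by (rule insert.prems(2))
  have "deep_tower {f \<in> {f \<in> H. \<forall>\<^sub>F t in F. f t = t}. \<forall>F\<in>\<F>. \<forall>\<^sub>F t in F. f t = t} a b"
    by (rule insert.IH[OF _ balanced_group_germ deep_tower_germ[OF insert.prems(3) e]])
      (use insert.prems in blast)
  moreover have "{f \<in> {f \<in> H. \<forall>\<^sub>F t in F. f t = t}. \<forall>F\<in>\<F>. \<forall>\<^sub>F t in F. f t = t} =
      {f \<in> H. \<forall>F\<in>insert F \<F>. \<forall>\<^sub>F t in F. f t = t}" by auto
  ultimately show ?case by (simp only:)
qed

section \<open>Descending sequences from deep towers\<close>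

lemma moved_bounded: "pl_homeo f \<Longrightarrow> bounded (moved f)"
  by (rule bounded_subset[of "{0..1}"]) (use pl_homeo_outside in \<open>auto simp: moved_def less_imp_le\<close>)

lemma compact_closure_mv: "pl_homeo f \<Longrightarrow> compact (closure (moved f))"
  using moved_bounded compact_closure by blast

context balanced_group
begin

lemma descent_step:
  assumes h: "h \<in> H" and C: "orb h a b" and d: "deep_tower H a b"
  shows "\<exists>h' p q. h' \<in> H \<and> orb h' p q \<and> deep_tower H p q \<and> closure (moved h') \<subseteq> moved h"
proof -
  define \<F> where "\<F> = at_right ` fr h \<union> at_left ` fr h"
  have "finite \<F>" unfolding \<F>_def using finite_fr[OF pl[OF h]] by simp
  moreover have "\<exists>e. germ e F" if "F \<in> \<F>" for F using that by (auto simp: \<F>_def germ_def)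
  ultimately have "deep_tower {f \<in> H. \<forall>F\<in>\<F>. \<forall>\<^sub>F t in F. f t = t} a b"
    by (rule deep_tower_germs[OF _ _ balanced_group_axioms d])
  then obtain g u v where n: "nest u v" and ab: "a \<le> u 0" "v 0 \<le> b"
    and g: "\<And>k. g k \<in> H" "\<And>k F. F \<in> \<F> \<Longrightarrow> \<forall>\<^sub>F t in F. g k t = t" and o: "\<And>k. orb (g k) (u k) (v k)"
    unfolding deep_tower_def by blast
  define f p q where "f = g 0" and "p = u 0" and "q = v 0"
  have fH: "f \<in> H" and fo: "orb f p q" using g(1) o by (simp_all add: f_def p_def q_def)
  \<comment> \<open>The tower below its top member is still deep and lies within the orbital of
    \<open>f\<close>.\<close>
  have d': "deep_tower H p q" unfolding deep_tower_def
    by (rule exI[of _ "\<lambda>k. g (k + 1)"], rule exI[of _ "\<lambda>k. u (k + 1)"], rule exI[of _ "\<lambda>k. v (k + 1)"])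
      (use g(1) o nest_shift[OF n, of 1] nest_less(1,2)[OF n, of 0 1] in \<open>auto simp: p_def q_def\<close>)
  have f_germ: "\<forall>\<^sub>F t in F. f t = t" if "e \<in> fr h" "germ e F" for e F
    unfolding f_def by (rule g(2)) (use that in \<open>auto simp: \<F>_def germ_def\<close>)
  have f_fr: "f e = e" if "e \<in> fr h" for e
    by (rule germ_trivial_fixed[OF hom[OF fH], of _ "at_right e"]) (use f_germ[OF that] in \<open>auto simp: germ_def\<close>)
  define S where "S = moved f \<inter> moved h"
  \<comment> \<open>\<open>f\<close> fixes the ends of every orbital of \<open>h\<close>, hence maps
    each of them to itself.\<close>
  have f_mv_h: "f z \<in> moved h \<longleftrightarrow> z \<in> moved h" for z
  proof -
    have *: "u < f z \<longleftrightarrow> u < z" "f z < v \<longleftrightarrow> z < v" if "orb h u v" for u v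
      using homeo_fixed_ends[OF hom[OF fH] f_fr f_fr, OF orb_fr[OF that]] by blast+
    show ?thesis
    proof
      assume "f z \<in> moved h"
      then obtain u v where uv: "orb h u v" "u < f z" "f z < v" using ex_orb[OF pl[OF h], of "f z"] by (auto simp: moved_def)
      then have "u < z" "z < v" using *[OF uv(1)] by blast+
      then show "z \<in> moved h" using uv(1) by (simp add: orb_def moved_def)
    next
      assume "z \<in> moved h"
      then obtain u v where uv: "orb h u v" "u < z" "z < v" using ex_orb[OF pl[OF h], of z] by (auto simp: moved_def)
      then have "u < f z" "f z < v" using *[OF uv(1)] by blast+
      then show "f z \<in> moved h" using uv(1) by (simp add: orb_def moved_def)
    qed
  qed
  have f_S: "f z \<in> S \<longleftrightarrow> z \<in> S" for z
    unfolding S_def using f_mv_h moved_apply_iff[OF bijH[OF fH]] by blast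
  have fS: "f ` S = S"
  proof (intro equalityI subsetI)
    fix z assume "z \<in> S"
    then have "inv f z \<in> S" using f_S[of "inv f z"] hom[OF fH] by simp
    then show "z \<in> f ` S" using hom[OF fH] by (metis homeo_inv2 image_eqI)
  qed (use f_S in auto)
  \<comment> \<open>Around a frontier point of \<open>h\<close> the map \<open>f\<close> is trivial,
    and around any other fixed point of \<open>h\<close> the map \<open>h\<close> is; so no fixed
    point of \<open>h\<close> is a limit of \<open>S\<close>.\<close>
  have clS: "closure S \<subseteq> moved h"
  proof
    fix t assume t: "t \<in> closure S"
    show "t \<in> moved h"
    proof (rule ccontr)
      assume "t \<notin> moved h"
      then have ht: "h t = t" and tS: "t \<notin> S" by (auto simp: moved_def S_def)
      then have lim: "t islimpt S" using t by (simp add: closure_def)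
      show False
      proof (cases "t \<in> fr h")
        case True
        have "\<forall>\<^sub>F s in at t. f s = s" unfolding at_germs using f_germ[OF True] by blast
        then have "\<forall>\<^sub>F s in at t. s \<notin> S" by eventually_elim (simp add: S_def moved_def)
        then show False using lim by (simp add: islimpt_iff_eventually)
      next
        case False
        then have "\<forall>\<^sub>F s in at t. h s = s" using ht by (simp add: fr_def)
        then have "\<forall>\<^sub>F s in at t. s \<notin> S" by eventually_elim (simp add: S_def moved_def)
        then show False using lim by (simp add: islimpt_iff_eventually)
      qed
    qed
  qed
  have "compact (closure S)"
    using bounded_subset[OF moved_bounded[OF pl[OF h]]] compact_closure[of S] by (auto simp: S_def)
  from eventually_happens[OF compact_wanders[OF pl[OF h] this clS]]
  obtain N where N: "\<And>z. z \<in> closure S \<Longrightarrow> zpow h (int N) z \<notin> closure S \<and> zpow h (- int N) z \<notin> closure S"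
    using trivial_limit_sequentially by blast
  define k where "k = zpow h (int N)"
  have kH: "k \<in> H" unfolding k_def by (rule zpow_mem[OF h])
  have ik: "inv k = zpow h (- int N)" unfolding k_def by (rule inv_zpow[OF bijH[OF h]])
  have mvk: "moved k \<subseteq> moved h" unfolding k_def by (rule moved_zpow[OF bijH[OF h]])
  have k_V: "k z \<in> moved h \<longleftrightarrow> z \<in> moved h" for z by (rule moved_subset_mem_iff[OF bijH[OF kH] mvk])
  have kV: "k ` moved h = moved h"
  proof (intro equalityI subsetI)
    fix z assume "z \<in> moved h"
    then have "inv k z \<in> moved h" using k_V[of "inv k z"] hom[OF kH] by simp
    then show "z \<in> k ` moved h" using hom[OF kH] by (metis homeo_inv2 image_eqI)
  qed (use k_V in auto)
  have kS: "k ` S \<inter> S = {}" using N closure_subset[of S] by (force simp: k_def)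
  define h' where "h' = comm f k"
  have "h' \<in> H" unfolding h'_def by (rule comm_mem[OF fH kH])
  moreover have "orb h' p q"
  proof -
    have pq: "p < q" using fo by (simp add: orb_def)
    have "{p<..<q} \<subseteq> S"
      using fo C ab by (auto simp: S_def moved_def orb_def p_def q_def)
    then have "{p..q} \<subseteq> closure S" using closure_mono closure_greaterThanLessThan[OF pq] by metis
    \<comment> \<open>The inverse of \<open>k\<close> takes \<open>z\<close> to a point of
      \<open>moved h\<close> outside \<open>S\<close>, where \<open>f\<close> is trivial, so the
      second half of the commutator has no effect.\<close>
    have "h' z = f z" if z: "p \<le> z" "z \<le> q" for z
      unfolding h'_def
    proof (rule comm_apply[OF bijH[OF fH] _ bijH[OF kH]])
      have zS: "z \<in> closure S" using \<open>{p..q} \<subseteq> closure S\<close> z by auto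
      then have "inv k z \<notin> S" unfolding ik using N closure_subset by blast
      moreover have "inv k z \<in> moved h" using clS zS k_V[of "inv k z"] hom[OF kH] by auto
      ultimately show "f (inv k z) = inv k z" by (auto simp: S_def moved_def)
    qed
    then show ?thesis using fo pq unfolding orb_def by simp
  qed
  moreover have "closure (moved h') \<subseteq> moved h"
  proof -
    have "moved h' \<subseteq> S \<union> k ` S" unfolding h'_def
      by (rule comm_localised(2)[OF bijH[OF fH] bijH[OF kH] mvk kV S_def fS kS])
    then have "closure (moved h') \<subseteq> closure S \<union> closure (k ` S)"
      using closure_mono closure_Un by metis
    also have "\<dots> \<subseteq> closure S \<union> k ` closure S" using closure_image_homeo[OF hom[OF kH]] by blast
    also have "\<dots> \<subseteq> moved h" using clS k_V by auto
    finally show ?thesis .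
  qed
  ultimately show ?thesis using d' by blast
qed

lemma balanced_descending:
  assumes "deep_tower H a b" shows "descending H"
proof -
  obtain g u v where g: "nest u v" "\<And>k. g k \<in> H" "\<And>k. orb (g k) (u k) (v k)"
    using assms unfolding deep_tower_def by blast
  define P where "P s \<longleftrightarrow> (case s of (h, a, b) \<Rightarrow> h \<in> H \<and> orb h a b \<and> deep_tower H a b)" for s
  have "deep_tower H (u 0) (v 0)" unfolding deep_tower_def using g by blast
  then have "P (g 0, u 0, v 0)" using g by (simp add: P_def)
  moreover have "\<exists>s'. P s' \<and> closure (moved (fst s')) \<subseteq> moved (fst s)" if "P s" for s
    using that descent_step unfolding P_def by (cases s) fastforce
  ultimately obtain s where s: "\<And>n. P (s n)" "\<And>n::nat. closure (moved (fst (s (Suc n)))) \<subseteq> moved (fst (s n))"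
    using dependent_nat_choice[of "\<lambda>_. P" "\<lambda>_ s s'. closure (moved (fst s')) \<subseteq> moved (fst s)"] by metis
  have "fst (s n) \<in> H \<and> fst (s n) \<noteq> id" for n
  proof -
    obtain h a b where hab: "s n = (h, a, b)" by (cases "s n")
    then have "h \<in> H" "orb h a b" using s(1)[of n] by (auto simp: P_def)
    moreover from this(2) obtain z where "a < z" "z < b" using dense[of a b] unfolding orb_def by blast
    ultimately show ?thesis using hab by (auto simp: orb_def)
  qed
  then show ?thesis unfolding descending_def using s(2) by (intro exI[of _ "\<lambda>n. fst (s n)"]) simp
qed

end

section \<open>From deep towers to wreath towers\<close>

lemma (in pl_group) deep_tower_descending:
  assumes "deep_tower H a b" shows "descending H"
proof (cases "balanced_group H")
  case True
  then show ?thesis using balanced_group.balanced_descending assms by blast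
next
  case False
  then obtain x y l r where "x \<in> H" "y \<in> H" "orb x l r" "(y l = l) \<noteq> (y r = r)"
    unfolding balanced_group_def balanced_group_axioms_def using pl_group_axioms by blast
  then show ?thesis using unbalanced_descending unbalanced_descending_mirror by blast
qed


text \<open>All sufficiently high powers of \<open>f n\<close> displace the compact closure of the
  next support. Raising \<open>f n\<close> to one such threshold \<open>M n\<close> makes every
  nonzero power of \<open>h n\<close> displace it.\<close>

lemma (in pl_group) descending_wr_tower:
  assumes "descending H"
  obtains h D where "wr_tower h D" "\<And>n. h n \<in> H"
proof -
  obtain f where f: "\<And>n::nat. f n \<in> H" "\<And>n. f n \<noteq> id" "\<And>n. closure (moved (f (Suc n))) \<subseteq> moved (f n)"
    using assms unfolding descending_def by blast
  have "\<exists>M. M > 0 \<and> (\<forall>m\<ge>M. \<forall>x\<in>closure (moved (f (Suc n))).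
      zpow (f n) (int m) x \<notin> closure (moved (f (Suc n))) \<and> zpow (f n) (- int m) x \<notin> closure (moved (f (Suc n))))" for n
  proof -
    obtain M0 where "\<forall>m\<ge>M0. \<forall>x\<in>closure (moved (f (Suc n))).
      zpow (f n) (int m) x \<notin> closure (moved (f (Suc n))) \<and> zpow (f n) (- int m) x \<notin> closure (moved (f (Suc n)))"
      using compact_wanders[OF pl[OF f(1)] compact_closure_mv[OF pl[OF f(1)]] f(3)]
      unfolding eventually_sequentially by blast
    then show ?thesis by (intro exI[of _ "Suc M0"]) simp
  qed
  then obtain M where M: "\<And>n. M n > 0" "\<And>n m x. m \<ge> M n \<Longrightarrow> x \<in> closure (moved (f (Suc n))) \<Longrightarrow>
      zpow (f n) (int m) x \<notin> closure (moved (f (Suc n))) \<and> zpow (f n) (- int m) x \<notin> closure (moved (f (Suc n)))"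
    by metis
  define h where "h n = zpow (f n) (int (M n))" for n
  \<comment> \<open>The first set is enlarged to the whole line, as \<open>wr_tower\<close> demands;
    the others are the supports.\<close>
  define D where "D n = (case n of 0 \<Rightarrow> UNIV | Suc m \<Rightarrow> moved (f n))" for n
  have hH: "h n \<in> H" for n unfolding h_def by (rule zpow_mem[OF f(1)])
  have mvD: "moved (f n) \<subseteq> D n" for n by (cases n) (auto simp: D_def)
  have "wr_tower h D"
  proof
    show "bij (h n)" for n by (rule bijH[OF hH])
    show "D 0 = UNIV" by (simp add: D_def)
    show "D n \<noteq> {}" for n
    proof -
      have "moved (f n) \<noteq> {}" using f(2)[of n] by (auto simp: moved_def fun_eq_iff)
      then show ?thesis using mvD by blast
    qed
    show "D (Suc n) \<subseteq> D n" for n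
    proof -
      have "D (Suc n) = moved (f (Suc n))" by (simp add: D_def)
      then show ?thesis using f(3)[of n] closure_subset mvD by blast
    qed
    show "moved (h n) \<subseteq> D n" for n
      unfolding h_def using moved_zpow[OF bijH[OF f(1)]] mvD by blast
    show "zpow (h n) k x \<notin> D (Suc n)" if "k \<noteq> 0" "x \<in> D (Suc n)" for k x n
    proof -
      have x: "x \<in> moved (f (Suc n))" and D: "D (Suc n) = moved (f (Suc n))" using that(2) by (simp_all add: D_def)
      define m where "m = M n * nat \<bar>k\<bar>"
      have "int (M n) * k = int m \<or> int (M n) * k = - int m" by (auto simp: m_def abs_if)
      moreover have "nat \<bar>k\<bar> \<ge> 1" using that(1) by simp
      then have "m \<ge> M n" unfolding m_def by (cases "nat \<bar>k\<bar>") auto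
      ultimately have "zpow (f n) (int (M n) * k) x \<notin> closure (moved (f (Suc n)))"
        using M(2)[of n m x] x closure_subset by fastforce
      then show ?thesis
        unfolding D h_def zpow_mult[OF bijH[OF f(1)]] using closure_subset by blast
    qed
  qed
  then show ?thesis using that hH by blast
qed

section \<open>The concrete group of piecewise linear homeomorphisms\<close>

lemma list_crossing:
  assumes "xs \<noteq> []" "Q (hd xs)" "\<not> Q (last xs)"
  shows "\<exists>i. Suc i < length xs \<and> Q (xs ! i) \<and> \<not> Q (xs ! Suc i)"
proof (rule ccontr)
  assume "\<not> ?thesis"
  then have step: "Q (xs ! Suc i)" if "Suc i < length xs" "Q (xs ! i)" for i using that by blast
  have "i < length xs \<Longrightarrow> Q (xs ! i)" for i
    by (induction i) (use assms step in \<open>auto simp: hd_conv_nth\<close>)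
  then show False using assms by (simp add: last_conv_nth)
qed

lemma PLo_homeo:
  assumes "f \<in> PLo" shows "homeo f" "f 0 = 0" "f 1 = 1"
proof -
  have out: "f x = x" if "x \<notin> {0..1}" for x using assms that by (simp add: PLo_def)
  have im: "f ` {0..1} = {0..1}" and sm: "strict_mono_on {0..1} f" using assms by (auto simp: PLo_def)
  have in01: "0 \<le> f x \<and> f x \<le> 1" if "0 \<le> x" "x \<le> 1" for x
    using imageI[of x "{0..1}" f] that unfolding im by simp
  have "f x < f y" if "x < y" for x y
  proof (cases "x \<in> {0..1} \<and> y \<in> {0..1}")
    case True
    then show ?thesis using strict_mono_onD[OF sm] that by blast
  next
    case False
    then show ?thesis using out[of x] out[of y] in01[of x] in01[of y] that by force
  qed
  then have mono: "strict_mono f" by (simp add: strict_mono_def)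
  have "y \<in> range f" for y
  proof (cases "y \<in> {0..1}")
    case False
    then show ?thesis using out by (metis rangeI)
  qed (use im in blast)
  then show h: "homeo f" using mono by (auto simp: homeo_def)
  have "0 \<in> f ` {0..1}" "1 \<in> f ` {0..1}" unfolding im by simp_all
  then obtain a b where ab: "a \<in> {0..1}" "f a = 0" "b \<in> {0..1}" "f b = 1" by fastforce
  then show "f 0 = 0" "f 1 = 1"
    using in01[of 0] in01[of 1] homeo_le_iff[OF h, of 0 a] homeo_le_iff[OF h, of b 1] by auto
qed

lemma PLo_pl_homeo:
  assumes "f \<in> PLo" shows "pl_homeo f"
  unfolding pl_homeo_def
proof (intro conjI allI impI)
  show "homeo f" by (rule PLo_homeo[OF assms])
  have out: "f x = x" if "x \<le> 0 \<or> 1 \<le> x" for x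
    using assms that PLo_homeo(2,3)[OF assms] by (cases "x = 0 \<or> x = 1") (auto simp: PLo_def)
  then show "f x = x" if "x \<le> 0 \<or> 1 \<le> x" for x using that .
  obtain ts :: "real list" where ts: "length ts \<ge> 2" "hd ts = 0" "last ts = 1"
    and lin: "\<And>i. Suc i < length ts \<Longrightarrow> \<exists>a b. \<forall>x \<in> {ts ! i .. ts ! Suc i}. f x = a * x + b"
    using assms unfolding PLo_def PL_piecewise_linear_def by blast
  have ne: "ts \<noteq> []" using ts by auto
  fix e F assume "germ e F"
  then consider "F = at_right e" | "F = at_left e" by (auto simp: germ_def)
  then show "\<exists>a. \<forall>\<^sub>F x in F. f x = f e + a * (x - e)"
  proof cases
    case 1
    have "\<exists>c>e. \<exists>a b. \<forall>x \<in> {e..c}. f x = a * x + b"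
    proof (cases "0 \<le> e \<and> e < 1")
      case True
      \<comment> \<open>The crossing in the list of breakpoints locates the linear piece starting at
        or containing \<open>e\<close> and extending to its right; the left germ below uses the
        strict comparison instead.\<close>
      obtain i where i: "Suc i < length ts" "ts ! i \<le> e" "\<not> ts ! Suc i \<le> e"
        using list_crossing[of ts "\<lambda>t. t \<le> e"] ne ts True by auto
      obtain a b where "\<forall>x \<in> {ts ! i .. ts ! Suc i}. f x = a * x + b" using lin[OF i(1)] by blast
      then have "\<forall>x \<in> {e .. ts ! Suc i}. f x = a * x + b" using i(2) by auto
      then show ?thesis using i(3) by (meson not_le)
    next
      case False
      define c where "c = (if e < 0 then 0 else e + 1)"
      have "\<forall>x\<in>{e..c}. f x = 1 * x + 0" using False by (auto simp: c_def intro!: out)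
      moreover have "c > e" by (simp add: c_def)
      ultimately show ?thesis by blast
    qed
    then obtain c a b where c: "c > e" "\<forall>x \<in> {e..c}. f x = a * x + b" by blast
    have "f x = f e + a * (x - e)" if "e < x" "x < c" for x
      using c(2) that c(1) by (simp add: algebra_simps)
    then show ?thesis unfolding 1 eventually_at_right_field using c(1) by blast
  next
    case 2
    have "\<exists>c<e. \<exists>a b. \<forall>x \<in> {c..e}. f x = a * x + b"
    proof (cases "0 < e \<and> e \<le> 1")
      case True
      obtain i where i: "Suc i < length ts" "ts ! i < e" "\<not> ts ! Suc i < e"
        using list_crossing[of ts "\<lambda>t. t < e"] ne ts True by auto
      obtain a b where "\<forall>x \<in> {ts ! i .. ts ! Suc i}. f x = a * x + b" using lin[OF i(1)] by blast
      then have "\<forall>x \<in> {ts ! i .. e}. f x = a * x + b" using i(3) by auto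
      then show ?thesis using i(2) by blast
    next
      case False
      define c where "c = (if e > 1 then 1 else e - 1)"
      have "\<forall>x\<in>{c..e}. f x = 1 * x + 0" using False by (auto simp: c_def intro!: out)
      moreover have "c < e" by (simp add: c_def)
      ultimately show ?thesis by blast
    qed
    then obtain c a b where c: "c < e" "\<forall>x \<in> {c..e}. f x = a * x + b" by blast
    have "f x = f e + a * (x - e)" if "c < x" "x < e" for x
      using c(2) that c(1) by (simp add: algebra_simps)
    then show ?thesis unfolding 2 eventually_at_left_field using c(1) by blast
  qed
qed

text \<open>Needed to identify the group inverse in \<open>PLo_group\<close> with the inverse
  function. The images of the breakpoints serve as breakpoints, and slopes are nonzero by strict
  monotonicity.\<close>

lemma PLo_inv:
  assumes "f \<in> PLo" shows "inv f \<in> PLo"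
proof -
  note h = PLo_homeo[OF assms]
  note hi = homeo_inv[OF h(1)]
  have "inv f x = x" if "x \<notin> {0..1}" for x
    using homeo_inv1[OF h(1), of x] assms that by (simp add: PLo_def)
  moreover have "strict_mono_on {0..1} (inv f)" using hi by (simp add: homeo_def strict_mono_on_def strict_mono_def)
  moreover have "inv f ` {0..1} = {0..1}"
  proof -
    have "inv f ` (f ` {0..1}) = {0..1}" using h(1) by (simp add: image_image)
    then show ?thesis using assms by (simp add: PLo_def)
  qed
  moreover have "PL_piecewise_linear (inv f)"
  proof -
    obtain ts :: "real list" where ts: "length ts \<ge> 2" "sorted_wrt (<) ts" "hd ts = 0" "last ts = 1"
      and lin: "\<And>i. Suc i < length ts \<Longrightarrow> \<exists>a b. \<forall>x \<in> {ts ! i .. ts ! Suc i}. f x = a * x + b"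
      using assms unfolding PLo_def PL_piecewise_linear_def by blast
    have ne: "ts \<noteq> []" using ts by auto
    have "\<exists>c d. \<forall>y \<in> {f (ts ! i) .. f (ts ! Suc i)}. inv f y = c * y + d" if i: "Suc i < length ts" for i
    proof -
      obtain a b where ab: "\<And>x. x \<in> {ts ! i .. ts ! Suc i} \<Longrightarrow> f x = a * x + b" using lin[OF i] by blast
      have lt: "ts ! i < ts ! Suc i" using sorted_wrt_nth_less[OF ts(2)] i by simp
      then have "f (ts ! i) < f (ts ! Suc i)" using homeo_less_iff[OF h(1)] by simp
      then have "a \<noteq> 0" using ab[of "ts ! i"] ab[of "ts ! Suc i"] lt by auto
      have "inv f y = (1 / a) * y + (- b / a)" if y: "y \<in> {f (ts ! i) .. f (ts ! Suc i)}" for y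
      proof -
        have "inv f y \<in> {ts ! i .. ts ! Suc i}"
          using y homeo_le_iff[OF h(1), of "ts ! i" "inv f y"] homeo_le_iff[OF h(1), of "inv f y" "ts ! Suc i"] h(1) by simp
        then have "y = a * inv f y + b" using ab h(1) by (metis homeo_inv2)
        then show ?thesis using \<open>a \<noteq> 0\<close> by (simp add: field_simps)
      qed
      then show ?thesis by blast
    qed
    moreover have "sorted_wrt (<) (map f ts)"
      unfolding sorted_wrt_map using ts(2) homeo_less_iff[OF h(1)] by simp
    ultimately show ?thesis unfolding PL_piecewise_linear_def
      by (intro exI[of _ "map f ts"]) (use ts ne h in \<open>simp add: hd_map last_map\<close>)
  qed
  ultimately show ?thesis using homeo_continuous[OF hi] by (simp add: PLo_def)
qed

lemma m_inv_PLo_group: "f \<in> PLo \<Longrightarrow> m_inv PLo_group f = inv f"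
proof -
  assume f: "f \<in> PLo"
  then have h: "homeo f" by (rule PLo_homeo)
  have fi: "f \<circ> inv f = id" "inv f \<circ> f = id" using h by (auto simp: fun_eq_iff)
  have "(THE y. y \<in> PLo \<and> y \<circ> f = id \<and> f \<circ> y = id) = inv f"
  proof (rule the_equality)
    show "inv f \<in> PLo \<and> inv f \<circ> f = id \<and> f \<circ> inv f = id" using PLo_inv[OF f] fi by blast
    show "y = inv f" if "y \<in> PLo \<and> y \<circ> f = id \<and> f \<circ> y = id" for y
      using that inv_unique_comp[of f y] by simp
  qed
  then show ?thesis by (simp add: m_inv_def PLo_group_def)
qed

lemma subgroup_PLo_group_iff:
  "subgroup H PLo_group \<longleftrightarrow> H \<subseteq> PLo \<and> id \<in> H \<and> (\<forall>f\<in>H. \<forall>g\<in>H. f \<circ> g \<in> H) \<and> (\<forall>f\<in>H. inv f \<in> H)"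
proof -
  have [simp]: "carrier PLo_group = PLo" "\<And>f g. f \<otimes>\<^bsub>PLo_group\<^esub> g = g \<circ> f" "\<one>\<^bsub>PLo_group\<^esub> = id"
    by (simp_all add: PLo_group_def)
  show ?thesis
  proof
    assume s: "subgroup H PLo_group"
    then have H: "H \<subseteq> PLo" using subgroup.subset by fastforce
    moreover have "inv f \<in> H" if "f \<in> H" for f
      using subgroup.m_inv_closed[OF s that] m_inv_PLo_group H that by auto
    moreover have "f \<circ> g \<in> H" if "f \<in> H" "g \<in> H" for f g
      using subgroup.m_closed[OF s that(2,1)] by simp
    moreover have "id \<in> H" using subgroup.one_closed[OF s] by simp
    ultimately show "H \<subseteq> PLo \<and> id \<in> H \<and> (\<forall>f\<in>H. \<forall>g\<in>H. f \<circ> g \<in> H) \<and> (\<forall>f\<in>H. inv f \<in> H)" by blast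
  next
    assume H: "H \<subseteq> PLo \<and> id \<in> H \<and> (\<forall>f\<in>H. \<forall>g\<in>H. f \<circ> g \<in> H) \<and> (\<forall>f\<in>H. inv f \<in> H)"
    then have "m_inv PLo_group f \<in> H" if "f \<in> H" for f using m_inv_PLo_group that by auto
    then show "subgroup H PLo_group" using H by (intro subgroup.intro) simp_all
  qed
qed

section \<open>Towers of orbitals and the embedded wreath product\<close>

lemma orbitals_orb:
  assumes "pl_homeo g" "A \<in> orbitals g"
  obtains u v where "A = {u<..<v}" "orb g u v"
proof -
  have supp: "supp g = moved g"
    using pl_homeo_outside[OF assms(1)] by (force simp: supp_def moved_def)
  have A: "A \<in> components (moved g)" using assms(2) by (simp add: orbitals_def supp)
  obtain x where x: "x \<in> A" using in_components_nonempty[OF A] by blast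
  have sub: "A \<subseteq> moved g" and con: "connected A" using in_components_subset[OF A] in_components_connected[OF A] by auto
  obtain u v where uv: "orb g u v" "u < x" "x < v" using ex_orb[OF assms(1), of x] sub x by (auto simp: moved_def)
  have nu: "u \<notin> A" "v \<notin> A" using sub uv(1) by (auto simp: orb_def moved_def)
  \<comment> \<open>The interval is connected, moved and meets \<open>A\<close>, so maximality of
    components applies; conversely \<open>A\<close> cannot pass the fixed points \<open>u\<close>
    and \<open>v\<close>.\<close>
  have "{u<..<v} \<subseteq> A"
    by (rule components_maximal[OF A]) (use uv x in \<open>auto simp: orb_def moved_def\<close>)
  moreover have "A \<subseteq> {u<..<v}"
  proof
    fix y assume y: "y \<in> A"
    have "z \<in> A" if "y \<le> z \<and> z \<le> x \<or> x \<le> z \<and> z \<le> y" for z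
      using connectedD_interval[OF con y x, of z] connectedD_interval[OF con x y, of z] that by blast
    then show "y \<in> {u<..<v}" using nu uv by (metis greaterThanLessThan_iff less_imp_le not_le)
  qed
  ultimately show ?thesis using that uv(1) by blast
qed

lemma deep_tower_of_tower:
  assumes pl: "\<And>g. g \<in> H \<Longrightarrow> pl_homeo g" and T: "tower H T" "deep T"
  shows "\<exists>a b. deep_tower H a b"
proof -
  obtain \<phi> :: "int \<Rightarrow> real set \<times> (real \<Rightarrow> real)" where \<phi>: "\<And>n. n < 0 \<Longrightarrow> \<phi> n \<in> T"
    "inj_on \<phi> {n. n < 0}" "\<And>m n. m < n \<Longrightarrow> n < 0 \<Longrightarrow> fst (\<phi> m) \<subseteq> fst (\<phi> n)"
    using T(2) unfolding deep_def by blast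
  \<comment> \<open>The negative indices are reversed: \<open>k = 0\<close> corresponds to -1, the
    largest orbital, and growing \<open>k\<close> goes down the tower.\<close>
  define s where "s k = \<phi> (- int k - 1)" for k
  have sT: "s k \<in> T" for k by (simp add: s_def \<phi>(1))
  have gk: "snd (s k) \<in> H" "fst (s k) \<in> orbitals (snd (s k))" for k
    using sT[of k] T(1) by (auto simp: tower_def signed_orbitals_def)
  then have "\<exists>u v. fst (s k) = {u<..<v} \<and> orb (snd (s k)) u v" for k
    using orbitals_orb[OF pl] by metis
  then obtain u v where uv: "\<And>k. fst (s k) = {u k<..<v k}" "\<And>k. orb (snd (s k)) (u k) (v k)" by metis
  have lt: "u k < v k" for k using uv(2) by (simp add: orb_def)
  have "nest u v" unfolding nest_def
  proof (intro allI conjI)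
    fix k
    have "fst (s (Suc k)) \<subseteq> fst (s k)" by (simp add: s_def \<phi>(3))
    then show "u k \<le> u (Suc k)" "v (Suc k) \<le> v k"
      using lt[of "Suc k"] by (simp_all add: uv(1) greaterThanLessThan_subseteq_greaterThanLessThan)
    have "s k \<noteq> s (Suc k)" using inj_onD[OF \<phi>(2), of "- int k - 1" "- int (Suc k) - 1"] by (auto simp: s_def)
    then have "fst (s k) \<noteq> fst (s (Suc k))" using T(1) sT by (simp add: tower_def)
    then show "(u k, v k) \<noteq> (u (Suc k), v (Suc k))" by (auto simp: uv(1))
  qed
  then show ?thesis unfolding deep_tower_def using gk(1) uv(2)
    by (intro exI[of _ "u 0"] exI[of _ "v 0"] exI[of _ "\<lambda>k. snd (s k)"] exI[of _ u] exI[of _ v]) simp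
qed

theorem theorem8:
  assumes "subgroup H PLo_group"
    and "tower H T" and "deep T"
  shows "\<exists>K. subgroup K PLo_group \<and> K \<subseteq> H \<and> PLo_group\<lparr>carrier := K\<rparr> \<cong> WrZ_inf"
proof -
  note H = assms(1)[unfolded subgroup_PLo_group_iff]
  interpret pl_group H using H PLo_pl_homeo by unfold_locales blast+
  obtain a b where "deep_tower H a b" using deep_tower_of_tower[OF pl assms(2,3)] by blast
  from descending_wr_tower[OF deep_tower_descending[OF this]]
  obtain h D where hD: "wr_tower h D" "\<And>n. h n \<in> H" by blast
  interpret wr_tower h D by (rule hD(1))
  define K where "K = snd ` gam"
  have KH: "K \<subseteq> H" unfolding K_def
    by (rule snd_gam_subset[OF id_mem comp_mem inv_mem hD(2)])
  have "subgroup K PLo_group" unfolding subgroup_PLo_group_iff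
  proof (intro conjI ballI)
    show "K \<subseteq> PLo" using KH H by blast
    show "id \<in> K" unfolding K_def by (rule image_eqI[OF _ gam.one]) simp
    fix f assume f: "f \<in> K"
    then obtain \<phi> where \<phi>: "(\<phi>, f) \<in> gam" by (auto simp: K_def)
    show "inv f \<in> K" unfolding K_def by (rule image_eqI[OF _ gam_inv[OF \<phi>]]) simp
    fix g assume "g \<in> K"
    then obtain \<psi> where \<psi>: "(\<psi>, g) \<in> gam" by (auto simp: K_def)
    show "f \<circ> g \<in> K" unfolding K_def by (rule image_eqI[OF _ gam.eng[OF \<phi> \<psi>]]) simp
  qed
  moreover have "PLo_group\<lparr>carrier := K\<rparr> \<cong> WrZ_inf"
    by (rule ex_iso_WrZ_inf) (simp_all add: PLo_group_def K_def)
  ultimately show ?thesis using KH by blast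
qed

end
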